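(* The group $G=S(2^\infty)\ltimes \widetilde C(X;\mathbb{Z}_2)$ is amenable, ICC, contains a non-trivial abelian normal subgroup (namely $\widetilde C(X;\mathbb{Z}_2)$), and has the ISR property: every $G$-invariant von Neumann subalgebra of $L(G)$ is of the form $L(N)$ for a normal subgroup $N\trianglelefteq G$.
   Context: For a countable discrete group $G$, $L(G)\subseteq B(\ell^2(G))$ is the group von Neumann algebra generated by the unitaries $u_g$, $u_g\delta_h=\delta_{gh}$, with trace $\tau(x)=\langle\delta_e,x\delta_e\rangle$; for a subgroup $N$, $L(N)$ is the von Neumann subalgebra generated by $\{u_g:g\in N\}$. A von Neumann subalgebra $\mathcal M\subseteq L(G)$ is $G$-invariant if $u_g\mathcal M u_g^*\subseteq\mathcal M$ for all $g\in G$. $G$ has the ISR property if every $G$-invariant von Neumann subalgebra of $L(G)$ equals $L(N)$ for some normal subgroup $N\trianglelefteq G$. For $n\ge1$ let $S(2^n)$ be the symmetric group of the finite set $\{0,1\}^n$, embedded in $S(2^{n+1})$ via $s\mapsto\tilde s$, $\tilde s(x,y)=(s(x),y)$ ($x\in\{0,1\}^n$, $y\in\{0,1\}$); $S(2^\infty)=\bigcup_n S(2^n)$. Let $X=\{0,1\}^{\mathbb N}$; $S(2^\infty)$ acts on $X$ by homeomorphisms via $s(x,y)=(s(x),y)$ for $s\in S(2^n)$, $x\in\{0,1\}^n$, $y\in\{0,1\}^{\mathbb N}$. $C(X;\mathbb Z_2)$ is the abelian group of continuous maps $X\to\mathbb Z_2$ under pointwise addition; its elements are $f_A=\mathbf 1_A$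 for clopen $A\subseteq X$, with $f_Af_B=f_{A\triangle B}$. $S(2^\infty)$ acts by $g\cdot f_A=f_{g(A)}$. The constant functions $\{f_\emptyset,f_X\}$ form an invariant subgroup and $\widetilde C(X;\mathbb Z_2)$ is the quotient group; $\widetilde f_A$ denotes the class of $f_A$ (so $\widetilde f_A=\widetilde f_{X\setminus A}$). $G=S(2^\infty)\ltimes\widetilde C(X;\mathbb Z_2)$, with $g\widetilde f_Ag^{-1}=\widetilde f_{g(A)}$. *)

theory Defs
  imports "HOL-Analysis.Analysis" "HOL-Algebra.Algebra" "HOL-Combinatorics.Permutations"
begin

definition amenable_grp :: "('a, 'b) monoid_scheme \<Rightarrow> bool" where
  "amenable_grp G \<longleftrightarrow> (\<exists>\<mu> :: 'a set \<Rightarrow> real.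
      \<mu> (carrier G) = 1 \<and>
      (\<forall>A. A \<subseteq> carrier G \<longrightarrow> 0 \<le> \<mu> A) \<and>
      (\<forall>A B. A \<subseteq> carrier G \<longrightarrow> B \<subseteq> carrier G \<longrightarrow> A \<inter> B = {} \<longrightarrow>
          \<mu> (A \<union> B) = \<mu> A + \<mu> B) \<and>
      (\<forall>g A. g \<in> carrier G \<longrightarrow> A \<subseteq> carrier G \<longrightarrow> \<mu> (g <#\<^bsub>G\<^esub> A) = \<mu> A))"

definition icc_grp :: "('a, 'b) monoid_scheme \<Rightarrow> bool" where
  "icc_grp G \<longleftrightarrow> (\<forall>g \<in> carrier G. g \<noteq> \<one>\<^bsub>G\<^esub> \<longrightarrow>
      infinite {h \<otimes>\<^bsub>G\<^esub> g \<otimes>\<^bsub>G\<^esub> inv\<^bsub>G\<^esub> h | h. h \<in> carrier G})"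

definition l2 :: "('a, 'b) monoid_scheme \<Rightarrow> ('a \<Rightarrow> complex) set" where
  "l2 G = {\<xi>. (\<forall>g. g \<notin> carrier G \<longrightarrow> \<xi> g = 0) \<and>
                 (\<lambda>g. (cmod (\<xi> g))\<^sup>2) summable_on carrier G}"

definition inner_l2 :: "('a, 'b) monoid_scheme \<Rightarrow> ('a \<Rightarrow> complex) \<Rightarrow> ('a \<Rightarrow> complex) \<Rightarrow> complex" where
  "inner_l2 G \<xi> \<eta> = infsum (\<lambda>g. cnj (\<xi> g) * \<eta> g) (carrier G)"

definition norm_l2 :: "('a, 'b) monoid_scheme \<Rightarrow> ('a \<Rightarrow> complex) \<Rightarrow> real" where
  "norm_l2 G \<xi> = sqrt (infsum (\<lambda>g. (cmod (\<xi> g))\<^sup>2) (carrier G))"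

text \<open>Bounded linear operators on l2(G). An operator is a function on
type a => complex; to have a canonical representative it is required
to vanish outside l2(G).\<close>
definition Bop :: "('a, 'b) monoid_scheme \<Rightarrow> (('a \<Rightarrow> complex) \<Rightarrow> ('a \<Rightarrow> complex)) set" where
  "Bop G = {T. (\<forall>\<xi>. \<xi> \<notin> l2 G \<longrightarrow> T \<xi> = (\<lambda>_. 0)) \<and>
               (\<forall>\<xi> \<in> l2 G. T \<xi> \<in> l2 G) \<and>
               (\<forall>\<xi> \<in> l2 G. \<forall>\<eta> \<in> l2 G. T (\<lambda>g. \<xi> g + \<eta> g) = (\<lambda>g. T \<xi> g + T \<eta> g)) \<and>
               (\<forall>\<xi> \<in> l2 G. \<forall>a::complex. T (\<lambda>g. a * \<xi> g) = (\<lambda>g. a * T \<xi> g)) \<and>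
               (\<exists>C. \<forall>\<xi> \<in> l2 G. norm_l2 G (T \<xi>) \<le> C * norm_l2 G \<xi>)}"

definition idop :: "('a, 'b) monoid_scheme \<Rightarrow> ('a \<Rightarrow> complex) \<Rightarrow> ('a \<Rightarrow> complex)" where
  "idop G = (\<lambda>\<xi>. if \<xi> \<in> l2 G then \<xi> else (\<lambda>_. 0))"

definition is_adjoint :: "('a, 'b) monoid_scheme \<Rightarrow> (('a \<Rightarrow> complex) \<Rightarrow> ('a \<Rightarrow> complex))
     \<Rightarrow> (('a \<Rightarrow> complex) \<Rightarrow> ('a \<Rightarrow> complex)) \<Rightarrow> bool" where
  "is_adjoint G T S \<longleftrightarrow> (\<forall>\<xi> \<in> l2 G. \<forall>\<eta> \<in> l2 G. inner_l2 G (S \<xi>) \<eta> = inner_l2 G \<xi> (T \<eta>))"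

definition adj :: "('a, 'b) monoid_scheme \<Rightarrow> (('a \<Rightarrow> complex) \<Rightarrow> ('a \<Rightarrow> complex))
     \<Rightarrow> (('a \<Rightarrow> complex) \<Rightarrow> ('a \<Rightarrow> complex))" where
  "adj G T = (SOME S. S \<in> Bop G \<and> is_adjoint G T S)"

definition wot_closed :: "('a, 'b) monoid_scheme \<Rightarrow> (('a \<Rightarrow> complex) \<Rightarrow> ('a \<Rightarrow> complex)) set \<Rightarrow> bool" where
  "wot_closed G M \<longleftrightarrow> (\<forall>T \<in> Bop G.
      (\<forall>F \<epsilon>. finite F \<longrightarrow> F \<subseteq> l2 G \<times> l2 G \<longrightarrow> \<epsilon> > 0 \<longrightarrow>
          (\<exists>S \<in> M. \<forall>(\<xi>, \<eta>) \<in> F. cmod (inner_l2 G \<xi> (T \<eta>) - inner_l2 G \<xi> (S \<eta>)) < \<epsilon>))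
      \<longrightarrow> T \<in> M)"

definition is_vNa :: "('a, 'b) monoid_scheme \<Rightarrow> (('a \<Rightarrow> complex) \<Rightarrow> ('a \<Rightarrow> complex)) set \<Rightarrow> bool" where
  "is_vNa G M \<longleftrightarrow> M \<subseteq> Bop G \<and> idop G \<in> M \<and>
     (\<forall>T \<in> M. \<forall>S \<in> M. (\<lambda>\<xi> g. T \<xi> g + S \<xi> g) \<in> M) \<and>
     (\<forall>T \<in> M. \<forall>a::complex. (\<lambda>\<xi> g. a * T \<xi> g) \<in> M) \<and>
     (\<forall>T \<in> M. \<forall>S \<in> M. T \<circ> S \<in> M) \<and>
     (\<forall>T \<in> M. \<exists>S \<in> M. is_adjoint G T S) \<and>
     wot_closed G M"

definition vN_gen :: "('a, 'b) monoid_scheme \<Rightarrow> (('a \<Rightarrow> complex) \<Rightarrow> ('a \<Rightarrow> complex)) set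
     \<Rightarrow> (('a \<Rightarrow> complex) \<Rightarrow> ('a \<Rightarrow> complex)) set" where
  "vN_gen G S = \<Inter> {M. is_vNa G M \<and> S \<subseteq> M}"

definition lreg :: "('a, 'b) monoid_scheme \<Rightarrow> 'a \<Rightarrow> ('a \<Rightarrow> complex) \<Rightarrow> ('a \<Rightarrow> complex)" where
  "lreg G g = (\<lambda>\<xi>. if \<xi> \<in> l2 G
      then (\<lambda>h. if h \<in> carrier G then \<xi> (inv\<^bsub>G\<^esub> g \<otimes>\<^bsub>G\<^esub> h) else 0) else (\<lambda>_. 0))"

definition grpvN :: "('a, 'b) monoid_scheme \<Rightarrow> 'a set \<Rightarrow> (('a \<Rightarrow> complex) \<Rightarrow> ('a \<Rightarrow> complex)) set" where
  "grpvN G N = vN_gen G (lreg G ` N)"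

definition G_invariant :: "('a, 'b) monoid_scheme \<Rightarrow> (('a \<Rightarrow> complex) \<Rightarrow> ('a \<Rightarrow> complex)) set \<Rightarrow> bool" where
  "G_invariant G M \<longleftrightarrow> (\<forall>g \<in> carrier G. \<forall>x \<in> M. lreg G g \<circ> x \<circ> adj G (lreg G g) \<in> M)"

definition ISR :: "('a, 'b) monoid_scheme \<Rightarrow> bool" where
  "ISR G \<longleftrightarrow> (\<forall>M. is_vNa G M \<and> M \<subseteq> grpvN G (carrier G) \<and> G_invariant G M \<longrightarrow>
      (\<exists>N. N \<lhd> G \<and> M = grpvN G N))"

text \<open>X = {0,1}^N as nat \<Rightarrow> bool, with the product topology of discrete bool.
{0,1}^n is represented as the functions vanishing from index n on.\<close>
type_synonym cantor = "nat \<Rightarrow> bool"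

definition cube :: "nat \<Rightarrow> cantor set" where
  "cube n = {v. \<forall>k \<ge> n. \<not> v k}"

definition trunc :: "nat \<Rightarrow> cantor \<Rightarrow> cantor" where
  "trunc n x = (\<lambda>k. k < n \<and> x k)"

definition lift_perm :: "nat \<Rightarrow> (cantor \<Rightarrow> cantor) \<Rightarrow> cantor \<Rightarrow> cantor" where
  "lift_perm n s = (\<lambda>x k. if k < n then s (trunc n x) k else x k)"

definition S2inf :: "(cantor \<Rightarrow> cantor) set" where
  "S2inf = (\<Union>n. {lift_perm n s | s. s permutes cube n})"

definition clopen :: "cantor set \<Rightarrow> bool" where
  "clopen A \<longleftrightarrow> open A \<and> closed A"

text \<open>An element of C~(X;Z_2) is the class {A, X - A} of a clopen set A
(f_A and f_(X-A) are identified).\<close>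
definition Ctil :: "cantor set set set" where
  "Ctil = {{A, - A} | A. clopen A}"

definition cmult :: "cantor set set \<Rightarrow> cantor set set \<Rightarrow> cantor set set" where
  "cmult c d = {(A - B) \<union> (B - A) | A B. A \<in> c \<and> B \<in> d}"

definition cact :: "(cantor \<Rightarrow> cantor) \<Rightarrow> cantor set set \<Rightarrow> cantor set set" where
  "cact \<sigma> c = (\<lambda>A. \<sigma> ` A) ` c"

text \<open>Elements written as f~_A \<cdot> \<sigma>; (f~_A \<sigma>)(f~_B \<tau>) = f~_(A symdiff \<sigma>(B)) \<sigma>\<tau>,
which encodes \<sigma> f~_B \<sigma>^-1 = f~_(\<sigma>(B)).\<close>
definition Gsd :: "(cantor set set \<times> (cantor \<Rightarrow> cantor)) monoid" where
  "Gsd = \<lparr> carrier = Ctil \<times> S2inf,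
           mult = (\<lambda>(c, \<sigma>) (d, \<tau>). (cmult c (cact \<sigma> d), \<sigma> \<circ> \<tau>)),
           one = ({{}, UNIV}, id) \<rparr>"

definition Csub :: "(cantor set set \<times> (cantor \<Rightarrow> cantor)) set" where
  "Csub = Ctil \<times> {id}"

end

theory Submission
  imports Defs
begin

text \<open>
  \<open>G\<close> is the increasing union of the finite subgroups \<open>G\<^sub>n\<close> of elements depending on the first \<open>n\<close>
  coordinates only. Permutations \<open>c\<^sub>i\<close> of the remaining coordinates commute with \<open>G\<^sub>n\<close>, while
  \<open>c\<^sub>i g c\<^sub>i\<close> leaves every finite set when \<open>g\<close> is not in \<open>G\<^sub>n\<close>. This gives ICC, and it shows that for an
  invariant von Neumann subalgebra \<open>M\<close> the truncation of \<open>x \<in> M\<close> to \<open>G\<^sub>n\<close>, being the weak limit of the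
  conjugates of \<open>x\<close> by the \<open>c\<^sub>i\<close>, again lies in \<open>M\<close>. Hence \<open>M\<close> is determined by its finitely supported
  elements, the conditional expectation \<open>E\<close> onto \<open>M\<close> maps \<open>\<complex>[G\<^sub>n]\<close> to itself, and it suffices to show
  that the finitely supported elements of \<open>M\<close> are combinations of group elements in \<open>M\<close>.

  Suppose \<open>E f \<noteq> 0\<close> for some \<open>f \<noteq> 1\<close> in the abelian normal subgroup \<open>A\<close>. Invariance of \<open>E f\<close> under the
  centralizer of \<open>f\<close> forces \<open>E f = f\<close>, and the conjugates of \<open>f\<close> generate \<open>A\<close>, so \<open>A \<subseteq> M\<close>. If there is no
  such \<open>f\<close>, then \<open>M\<close> is trivial: for a finitely supported \<open>a \<in> M\<close> and \<open>f \<in> A\<close> in general position,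
  \<open>a* f a (inv f)\<close> has a nonzero coefficient at a nontrivial element of \<open>A\<close> unless \<open>a\<close> is scalar. Finally, if
  \<open>A \<subseteq> M\<close> and \<open>E g \<noteq> 0\<close> for some \<open>g\<close> with nontrivial permutation part, then some commutators of \<open>g\<close> lie
  in \<open>M\<close>; they are products of two transpositions of cylinders, which generate all permutations.
\<close>

subsection \<open>Square-summable functions\<close>

definition delta :: "'a \<Rightarrow> 'a \<Rightarrow> complex" where
  "delta g = (\<lambda>h. if h = g then 1 else 0)"

definition cutoff :: "'a set \<Rightarrow> ('a \<Rightarrow> complex) \<Rightarrow> 'a \<Rightarrow> complex" where
  "cutoff F \<xi> = (\<lambda>h. if h \<in> F then \<xi> h else 0)"

lemma l2_outside: "\<xi> \<in> l2 G \<Longrightarrow> g \<notin> carrier G \<Longrightarrow> \<xi> g = 0"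
  by (simp add: l2_def)

lemma l2_summable: "\<xi> \<in> l2 G \<Longrightarrow> (\<lambda>g. (cmod (\<xi> g))\<^sup>2) summable_on carrier G"
  by (simp add: l2_def)

lemma norm_l2_nonneg: "0 \<le> norm_l2 G \<xi>"
  by (auto simp: norm_l2_def intro!: infsum_nonneg)

lemma L2_set_le_norm_l2:
  assumes "\<xi> \<in> l2 G" "finite F" "F \<subseteq> carrier G"
  shows "L2_set (\<lambda>g. cmod (\<xi> g)) F \<le> norm_l2 G \<xi>"
  unfolding L2_set_def norm_l2_def
  by (intro real_sqrt_le_mono finite_sum_le_infsum) (use assms l2_summable in auto)

lemma cmod_le_norm_l2:
  assumes "\<xi> \<in> l2 G"
  shows "cmod (\<xi> g) \<le> norm_l2 G \<xi>"
proof (cases "g \<in> carrier G")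
  case True
  then show ?thesis using L2_set_le_norm_l2[OF assms, of "{g}"] by simp
qed (simp add: l2_outside[OF assms] norm_l2_nonneg)

lemma norm_l2_eq_0:
  assumes "\<xi> \<in> l2 G" "norm_l2 G \<xi> = 0"
  shows "\<xi> = (\<lambda>_. 0)"
  using cmod_le_norm_l2[OF assms(1)] assms(2) by fastforce

lemma l2_if_finite_norms_bounded:
  assumes outside: "\<And>g. g \<notin> carrier G \<Longrightarrow> \<xi> g = 0"
    and bound: "\<And>F. finite F \<Longrightarrow> F \<subseteq> carrier G \<Longrightarrow> L2_set (\<lambda>g. cmod (\<xi> g)) F \<le> B"
  shows "\<xi> \<in> l2 G" "norm_l2 G \<xi> \<le> B"
proof -
  have "0 \<le> B" using bound[of "{}"] by simp
  have sum_bound: "(\<Sum>g\<in>F. (cmod (\<xi> g))\<^sup>2) \<le> B\<^sup>2" if "finite F" "F \<subseteq> carrier G" for F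
    using bound[OF that] unfolding L2_set_def by (rule sqrt_le_D)
  have summable: "(\<lambda>g. (cmod (\<xi> g))\<^sup>2) summable_on carrier G"
    using sum_bound by (intro nonneg_bdd_above_summable_on bdd_aboveI2[where M="B\<^sup>2"]) auto
  then show "\<xi> \<in> l2 G" using outside by (simp add: l2_def)
  have "infsum (\<lambda>g. (cmod (\<xi> g))\<^sup>2) (carrier G) \<le> B\<^sup>2"
    by (rule infsum_le_finite_sums[OF summable sum_bound])
  then show "norm_l2 G \<xi> \<le> B"
    unfolding norm_l2_def using \<open>0 \<le> B\<close> by (rule real_le_lsqrt[rotated])
qed

lemma
  assumes "\<xi> \<in> l2 G" "\<eta> \<in> l2 G"
  shows l2_add: "(\<lambda>g. \<xi> g + \<eta> g) \<in> l2 G"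
    and norm_l2_add: "norm_l2 G (\<lambda>g. \<xi> g + \<eta> g) \<le> norm_l2 G \<xi> + norm_l2 G \<eta>"
proof -
  have finite_bound: "L2_set (\<lambda>g. cmod (\<xi> g + \<eta> g)) F \<le> norm_l2 G \<xi> + norm_l2 G \<eta>"
    if "finite F" "F \<subseteq> carrier G" for F
  proof -
    have "L2_set (\<lambda>g. cmod (\<xi> g + \<eta> g)) F \<le> L2_set (\<lambda>g. cmod (\<xi> g) + cmod (\<eta> g)) F"
      by (rule L2_set_mono) (auto intro: norm_triangle_ineq)
    also have "\<dots> \<le> L2_set (\<lambda>g. cmod (\<xi> g)) F + L2_set (\<lambda>g. cmod (\<eta> g)) F"
      by (rule L2_set_triangle_ineq)
    also have "\<dots> \<le> norm_l2 G \<xi> + norm_l2 G \<eta>"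
      using L2_set_le_norm_l2 assms that by (intro add_mono) auto
    finally show ?thesis .
  qed
  have outside: "\<xi> g + \<eta> g = 0" if "g \<notin> carrier G" for g
    using assms that by (simp add: l2_outside)
  show "(\<lambda>g. \<xi> g + \<eta> g) \<in> l2 G" "norm_l2 G (\<lambda>g. \<xi> g + \<eta> g) \<le> norm_l2 G \<xi> + norm_l2 G \<eta>"
    using l2_if_finite_norms_bounded[OF outside finite_bound] by auto
qed

lemma
  assumes "\<xi> \<in> l2 G"
  shows l2_scale: "(\<lambda>g. a * \<xi> g) \<in> l2 G"
    and norm_l2_scale: "norm_l2 G (\<lambda>g. a * \<xi> g) = cmod a * norm_l2 G \<xi>"
proof -
  have "(\<lambda>g. (cmod a)\<^sup>2 * (cmod (\<xi> g))\<^sup>2) summable_on carrier G"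
    using l2_summable[OF assms] by (rule summable_on_cmult_right)
  then show "(\<lambda>g. a * \<xi> g) \<in> l2 G"
    using assms by (simp add: l2_def norm_mult power_mult_distrib)
  show "norm_l2 G (\<lambda>g. a * \<xi> g) = cmod a * norm_l2 G \<xi>"
    by (simp add: norm_l2_def norm_mult power_mult_distrib infsum_cmult_right' real_sqrt_mult)
qed

lemma l2_zero: "(\<lambda>_. 0) \<in> l2 G"
  by (simp add: l2_def)

lemma
  assumes "\<xi> \<in> l2 G" "\<eta> \<in> l2 G"
  shows l2_diff: "(\<lambda>g. \<xi> g - \<eta> g) \<in> l2 G"
    and norm_l2_diff: "norm_l2 G (\<lambda>g. \<xi> g - \<eta> g) \<le> norm_l2 G \<xi> + norm_l2 G \<eta>"
  using l2_add[OF assms(1) l2_scale[OF assms(2)], of "-1"]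
    norm_l2_add[OF assms(1) l2_scale[OF assms(2)], of "-1"] norm_l2_scale[OF assms(2), of "-1"]
  by simp_all

lemma
  assumes "finite F" "F \<subseteq> carrier G" "\<And>g. g \<notin> F \<Longrightarrow> \<xi> g = 0"
  shows l2_finite_support: "\<xi> \<in> l2 G"
    and norm_l2_finite_support: "norm_l2 G \<xi> = L2_set (\<lambda>g. cmod (\<xi> g)) F"
proof -
  have "(\<lambda>g. (cmod (\<xi> g))\<^sup>2) summable_on carrier G \<longleftrightarrow> (\<lambda>g. (cmod (\<xi> g))\<^sup>2) summable_on F"
    by (rule summable_on_cong_neutral) (use assms in auto)
  then show "\<xi> \<in> l2 G" using assms by (auto simp: l2_def)
  have "infsum (\<lambda>g. (cmod (\<xi> g))\<^sup>2) (carrier G) = infsum (\<lambda>g. (cmod (\<xi> g))\<^sup>2) F"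
    by (rule infsum_cong_neutral) (use assms in auto)
  then show "norm_l2 G \<xi> = L2_set (\<lambda>g. cmod (\<xi> g)) F"
    using assms by (simp add: norm_l2_def L2_set_def)
qed

lemma l2_delta: "g \<in> carrier G \<Longrightarrow> delta g \<in> l2 G"
  by (rule l2_finite_support[of "{g}"]) (auto simp: delta_def)

lemma norm_l2_delta: "g \<in> carrier G \<Longrightarrow> norm_l2 G (delta g) = 1"
  by (subst norm_l2_finite_support[of "{g}"]) (auto simp: delta_def)

lemma l2_cutoff:
  assumes "\<xi> \<in> l2 G"
  shows "cutoff F \<xi> \<in> l2 G"
proof -
  have "(\<lambda>g. (cmod (cutoff F \<xi> g))\<^sup>2) summable_on carrier G"
    by (rule summable_on_comparison_test[OF l2_summable[OF assms]]) (auto simp: cutoff_def)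
  then show ?thesis using assms by (auto simp: l2_def cutoff_def)
qed

lemma inner_abs_summable:
  assumes "\<xi> \<in> l2 G" "\<eta> \<in> l2 G"
  shows "(\<lambda>g. cmod (cnj (\<xi> g) * \<eta> g)) summable_on carrier G"
  by (rule abs_summable_product)
    (use l2_summable assms in \<open>auto simp: norm_mult power2_eq_square\<close>)

lemma inner_summable:
  assumes "\<xi> \<in> l2 G" "\<eta> \<in> l2 G"
  shows "(\<lambda>g. cnj (\<xi> g) * \<eta> g) summable_on carrier G"
  by (rule Infinite_Sum.abs_summable_summable[OF inner_abs_summable[OF assms]])

lemma inner_cauchy_schwarz:
  assumes "\<xi> \<in> l2 G" "\<eta> \<in> l2 G"
  shows "cmod (inner_l2 G \<xi> \<eta>) \<le> norm_l2 G \<xi> * norm_l2 G \<eta>"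
proof -
  have "cmod (inner_l2 G \<xi> \<eta>) \<le> infsum (\<lambda>g. cmod (cnj (\<xi> g) * \<eta> g)) (carrier G)"
    unfolding inner_l2_def by (rule norm_infsum_bound[OF inner_abs_summable[OF assms]])
  also have "\<dots> \<le> norm_l2 G \<xi> * norm_l2 G \<eta>"
  proof (rule infsum_le_finite_sums[OF inner_abs_summable[OF assms]])
    fix F assume F_finite: "finite F" and F_carrier: "F \<subseteq> carrier G"
    have "(\<Sum>g\<in>F. cmod (cnj (\<xi> g) * \<eta> g)) \<le> L2_set (\<lambda>g. cmod (\<xi> g)) F * L2_set (\<lambda>g. cmod (\<eta> g)) F"
      using L2_set_mult_ineq[of "\<lambda>g. cmod (\<xi> g)" "\<lambda>g. cmod (\<eta> g)" F] by (simp add: norm_mult)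
    also have "\<dots> \<le> norm_l2 G \<xi> * norm_l2 G \<eta>"
      using F_finite F_carrier L2_set_le_norm_l2 assms by (intro mult_mono norm_l2_nonneg) auto
    finally show "(\<Sum>g\<in>F. cmod (cnj (\<xi> g) * \<eta> g)) \<le> norm_l2 G \<xi> * norm_l2 G \<eta>" .
  qed
  finally show ?thesis .
qed

lemma inner_add_right:
  assumes "\<xi> \<in> l2 G" "\<eta> \<in> l2 G" "\<zeta> \<in> l2 G"
  shows "inner_l2 G \<xi> (\<lambda>g. \<eta> g + \<zeta> g) = inner_l2 G \<xi> \<eta> + inner_l2 G \<xi> \<zeta>"
  unfolding inner_l2_def distrib_left by (intro infsum_add inner_summable assms)

lemma inner_scale_right: "inner_l2 G \<xi> (\<lambda>g. a * \<eta> g) = a * inner_l2 G \<xi> \<eta>"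
  unfolding inner_l2_def by (simp add: mult.left_commute infsum_cmult_right')

lemma inner_cnj: "inner_l2 G \<xi> \<eta> = cnj (inner_l2 G \<eta> \<xi>)"
  unfolding inner_l2_def by (simp add: mult.commute flip: infsum_cnj)

lemma inner_add_left:
  assumes "\<xi> \<in> l2 G" "\<eta> \<in> l2 G" "\<zeta> \<in> l2 G"
  shows "inner_l2 G (\<lambda>g. \<eta> g + \<zeta> g) \<xi> = inner_l2 G \<eta> \<xi> + inner_l2 G \<zeta> \<xi>"
  using inner_add_right[OF assms] by (subst (1 2 3) inner_cnj) simp

lemma inner_scale_left: "inner_l2 G (\<lambda>g. a * \<eta> g) \<xi> = cnj a * inner_l2 G \<eta> \<xi>"
  by (subst (1 2) inner_cnj) (simp add: inner_scale_right)

lemma inner_diff_right: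
  assumes "\<xi> \<in> l2 G" "\<eta> \<in> l2 G" "\<zeta> \<in> l2 G"
  shows "inner_l2 G \<xi> (\<lambda>g. \<eta> g - \<zeta> g) = inner_l2 G \<xi> \<eta> - inner_l2 G \<xi> \<zeta>"
  using inner_add_right[OF assms(1,2) l2_scale[OF assms(3), of "-1"]]
    inner_scale_right[of G \<xi> "-1" \<zeta>]
  by simp

lemma inner_diff_left:
  assumes "\<xi> \<in> l2 G" "\<eta> \<in> l2 G" "\<zeta> \<in> l2 G"
  shows "inner_l2 G (\<lambda>g. \<eta> g - \<zeta> g) \<xi> = inner_l2 G \<eta> \<xi> - inner_l2 G \<zeta> \<xi>"
  using inner_diff_right[OF assms] by (subst (1 2 3) inner_cnj) simp

lemma inner_delta_left: "g \<in> carrier G \<Longrightarrow> inner_l2 G (delta g) \<xi> = \<xi> g"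
  unfolding inner_l2_def
  by (subst infsum_cong_neutral[where T="{g}" and g="\<lambda>_. \<xi> g"]) (auto simp: delta_def)

lemma inner_delta_right: "g \<in> carrier G \<Longrightarrow> inner_l2 G \<xi> (delta g) = cnj (\<xi> g)"
  by (subst inner_cnj) (simp add: inner_delta_left)

lemma inner_self:
  assumes "\<xi> \<in> l2 G"
  shows "inner_l2 G \<xi> \<xi> = complex_of_real ((norm_l2 G \<xi>)\<^sup>2)"
proof -
  have "((\<lambda>g. complex_of_real ((cmod (\<xi> g))\<^sup>2)) has_sum
      complex_of_real (infsum (\<lambda>g. (cmod (\<xi> g))\<^sup>2) (carrier G))) (carrier G)"
    by (intro has_sum_of_real has_sum_infsum l2_summable assms)
  then show ?thesis
    by (simp add: infsumI inner_l2_def norm_l2_def infsum_nonneg complex_norm_square mult.commute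
        del: of_real_power)
qed

lemma inner_cutoff_left: "inner_l2 G (cutoff F \<xi>) \<eta> = inner_l2 G \<xi> (cutoff F \<eta>)"
  unfolding inner_l2_def by (rule infsum_cong) (simp add: cutoff_def)

lemma inner_cutoff_self:
  assumes "\<xi> \<in> l2 G"
  shows "inner_l2 G \<xi> (cutoff F \<xi>) = complex_of_real ((norm_l2 G (cutoff F \<xi>))\<^sup>2)"
proof -
  have "inner_l2 G \<xi> (cutoff F \<xi>) = inner_l2 G (cutoff F \<xi>) (cutoff F \<xi>)"
    unfolding inner_l2_def by (rule infsum_cong) (simp add: cutoff_def)
  then show ?thesis using inner_self[OF l2_cutoff[OF assms]] by simp
qed

lemma inner_cutoff_finite:
  assumes "finite F" "F \<subseteq> carrier G"
  shows "inner_l2 G (cutoff F \<xi>) \<eta> = (\<Sum>k\<in>F. cnj (\<xi> k) * \<eta> k)"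
proof -
  have "inner_l2 G (cutoff F \<xi>) \<eta> = infsum (\<lambda>k. cnj (\<xi> k) * \<eta> k) F"
    unfolding inner_l2_def by (rule infsum_cong_neutral) (use assms(2) in \<open>auto simp: cutoff_def\<close>)
  then show ?thesis using assms(1) by simp
qed

lemma l2_ext:
  assumes "\<xi> \<in> l2 G" "\<eta> \<in> l2 G" "\<And>\<zeta>. \<zeta> \<in> l2 G \<Longrightarrow> inner_l2 G \<zeta> \<xi> = inner_l2 G \<zeta> \<eta>"
  shows "\<xi> = \<eta>"
proof
  fix g show "\<xi> g = \<eta> g"
  proof (cases "g \<in> carrier G")
    case True then show ?thesis using assms(3)[OF l2_delta[OF True]] by (simp add: inner_delta_left)
  qed (use assms in \<open>simp add: l2_outside\<close>)
qed

lemma l2_finite_approx: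
  assumes "\<xi> \<in> l2 G" "\<epsilon> > 0"
  obtains F where "finite F" "F \<subseteq> carrier G" "norm_l2 G (\<lambda>g. \<xi> g - cutoff F \<xi> g) < \<epsilon>"
proof -
  let ?f = "\<lambda>g. (cmod (\<xi> g))\<^sup>2"
  note summable = l2_summable[OF assms(1)]
  obtain F where F_finite: "finite F" and F_carrier: "F \<subseteq> carrier G"
      and F_approx: "dist (sum ?f F) (infsum ?f (carrier G)) \<le> \<epsilon>\<^sup>2 / 2"
    using infsum_finite_approximation[OF summable, of "\<epsilon>\<^sup>2 / 2"] assms(2) by auto
  have "infsum (\<lambda>g. (cmod (\<xi> g - cutoff F \<xi> g))\<^sup>2) (carrier G) = infsum ?f (carrier G - F)"
    by (rule infsum_cong_neutral) (auto simp: cutoff_def)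
  also have "\<dots> = infsum ?f (carrier G) - sum ?f F"
    using F_finite F_carrier F_approx summable
    by (subst infsum_Diff) (auto simp: summable_on_finite)
  also have "\<dots> \<le> \<epsilon>\<^sup>2 / 2"
    using abs_le_D2[OF F_approx[unfolded dist_real_def]] by simp
  also have "\<dots> < \<epsilon>\<^sup>2" using assms(2) by simp
  finally have "norm_l2 G (\<lambda>g. \<xi> g - cutoff F \<xi> g) < \<epsilon>"
    unfolding norm_l2_def using assms(2) by (simp add: real_less_lsqrt)
  then show ?thesis using F_finite F_carrier F_approx that by blast
qed

lemma l2_vanishes_at_infinity:
  assumes "\<xi> \<in> l2 G" "\<epsilon> > 0"
  obtains F where "finite F" "F \<subseteq> carrier G" "\<And>h. h \<notin> F \<Longrightarrow> cmod (\<xi> h) < \<epsilon>"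
proof -
  obtain F where F_finite: "finite F" and F_carrier: "F \<subseteq> carrier G"
      and tail_small: "norm_l2 G (\<lambda>g. \<xi> g - cutoff F \<xi> g) < \<epsilon>"
    using l2_finite_approx[OF assms] .
  have "cmod (\<xi> h) < \<epsilon>" if "h \<notin> F" for h
    using cmod_le_norm_l2[OF l2_diff[OF assms(1) l2_cutoff[OF assms(1), of F]], of h] that
      tail_small
    by (simp add: cutoff_def)
  then show ?thesis using F_finite F_carrier tail_small that by blast
qed

lemma l2_pointwise_limit:
  assumes "\<And>i. v i \<in> l2 G" "\<And>i. norm_l2 G (v i) \<le> K"
    and "\<And>g. (\<lambda>i. v i g) \<longlonglongrightarrow> w g"
  shows "w \<in> l2 G" "norm_l2 G w \<le> K"
proof -
  have outside: "w g = 0" if "g \<notin> carrier G" for g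
    using assms(3)[of g] l2_outside[OF assms(1) that] by (simp add: LIMSEQ_const_iff)
  have finite_bound: "L2_set (\<lambda>g. cmod (w g)) F \<le> K" if "finite F" "F \<subseteq> carrier G" for F
  proof (rule LIMSEQ_le_const2)
    show "(\<lambda>i. L2_set (\<lambda>g. cmod (v i g)) F) \<longlonglongrightarrow> L2_set (\<lambda>g. cmod (w g)) F"
      unfolding L2_set_def by (intro tendsto_intros assms(3))
    show "\<exists>N. \<forall>i\<ge>N. L2_set (\<lambda>g. cmod (v i g)) F \<le> K"
      using L2_set_le_norm_l2[OF assms(1) that] assms(2) order_trans by blast
  qed
  show "w \<in> l2 G" by (rule l2_if_finite_norms_bounded(1)[OF outside finite_bound])
  show "norm_l2 G w \<le> K" by (rule l2_if_finite_norms_bounded(2)[OF outside finite_bound])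
qed

lemma l2_weakly_null:
  assumes d_l2: "\<And>i. d i \<in> l2 G" and d_norm: "\<And>i. norm_l2 G (d i) \<le> K"
    and lim: "\<And>g. (\<lambda>i. d i g) \<longlonglongrightarrow> 0" and \<zeta>_l2: "\<zeta> \<in> l2 G"
  shows "(\<lambda>i. inner_l2 G \<zeta> (d i)) \<longlonglongrightarrow> 0"
proof (rule LIMSEQ_I)
  fix r :: real assume "0 < r"
  have "0 \<le> K" using norm_l2_nonneg d_norm by (rule order_trans)
  define \<epsilon> where "\<epsilon> = r / (2 * (K + 1))"
  have "0 < \<epsilon>" using \<open>0 < r\<close> \<open>0 \<le> K\<close> by (simp add: \<epsilon>_def)
  then obtain F where F_finite: "finite F" and F_carrier: "F \<subseteq> carrier G"
      and tail_small: "norm_l2 G (\<lambda>g. \<zeta> g - cutoff F \<zeta> g) < \<epsilon>"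
    using l2_finite_approx[OF \<zeta>_l2] by blast
  have tail: "cmod (inner_l2 G (\<lambda>g. \<zeta> g - cutoff F \<zeta> g) (d i)) \<le> r / 2" for i
  proof -
    have "cmod (inner_l2 G (\<lambda>g. \<zeta> g - cutoff F \<zeta> g) (d i)) \<le>
        norm_l2 G (\<lambda>g. \<zeta> g - cutoff F \<zeta> g) * norm_l2 G (d i)"
      by (intro inner_cauchy_schwarz l2_diff l2_cutoff \<zeta>_l2 d_l2)
    also have "\<dots> \<le> \<epsilon> * (K + 1)"
      using tail_small d_norm[of i] \<open>0 < \<epsilon>\<close> by (intro mult_mono norm_l2_nonneg) auto
    also have "\<dots> = r / 2" using \<open>0 \<le> K\<close> by (simp add: \<epsilon>_def field_simps)
    finally show ?thesis .
  qed
  have "(\<lambda>i. \<Sum>k\<in>F. cnj (\<zeta> k) * d i k) \<longlonglongrightarrow> (\<Sum>k\<in>F. cnj (\<zeta> k) * 0)"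
    by (intro tendsto_intros lim)
  then obtain n where head_small: "\<And>i. i \<ge> n \<Longrightarrow> cmod (\<Sum>k\<in>F. cnj (\<zeta> k) * d i k) < r / 2"
    using LIMSEQ_D[of "\<lambda>i. \<Sum>k\<in>F. cnj (\<zeta> k) * d i k" 0 "r / 2"] \<open>0 < r\<close> by auto
  have "cmod (inner_l2 G \<zeta> (d i) - 0) < r" if "i \<ge> n" for i
  proof -
    have "inner_l2 G \<zeta> (d i) - 0 =
        inner_l2 G (cutoff F \<zeta>) (d i) + inner_l2 G (\<lambda>g. \<zeta> g - cutoff F \<zeta> g) (d i)"
      using inner_diff_left[OF d_l2[of i] \<zeta>_l2 l2_cutoff[OF \<zeta>_l2, of F]] by simp
    moreover have "cmod (inner_l2 G (cutoff F \<zeta>) (d i)) +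
        cmod (inner_l2 G (\<lambda>g. \<zeta> g - cutoff F \<zeta> g) (d i)) < r"
      using head_small[OF that] tail[of i] unfolding inner_cutoff_finite[OF F_finite F_carrier]
      by linarith
    ultimately show ?thesis by (simp only: norm_triangle_lt)
  qed
  then show "\<exists>n. \<forall>i\<ge>n. cmod (inner_l2 G \<zeta> (d i) - 0) < r" by blast
qed

lemma l2_weak_limit:
  assumes v_l2: "\<And>i. v i \<in> l2 G" and v_norm: "\<And>i. norm_l2 G (v i) \<le> K"
    and lim: "\<And>g. (\<lambda>i. v i g) \<longlonglongrightarrow> w g" and \<zeta>_l2: "\<zeta> \<in> l2 G"
  shows "(\<lambda>i. inner_l2 G \<zeta> (v i)) \<longlonglongrightarrow> inner_l2 G \<zeta> w"
proof -
  note w = l2_pointwise_limit[OF v_l2 v_norm lim]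
  have "(\<lambda>i. inner_l2 G \<zeta> (\<lambda>g. v i g - w g)) \<longlonglongrightarrow> 0"
  proof (rule l2_weakly_null[OF l2_diff[OF v_l2 w(1)] _ LIM_zero[OF lim] \<zeta>_l2])
    show "norm_l2 G (\<lambda>g. v i g - w g) \<le> K + K" for i
      using norm_l2_diff[OF v_l2 w(1), of i] v_norm[of i] w(2) by linarith
  qed
  then show ?thesis by (simp add: inner_diff_right[OF \<zeta>_l2 v_l2 w(1)] LIM_zero_iff)
qed

context
  fixes G :: "('a, 'b) monoid_scheme" and \<phi> :: "('a \<Rightarrow> complex) \<Rightarrow> complex" and K :: real
  assumes add: "\<And>\<xi> \<eta>. \<xi> \<in> l2 G \<Longrightarrow> \<eta> \<in> l2 G \<Longrightarrow> \<phi> (\<lambda>g. \<xi> g + \<eta> g) = \<phi> \<xi> + \<phi> \<eta>"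
    and scale: "\<And>\<xi> a. \<xi> \<in> l2 G \<Longrightarrow> \<phi> (\<lambda>g. a * \<xi> g) = a * \<phi> \<xi>"
    and bound: "\<And>\<xi>. \<xi> \<in> l2 G \<Longrightarrow> cmod (\<phi> \<xi>) \<le> K * norm_l2 G \<xi>"
    and K_nonneg: "0 \<le> K"
begin

lemma functional_cutoff:
  assumes "finite F" "F \<subseteq> carrier G"
  shows "\<phi> (cutoff F \<xi>) = (\<Sum>k\<in>F. \<xi> k * \<phi> (delta k))"
  using assms
proof (induction F)
  case empty
  then show ?case using scale[OF l2_zero, of 0] by (simp add: cutoff_def)
next
  case (insert k F)
  have "cutoff (insert k F) \<xi> = (\<lambda>g. \<xi> k * delta k g + cutoff F \<xi> g)"
    using insert.hyps(2) by (auto simp: cutoff_def delta_def)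
  moreover have "cutoff F \<xi> \<in> l2 G"
    by (rule l2_finite_support[of F]) (use insert in \<open>auto simp: cutoff_def\<close>)
  ultimately show ?case
    using insert by (simp add: add scale l2_scale l2_delta)
qed

definition riesz_vector :: "'a \<Rightarrow> complex" where
  "riesz_vector = (\<lambda>k. if k \<in> carrier G then cnj (\<phi> (delta k)) else 0)"

lemma
  shows l2_riesz_vector: "riesz_vector \<in> l2 G" and norm_riesz_vector: "norm_l2 G riesz_vector \<le> K"
proof -
  have "L2_set (\<lambda>k. cmod (riesz_vector k)) F \<le> K" (is "?n \<le> K")
    if F_finite: "finite F" and F_carrier: "F \<subseteq> carrier G" for F
  proof -
    have cutoff: "cutoff F riesz_vector \<in> l2 G" "norm_l2 G (cutoff F riesz_vector) = ?n"
      using l2_finite_support[OF F_finite F_carrier, of "cutoff F riesz_vector"]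
        norm_l2_finite_support[OF F_finite F_carrier, of "cutoff F riesz_vector"]
      by (auto simp: cutoff_def cong: L2_set_cong)
    have "\<phi> (cutoff F riesz_vector) = (\<Sum>k\<in>F. complex_of_real ((cmod (riesz_vector k))\<^sup>2))"
      unfolding functional_cutoff[OF F_finite F_carrier]
      by (rule sum.cong) (use F_finite F_carrier in
        \<open>auto simp: complex_norm_square riesz_vector_def simp del: of_real_power\<close>)
    also have "\<dots> = complex_of_real (?n\<^sup>2)" by (simp add: L2_set_def sum_nonneg del: of_real_power)
    finally have "?n\<^sup>2 \<le> K * ?n"
      using bound[OF cutoff(1)] cutoff(2) by (simp del: of_real_power)
    then show ?thesis
      using K_nonneg L2_set_nonneg[of "\<lambda>k. cmod (riesz_vector k)" F]
      by (cases "?n = 0") (auto simp: power2_eq_square)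
  qed
  then show "riesz_vector \<in> l2 G" "norm_l2 G riesz_vector \<le> K"
    using l2_if_finite_norms_bounded[of G riesz_vector] by (auto simp: riesz_vector_def)
qed

lemma inner_riesz_vector:
  assumes \<xi>_l2: "\<xi> \<in> l2 G"
  shows "inner_l2 G riesz_vector \<xi> = \<phi> \<xi>"
proof -
  let ?d = "\<lambda>F g. \<xi> g - cutoff F \<xi> g"
  have split: "\<phi> \<xi> - inner_l2 G riesz_vector \<xi> = \<phi> (?d F) - inner_l2 G riesz_vector (?d F)"
    if F_finite: "finite F" and F_carrier: "F \<subseteq> carrier G" for F
  proof -
    have "\<phi> (cutoff F \<xi>) = inner_l2 G riesz_vector (cutoff F \<xi>)"
      unfolding functional_cutoff[OF F_finite F_carrier] inner_cutoff_left[symmetric]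
        inner_cutoff_finite[OF F_finite F_carrier]
      using F_carrier by (auto simp: riesz_vector_def intro!: sum.cong)
    moreover have "\<phi> \<xi> = \<phi> (?d F) + \<phi> (cutoff F \<xi>)"
      using add[OF l2_diff[OF \<xi>_l2 l2_cutoff[OF \<xi>_l2]] l2_cutoff[OF \<xi>_l2], of F F] by simp
    ultimately show ?thesis
      using inner_diff_right[OF l2_riesz_vector \<xi>_l2 l2_cutoff[OF \<xi>_l2], of F] by simp
  qed
  have "cmod (\<phi> \<xi> - inner_l2 G riesz_vector \<xi>) \<le> 0 + \<epsilon>" if "\<epsilon> > 0" for \<epsilon>
  proof -
    have pos: "0 < \<epsilon> / (2 * K + 1)" using that K_nonneg by simp
    obtain F where F_finite: "finite F" and F_carrier: "F \<subseteq> carrier G"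
        and tail_small: "norm_l2 G (?d F) < \<epsilon> / (2 * K + 1)"
      using l2_finite_approx[OF \<xi>_l2 pos] .
    have tail_l2: "?d F \<in> l2 G" by (intro l2_diff l2_cutoff \<xi>_l2)
    have "cmod (\<phi> \<xi> - inner_l2 G riesz_vector \<xi>) \<le>
        cmod (\<phi> (?d F)) + cmod (inner_l2 G riesz_vector (?d F))"
      unfolding split[OF F_finite F_carrier] by (rule norm_triangle_ineq4)
    also have "\<dots> \<le> K * norm_l2 G (?d F) + K * norm_l2 G (?d F)"
      using inner_cauchy_schwarz[OF l2_riesz_vector tail_l2]
        mult_right_mono[OF norm_riesz_vector norm_l2_nonneg[of G "?d F"]] bound[OF tail_l2]
      by linarith
    also have "\<dots> \<le> (2 * K + 1) * norm_l2 G (?d F)"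
      using norm_l2_nonneg[of G "?d F"] by (simp add: algebra_simps)
    also have "\<dots> \<le> \<epsilon>" using tail_small K_nonneg by (simp add: field_simps)
    finally show ?thesis by simp
  qed
  then have "cmod (\<phi> \<xi> - inner_l2 G riesz_vector \<xi>) \<le> 0" by (rule field_le_epsilon)
  then show ?thesis by simp
qed

end

lemma riesz_representation:
  fixes \<phi> :: "('a \<Rightarrow> complex) \<Rightarrow> complex"
  assumes "\<And>\<xi> \<eta>. \<xi> \<in> l2 G \<Longrightarrow> \<eta> \<in> l2 G \<Longrightarrow> \<phi> (\<lambda>g. \<xi> g + \<eta> g) = \<phi> \<xi> + \<phi> \<eta>"
    and "\<And>\<xi> a. \<xi> \<in> l2 G \<Longrightarrow> \<phi> (\<lambda>g. a * \<xi> g) = a * \<phi> \<xi>"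
    and "\<And>\<xi>. \<xi> \<in> l2 G \<Longrightarrow> cmod (\<phi> \<xi>) \<le> K * norm_l2 G \<xi>" and "0 \<le> K"
  shows "\<exists>\<zeta>\<in>l2 G. norm_l2 G \<zeta> \<le> K \<and> (\<forall>\<xi>\<in>l2 G. inner_l2 G \<zeta> \<xi> = \<phi> \<xi>)"
  using l2_riesz_vector[OF assms] norm_riesz_vector[OF assms] inner_riesz_vector[OF assms] by blast

subsection \<open>Bounded operators\<close>

definition op_bound :: "('a, 'b) monoid_scheme \<Rightarrow> real \<Rightarrow> (('a \<Rightarrow> complex) \<Rightarrow> 'a \<Rightarrow> complex) \<Rightarrow> bool"
  where
  "op_bound G C T \<longleftrightarrow> 0 \<le> C \<and> (\<forall>\<xi>\<in>l2 G. norm_l2 G (T \<xi>) \<le> C * norm_l2 G \<xi>)"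

lemma op_boundD: "op_bound G C T \<Longrightarrow> \<xi> \<in> l2 G \<Longrightarrow> norm_l2 G (T \<xi>) \<le> C * norm_l2 G \<xi>"
  by (simp add: op_bound_def)

lemma BopD:
  assumes "T \<in> Bop G"
  shows "\<xi> \<notin> l2 G \<Longrightarrow> T \<xi> = (\<lambda>_. 0)"
    and "\<xi> \<in> l2 G \<Longrightarrow> T \<xi> \<in> l2 G"
    and "\<xi> \<in> l2 G \<Longrightarrow> \<eta> \<in> l2 G \<Longrightarrow> T (\<lambda>g. \<xi> g + \<eta> g) = (\<lambda>g. T \<xi> g + T \<eta> g)"
    and "\<xi> \<in> l2 G \<Longrightarrow> T (\<lambda>g. a * \<xi> g) = (\<lambda>g. a * T \<xi> g)"
  using assms unfolding Bop_def by blast+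

lemma Bop_l2: "T \<in> Bop G \<Longrightarrow> T \<xi> \<in> l2 G"
  using BopD(1,2)[of T G \<xi>] l2_zero[of G] by (cases "\<xi> \<in> l2 G") simp_all

lemma Bop_bounded:
  assumes "T \<in> Bop G"
  obtains C where "op_bound G C T"
proof -
  obtain C where C_bound: "\<And>\<xi>. \<xi> \<in> l2 G \<Longrightarrow> norm_l2 G (T \<xi>) \<le> C * norm_l2 G \<xi>"
    using assms unfolding Bop_def by blast
  have "norm_l2 G (T \<xi>) \<le> \<bar>C\<bar> * norm_l2 G \<xi>" if "\<xi> \<in> l2 G" for \<xi>
    using C_bound[OF that] mult_right_mono[OF abs_ge_self[of C] norm_l2_nonneg[of G \<xi>]] by linarith
  then show ?thesis using that[of "\<bar>C\<bar>"] by (simp add: op_bound_def)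
qed

lemma BopI:
  assumes "\<And>\<xi>. \<xi> \<notin> l2 G \<Longrightarrow> T \<xi> = (\<lambda>_. 0)"
    and "\<And>\<xi>. \<xi> \<in> l2 G \<Longrightarrow> T \<xi> \<in> l2 G"
    and "\<And>\<xi> \<eta>. \<xi> \<in> l2 G \<Longrightarrow> \<eta> \<in> l2 G \<Longrightarrow> T (\<lambda>g. \<xi> g + \<eta> g) = (\<lambda>g. T \<xi> g + T \<eta> g)"
    and "\<And>\<xi> a. \<xi> \<in> l2 G \<Longrightarrow> T (\<lambda>g. a * \<xi> g) = (\<lambda>g. a * T \<xi> g)"
    and "\<And>\<xi>. \<xi> \<in> l2 G \<Longrightarrow> norm_l2 G (T \<xi>) \<le> C * norm_l2 G \<xi>"
  shows "T \<in> Bop G"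
  unfolding Bop_def using assms by blast

lemma Bop_zero: "T \<in> Bop G \<Longrightarrow> T (\<lambda>_. 0) = (\<lambda>_. 0)"
  using BopD(4)[OF _ l2_zero, of T G 0] by simp

lemma Bop_ext:
  assumes "T \<in> Bop G" "S \<in> Bop G" "\<And>\<xi>. \<xi> \<in> l2 G \<Longrightarrow> T \<xi> = S \<xi>"
  shows "T = S"
  using assms BopD(1) by (metis ext)

lemma Bop_idop: "idop G \<in> Bop G"
  by (rule BopI[where C=1]) (auto simp: idop_def l2_add l2_scale)

lemma Bop_add:
  assumes "T \<in> Bop G" "S \<in> Bop G"
  shows "(\<lambda>\<xi> g. T \<xi> g + S \<xi> g) \<in> Bop G"
proof -
  obtain C D where T_bound: "op_bound G C T" and S_bound: "op_bound G D S"
    using Bop_bounded assms by metis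
  show ?thesis
  proof (rule BopI[where C="C + D"])
    fix \<xi> assume \<xi>_l2: "\<xi> \<in> l2 G"
    show "norm_l2 G (\<lambda>g. T \<xi> g + S \<xi> g) \<le> (C + D) * norm_l2 G \<xi>"
      using norm_l2_add[OF Bop_l2[OF assms(1)] Bop_l2[OF assms(2)], of \<xi> \<xi>]
        op_boundD[OF T_bound \<xi>_l2] op_boundD[OF S_bound \<xi>_l2] by (simp add: distrib_right)
  qed (use assms in \<open>auto simp: BopD l2_add algebra_simps\<close>)
qed

lemma Bop_scale:
  assumes "T \<in> Bop G"
  shows "(\<lambda>\<xi> g. a * T \<xi> g) \<in> Bop G"
proof -
  obtain C where T_bound: "op_bound G C T" using Bop_bounded assms by metis
  show ?thesis
  proof (rule BopI[where C="cmod a * C"])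
    fix \<xi> assume \<xi>_l2: "\<xi> \<in> l2 G"
    show "norm_l2 G (\<lambda>g. a * T \<xi> g) \<le> cmod a * C * norm_l2 G \<xi>"
      using op_boundD[OF T_bound \<xi>_l2] Bop_l2[OF assms]
      by (simp add: norm_l2_scale mult_left_mono mult.assoc)
  qed (use assms in \<open>auto simp: BopD l2_scale algebra_simps\<close>)
qed

lemma Bop_comp:
  assumes "T \<in> Bop G" "S \<in> Bop G"
  shows "T \<circ> S \<in> Bop G"
proof -
  obtain C D where T_bound: "op_bound G C T" and S_bound: "op_bound G D S"
    using Bop_bounded assms by metis
  show ?thesis
  proof (rule BopI[where C="C * D"])
    fix \<xi> assume \<xi>_l2: "\<xi> \<in> l2 G"
    have "norm_l2 G (T (S \<xi>)) \<le> C * norm_l2 G (S \<xi>)"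
      by (rule op_boundD[OF T_bound Bop_l2[OF assms(2)]])
    also have "\<dots> \<le> C * (D * norm_l2 G \<xi>)"
      using op_boundD[OF S_bound \<xi>_l2] T_bound by (simp add: mult_left_mono op_bound_def)
    finally show "norm_l2 G ((T \<circ> S) \<xi>) \<le> C * D * norm_l2 G \<xi>" by (simp add: mult.assoc)
  qed (use assms in \<open>auto simp: BopD Bop_zero\<close>)
qed

lemma is_adjointD:
  "is_adjoint G T S \<Longrightarrow> \<xi> \<in> l2 G \<Longrightarrow> \<eta> \<in> l2 G \<Longrightarrow> inner_l2 G (S \<xi>) \<eta> = inner_l2 G \<xi> (T \<eta>)"
  by (simp add: is_adjoint_def)

lemma is_adjoint_sym: "is_adjoint G T S \<Longrightarrow> is_adjoint G S T"
  unfolding is_adjoint_def by (metis inner_cnj)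

lemma is_adjoint_unique:
  assumes "S \<in> Bop G" "S' \<in> Bop G" "is_adjoint G T S" "is_adjoint G T S'"
  shows "S = S'"
proof (rule Bop_ext[OF assms(1,2)])
  fix \<xi> assume \<xi>_l2: "\<xi> \<in> l2 G"
  show "S \<xi> = S' \<xi>"
  proof (rule l2_ext[OF Bop_l2[OF assms(1)] Bop_l2[OF assms(2)]])
    fix \<zeta> assume "\<zeta> \<in> l2 G"
    then show "inner_l2 G \<zeta> (S \<xi>) = inner_l2 G \<zeta> (S' \<xi>)"
      using is_adjointD[OF assms(3) \<xi>_l2] is_adjointD[OF assms(4) \<xi>_l2]
      by (subst (1 2) inner_cnj) simp
  qed
qed

lemma adjoint_exists:
  assumes T_Bop: "T \<in> Bop G" and T_bound: "op_bound G C T"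
  obtains S where "S \<in> Bop G" "is_adjoint G T S" "op_bound G C S"
proof -
  have "\<exists>\<zeta>\<in>l2 G. norm_l2 G \<zeta> \<le> C * norm_l2 G \<xi> \<and> (\<forall>\<eta>\<in>l2 G. inner_l2 G \<zeta> \<eta> = inner_l2 G \<xi> (T \<eta>))"
    if \<xi>_l2: "\<xi> \<in> l2 G" for \<xi>
  proof (rule riesz_representation)
    show "cmod (inner_l2 G \<xi> (T \<eta>)) \<le> C * norm_l2 G \<xi> * norm_l2 G \<eta>" if "\<eta> \<in> l2 G" for \<eta>
      using inner_cauchy_schwarz[OF \<xi>_l2 Bop_l2[OF T_Bop], of \<eta>]
        mult_left_mono[OF op_boundD[OF T_bound that] norm_l2_nonneg[of G \<xi>]] by (simp add: mult_ac)
  qed (use T_bound \<xi>_l2 Bop_l2[OF T_Bop] norm_l2_nonneg[of G \<xi>] in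
      \<open>auto simp: BopD(3,4)[OF T_Bop] inner_add_right inner_scale_right op_bound_def\<close>)
  then obtain S' where S'_l2: "\<And>\<xi>. \<xi> \<in> l2 G \<Longrightarrow> S' \<xi> \<in> l2 G"
      and S'_norm: "\<And>\<xi>. \<xi> \<in> l2 G \<Longrightarrow> norm_l2 G (S' \<xi>) \<le> C * norm_l2 G \<xi>"
      and S'_inner: "\<And>\<xi> \<eta>. \<xi> \<in> l2 G \<Longrightarrow> \<eta> \<in> l2 G \<Longrightarrow> inner_l2 G (S' \<xi>) \<eta> = inner_l2 G \<xi> (T \<eta>)"
    by metis
  define S where "S \<xi> = (if \<xi> \<in> l2 G then S' \<xi> else (\<lambda>_. 0))" for \<xi>
  have inner_S: "inner_l2 G \<eta> (S' \<xi>) = inner_l2 G (T \<eta>) \<xi>" if "\<xi> \<in> l2 G" "\<eta> \<in> l2 G" for \<xi> \<eta>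
    using S'_inner[OF that] by (metis inner_cnj)
  have "S \<in> Bop G"
  proof (rule BopI[where C=C])
    fix \<xi> assume \<xi>_l2: "\<xi> \<in> l2 G"
    show "S (\<lambda>g. \<xi> g + \<eta> g) = (\<lambda>g. S \<xi> g + S \<eta> g)" if "\<eta> \<in> l2 G" for \<eta>
      by (rule l2_ext[of _ G])
        (use \<xi>_l2 that S'_l2 Bop_l2[OF T_Bop] in
            \<open>auto simp: S_def l2_add inner_S inner_add_right\<close>)
    show "S (\<lambda>g. a * \<xi> g) = (\<lambda>g. a * S \<xi> g)" for a
      by (rule l2_ext[of _ G])
        (use \<xi>_l2 S'_l2 Bop_l2[OF T_Bop] in
            \<open>auto simp: S_def l2_scale inner_S inner_scale_right\<close>)
  qed (use S'_l2 S'_norm in \<open>auto simp: S_def\<close>)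
  moreover have "is_adjoint G T S" "op_bound G C S"
    using S'_norm S'_inner T_bound by (simp_all add: is_adjoint_def op_bound_def S_def)
  ultimately show ?thesis using that by blast
qed

lemma adjoint_apply:
  assumes "is_adjoint G T S" "\<eta> \<in> l2 G" "h \<in> carrier G"
  shows "T \<eta> h = inner_l2 G (S (delta h)) \<eta>"
  using is_adjointD[OF assms(1) l2_delta[OF assms(3)] assms(2)]
  by (simp add: inner_delta_left assms(3))

lemma adjoint_delta:
  assumes "is_adjoint G T S" "h \<in> carrier G" "k \<in> carrier G"
  shows "S (delta h) k = cnj (T (delta k) h)"
  using adjoint_apply[OF assms(1) l2_delta[OF assms(3)] assms(2)]
  by (simp add: inner_delta_right assms(3))

lemma Bop_outside: "T \<in> Bop G \<Longrightarrow> h \<notin> carrier G \<Longrightarrow> T \<xi> h = 0"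
  by (rule l2_outside[OF Bop_l2])

lemma Bop_eq_on_delta:
  assumes T_Bop: "T \<in> Bop G" and S_Bop: "S \<in> Bop G"
    and agree: "\<And>k. k \<in> carrier G \<Longrightarrow> T (delta k) = S (delta k)"
  shows "T = S"
proof (rule Bop_ext[OF T_Bop S_Bop], rule ext)
  fix \<eta> h assume \<eta>_l2: "\<eta> \<in> l2 G"
  obtain T' S' where T'_Bop: "T' \<in> Bop G" and T'_adjoint: "is_adjoint G T T'"
      and S'_Bop: "S' \<in> Bop G" and S'_adjoint: "is_adjoint G S S'"
    using adjoint_exists Bop_bounded T_Bop S_Bop by metis
  show "T \<eta> h = S \<eta> h"
  proof (cases "h \<in> carrier G")
    case True
    have "T' (delta h) = S' (delta h)"
    proof
      fix k show "T' (delta h) k = S' (delta h) k"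
        by (cases "k \<in> carrier G")
          (simp_all add: adjoint_delta[OF T'_adjoint True] adjoint_delta[OF S'_adjoint True] agree
            Bop_outside[OF T'_Bop] Bop_outside[OF S'_Bop])
    qed
    then show ?thesis
      using adjoint_apply[OF T'_adjoint \<eta>_l2 True] adjoint_apply[OF S'_adjoint \<eta>_l2 True] by simp
  qed (simp add: Bop_outside[OF T_Bop] Bop_outside[OF S_Bop])
qed

context
  fixes G :: "('a, 'b) monoid_scheme" and T :: "nat \<Rightarrow> ('a \<Rightarrow> complex) \<Rightarrow> 'a \<Rightarrow> complex"
    and S :: "('a \<Rightarrow> complex) \<Rightarrow> 'a \<Rightarrow> complex" and C :: real
  assumes T_Bop: "\<And>i. T i \<in> Bop G" and T_bound: "\<And>i. op_bound G C (T i)" and S_Bop: "S \<in> Bop G"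
    and lim: "\<And>h k. h \<in> carrier G \<Longrightarrow> k \<in> carrier G \<Longrightarrow> (\<lambda>i. T i (delta k) h) \<longlonglongrightarrow> S (delta k) h"
begin

lemma Bop_pointwise_tendsto:
  assumes \<eta>_l2: "\<eta> \<in> l2 G"
  shows "(\<lambda>i. T i \<eta> h) \<longlonglongrightarrow> S \<eta> h"
proof (cases "h \<in> carrier G")
  case True
  have "\<exists>S. S \<in> Bop G \<and> is_adjoint G (T i) S \<and> op_bound G C S" for i
    using adjoint_exists[OF T_Bop T_bound, of i] by metis
  then obtain T' where T'_Bop: "\<And>i. T' i \<in> Bop G" and T'_adjoint: "\<And>i. is_adjoint G (T i) (T' i)"
      and T'_bound: "\<And>i. op_bound G C (T' i)"
    by metis
  obtain S' where S'_Bop: "S' \<in> Bop G" and S'_adjoint: "is_adjoint G S S'"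
    using adjoint_exists Bop_bounded S_Bop by metis
  have "(\<lambda>i. T' i (delta h) k) \<longlonglongrightarrow> S' (delta h) k" for k
  proof (cases "k \<in> carrier G")
    case k: True
    show ?thesis
      unfolding adjoint_delta[OF T'_adjoint True k] adjoint_delta[OF S'_adjoint True k]
      by (intro tendsto_cnj lim True k)
  qed (simp add: Bop_outside[OF T'_Bop] Bop_outside[OF S'_Bop])
  moreover have "norm_l2 G (T' i (delta h)) \<le> C * 1" for i
    using op_boundD[OF T'_bound l2_delta[OF True]] norm_l2_delta[OF True] by metis
  ultimately have "(\<lambda>i. inner_l2 G \<eta> (T' i (delta h))) \<longlonglongrightarrow> inner_l2 G \<eta> (S' (delta h))"
    by (intro l2_weak_limit[OF Bop_l2[OF T'_Bop]] \<eta>_l2)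
  then have "(\<lambda>i. cnj (inner_l2 G \<eta> (T' i (delta h)))) \<longlonglongrightarrow> cnj (inner_l2 G \<eta> (S' (delta h)))"
    by (rule tendsto_cnj)
  then show ?thesis
    unfolding adjoint_apply[OF T'_adjoint \<eta>_l2 True] adjoint_apply[OF S'_adjoint \<eta>_l2 True]
      inner_cnj[symmetric] .
qed (simp add: Bop_outside[OF T_Bop] Bop_outside[OF S_Bop])

lemma op_bound_limit: "op_bound G C S"
  using l2_pointwise_limit(2)[OF Bop_l2[OF T_Bop] op_boundD[OF T_bound] Bop_pointwise_tendsto]
    T_bound
  by (auto simp: op_bound_def)

lemma wot_tendsto:
  assumes "\<xi> \<in> l2 G" "\<eta> \<in> l2 G"
  shows "(\<lambda>i. inner_l2 G \<xi> (T i \<eta>)) \<longlonglongrightarrow> inner_l2 G \<xi> (S \<eta>)"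
  by (rule l2_weak_limit[OF Bop_l2[OF T_Bop] op_boundD[OF T_bound assms(2)]
        Bop_pointwise_tendsto[OF assms(2)] assms(1)])

end

subsection \<open>Von Neumann algebras\<close>

lemma is_vNaD:
  assumes "is_vNa G M"
  shows "M \<subseteq> Bop G" "idop G \<in> M"
    "T \<in> M \<Longrightarrow> S \<in> M \<Longrightarrow> (\<lambda>\<xi> g. T \<xi> g + S \<xi> g) \<in> M"
    "T \<in> M \<Longrightarrow> (\<lambda>\<xi> g. a * T \<xi> g) \<in> M"
    "T \<in> M \<Longrightarrow> S \<in> M \<Longrightarrow> T \<circ> S \<in> M"
    "T \<in> M \<Longrightarrow> \<exists>S\<in>M. is_adjoint G T S"
    "wot_closed G M"
  using assms unfolding is_vNa_def by blast+

lemma vNa_sum: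
  assumes "is_vNa G M" "finite F" "\<And>k. k \<in> F \<Longrightarrow> T k \<in> M"
  shows "(\<lambda>\<xi> g. \<Sum>k\<in>F. a k * T k \<xi> g) \<in> M"
  using assms(2,3)
proof (induction F)
  case empty
  show ?case using is_vNaD(4)[OF assms(1) is_vNaD(2)[OF assms(1)], of 0] by simp
next
  case (insert k F)
  then show ?case using is_vNaD(3)[OF assms(1) is_vNaD(4)[OF assms(1), of "T k" "a k"]] by simp
qed

lemma wot_closed_sequential:
  assumes "wot_closed G M" "\<And>i::nat. T i \<in> M" "S \<in> Bop G"
    and lim: "\<And>\<xi> \<eta>. \<xi> \<in> l2 G \<Longrightarrow> \<eta> \<in> l2 G \<Longrightarrow> (\<lambda>i. inner_l2 G \<xi> (T i \<eta>)) \<longlonglongrightarrow> inner_l2 G \<xi> (S \<eta>)"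
  shows "S \<in> M"
proof -
  have "\<exists>R\<in>M. \<forall>(\<xi>, \<eta>)\<in>F. cmod (inner_l2 G \<xi> (S \<eta>) - inner_l2 G \<xi> (R \<eta>)) < \<epsilon>"
    if F_finite: "finite F" and F_l2: "F \<subseteq> l2 G \<times> l2 G" and "\<epsilon> > 0" for F \<epsilon>
  proof -
    have "\<forall>p\<in>F. \<forall>\<^sub>F i in sequentially.
        cmod (inner_l2 G (fst p) (S (snd p)) - inner_l2 G (fst p) (T i (snd p))) < \<epsilon>"
    proof
      fix p assume "p \<in> F"
      then have "(\<lambda>i. inner_l2 G (fst p) (T i (snd p))) \<longlonglongrightarrow> inner_l2 G (fst p) (S (snd p))"
        using F_l2 by (intro lim) auto
      from tendstoD[OF this \<open>\<epsilon> > 0\<close>]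
      show "\<forall>\<^sub>F i in sequentially.
          cmod (inner_l2 G (fst p) (S (snd p)) - inner_l2 G (fst p) (T i (snd p))) < \<epsilon>"
        by (simp add: dist_norm norm_minus_commute)
    qed
    then have "\<forall>\<^sub>F i in sequentially. \<forall>p\<in>F.
        cmod (inner_l2 G (fst p) (S (snd p)) - inner_l2 G (fst p) (T i (snd p))) < \<epsilon>"
      by (simp add: eventually_ball_finite_distrib[OF F_finite])
    then obtain i
        where "\<forall>p\<in>F. cmod (inner_l2 G (fst p) (S (snd p)) - inner_l2 G (fst p) (T i (snd p))) < \<epsilon>"
      using eventually_happens'[OF sequentially_bot] by blast
    then show ?thesis using assms(2)[of i] by (auto intro!: bexI[of _ "T i"])
  qed
  then show ?thesis using assms(1,3) unfolding wot_closed_def by blast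
qed

lemma vNa_limit:
  fixes T :: "nat \<Rightarrow> ('a \<Rightarrow> complex) \<Rightarrow> 'a \<Rightarrow> complex"
  assumes M_vNa: "is_vNa G M" and T_in_M: "\<And>i. T i \<in> M" and T_bound: "\<And>i. op_bound G C (T i)"
    and S_Bop: "S \<in> Bop G"
    and lim: "\<And>h k. h \<in> carrier G \<Longrightarrow> k \<in> carrier G \<Longrightarrow> (\<lambda>i. T i (delta k) h) \<longlonglongrightarrow> S (delta k) h"
  shows "S \<in> M"
proof (rule wot_closed_sequential[OF is_vNaD(7)[OF M_vNa] T_in_M S_Bop])
  have "T i \<in> Bop G" for i using is_vNaD(1)[OF M_vNa] T_in_M by blast
  then show "(\<lambda>i. inner_l2 G \<xi> (T i \<eta>)) \<longlonglongrightarrow> inner_l2 G \<xi> (S \<eta>)" if "\<xi> \<in> l2 G" "\<eta> \<in> l2 G" for \<xi> \<eta>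
    by (rule wot_tendsto[OF _ T_bound S_Bop lim that])
qed

definition commutant ::
  "('a, 'b) monoid_scheme \<Rightarrow> (('a \<Rightarrow> complex) \<Rightarrow> 'a \<Rightarrow> complex) set \<Rightarrow>
    (('a \<Rightarrow> complex) \<Rightarrow> 'a \<Rightarrow> complex) set"
  where "commutant G A = {T \<in> Bop G. \<forall>R\<in>A. \<forall>\<xi>\<in>l2 G. T (R \<xi>) = R (T \<xi>)}"

lemma commutant_Bop: "T \<in> commutant G A \<Longrightarrow> T \<in> Bop G"
  by (simp add: commutant_def)

lemma commutantD: "T \<in> commutant G A \<Longrightarrow> R \<in> A \<Longrightarrow> \<xi> \<in> l2 G \<Longrightarrow> T (R \<xi>) = R (T \<xi>)"
  by (simp add: commutant_def)

context
  fixes G :: "('a, 'b) monoid_scheme" and A :: "(('a \<Rightarrow> complex) \<Rightarrow> 'a \<Rightarrow> complex) set"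
  assumes A_Bop: "A \<subseteq> Bop G" and A_adjoint: "\<And>R. R \<in> A \<Longrightarrow> \<exists>R'\<in>A. is_adjoint G R R'"
begin

lemma commutant_adjoint:
  assumes T_commutant: "T \<in> commutant G A"
  shows "\<exists>S\<in>commutant G A. is_adjoint G T S"
proof -
  obtain S where S_Bop: "S \<in> Bop G" and S_adjoint: "is_adjoint G T S"
    using adjoint_exists Bop_bounded commutant_Bop[OF T_commutant] by metis
  note S_T = is_adjointD[OF is_adjoint_sym[OF S_adjoint], symmetric]
  have "S (R \<xi>) = R (S \<xi>)" if "R \<in> A" and \<xi>_l2: "\<xi> \<in> l2 G" for R \<xi>
  proof (rule l2_ext[of _ G])
    obtain R' where R'_in_A: "R' \<in> A" and R'_adjoint: "is_adjoint G R R'"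
      using A_adjoint \<open>R \<in> A\<close> by blast
    have R_l2: "R \<zeta> \<in> l2 G" and R'_l2: "R' \<zeta> \<in> l2 G" for \<zeta>
      using A_Bop \<open>R \<in> A\<close> R'_in_A Bop_l2 by blast+
    note [simp] = R_l2 R'_l2 Bop_l2[OF S_Bop] Bop_l2[OF commutant_Bop[OF T_commutant]] \<xi>_l2
    show "S (R \<xi>) \<in> l2 G" "R (S \<xi>) \<in> l2 G" by simp_all
    fix \<eta> assume [simp]: "\<eta> \<in> l2 G"
    have "inner_l2 G \<eta> (S (R \<xi>)) = inner_l2 G (T \<eta>) (R \<xi>)" by (simp add: S_T)
    also have "\<dots> = inner_l2 G (R' (T \<eta>)) \<xi>" by (simp add: is_adjointD[OF R'_adjoint])
    also have "\<dots> = inner_l2 G (T (R' \<eta>)) \<xi>" using commutantD[OF T_commutant R'_in_A] by simp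
    also have "\<dots> = inner_l2 G (R' \<eta>) (S \<xi>)" by (simp add: S_T)
    also have "\<dots> = inner_l2 G \<eta> (R (S \<xi>))" by (simp add: is_adjointD[OF R'_adjoint])
    finally show "inner_l2 G \<eta> (S (R \<xi>)) = inner_l2 G \<eta> (R (S \<xi>))" .
  qed
  then show ?thesis using S_Bop S_adjoint by (auto simp: commutant_def)
qed

lemma wot_closed_commutant: "wot_closed G (commutant G A)"
  unfolding wot_closed_def
proof (intro ballI impI)
  fix T assume T_Bop: "T \<in> Bop G" and approx: "\<forall>F \<epsilon>. finite F \<longrightarrow> F \<subseteq> l2 G \<times> l2 G \<longrightarrow> 0 < \<epsilon> \<longrightarrow>
    (\<exists>S\<in>commutant G A. \<forall>(\<xi>, \<eta>)\<in>F. cmod (inner_l2 G \<xi> (T \<eta>) - inner_l2 G \<xi> (S \<eta>)) < \<epsilon>)"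
  have "T (R \<xi>) = R (T \<xi>)" if "R \<in> A" and \<xi>_l2: "\<xi> \<in> l2 G" for R \<xi>
  proof (rule l2_ext[of _ G])
    obtain R' where R'_in_A: "R' \<in> A" and R'_adjoint: "is_adjoint G R R'"
      using A_adjoint \<open>R \<in> A\<close> by blast
    have R_l2: "R \<zeta> \<in> l2 G" and R'_l2: "R' \<zeta> \<in> l2 G" for \<zeta>
      using A_Bop \<open>R \<in> A\<close> R'_in_A Bop_l2 by blast+
    show "T (R \<xi>) \<in> l2 G" "R (T \<xi>) \<in> l2 G" using Bop_l2[OF T_Bop] R_l2 R'_l2 by simp_all
    fix \<zeta> assume \<zeta>_l2: "\<zeta> \<in> l2 G"
    let ?a = "\<lambda>S. inner_l2 G \<zeta> (S (R \<xi>))" and ?b = "\<lambda>S. inner_l2 G (R' \<zeta>) (S \<xi>)"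
    have "dist (?a T) (?b T) < \<epsilon>" if "\<epsilon> > 0" for \<epsilon>
    proof -
      obtain S where S_commutant: "S \<in> commutant G A" and S_close_R: "cmod (?a T - ?a S) < \<epsilon> / 2"
          and S_close_R': "cmod (?b T - ?b S) < \<epsilon> / 2"
        using approx[rule_format, of "{(\<zeta>, R \<xi>), (R' \<zeta>, \<xi>)}" "\<epsilon> / 2"] \<open>\<epsilon> > 0\<close> \<xi>_l2 \<zeta>_l2 R_l2 R'_l2
        by auto
      have "?a S = ?b S"
        using commutantD[OF S_commutant \<open>R \<in> A\<close> \<xi>_l2]
          is_adjointD[OF R'_adjoint \<zeta>_l2 Bop_l2[OF commutant_Bop[OF S_commutant]]]
        by simp
      show ?thesis
      proof (rule dist_triangle_half_l)
        show "dist (?a T) (?a S) < \<epsilon> / 2" "dist (?b T) (?a S) < \<epsilon> / 2"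
          using S_close_R S_close_R' by (simp_all only: dist_norm \<open>?a S = ?b S\<close>)
      qed
    qed
    then have "?a T = ?b T" by (metis dist_self less_irrefl zero_less_dist_iff)
    then show "inner_l2 G \<zeta> (T (R \<xi>)) = inner_l2 G \<zeta> (R (T \<xi>))"
      by (simp add: is_adjointD[OF R'_adjoint \<zeta>_l2 Bop_l2[OF T_Bop]])
  qed
  then show "T \<in> commutant G A" using T_Bop by (simp add: commutant_def)
qed

lemma is_vNa_commutant: "is_vNa G (commutant G A)"
  unfolding is_vNa_def
proof (intro conjI ballI allI)
  have R_Bop: "R \<in> Bop G" if "R \<in> A" for R using A_Bop that by blast
  show "commutant G A \<subseteq> Bop G" by (auto simp: commutant_def)
  show "idop G \<in> commutant G A"
    using Bop_idop Bop_l2[OF R_Bop] by (simp add: commutant_def idop_def)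
  fix T assume T_commutant: "T \<in> commutant G A"
  note T_l2 = Bop_l2[OF commutant_Bop[OF T_commutant]]
  show "(\<lambda>\<xi> g. a * T \<xi> g) \<in> commutant G A" for a
    using T_commutant T_l2 by (simp add: commutant_def Bop_scale BopD(4)[OF R_Bop])
  fix S assume S_commutant: "S \<in> commutant G A"
  note S_l2 = Bop_l2[OF commutant_Bop[OF S_commutant]]
  show "(\<lambda>\<xi> g. T \<xi> g + S \<xi> g) \<in> commutant G A"
    using T_commutant S_commutant T_l2 S_l2 by (simp add: commutant_def Bop_add BopD(3)[OF R_Bop])
  show "T \<circ> S \<in> commutant G A"
    using T_commutant S_commutant S_l2 by (simp add: commutant_def Bop_comp)
qed (use commutant_adjoint wot_closed_commutant in blast)+

end

subsection \<open>The commutant of the right regular representation\<close>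

definition supp :: "('a \<Rightarrow> complex) \<Rightarrow> 'a set" where
  "supp a = {k. a k \<noteq> 0}"

definition rreg :: "('a, 'b) monoid_scheme \<Rightarrow> 'a \<Rightarrow> ('a \<Rightarrow> complex) \<Rightarrow> ('a \<Rightarrow> complex)" where
  "rreg G g = (\<lambda>\<xi>. if \<xi> \<in> l2 G then (\<lambda>h. if h \<in> carrier G then \<xi> (h \<otimes>\<^bsub>G\<^esub> g) else 0) else (\<lambda>_. 0))"

definition right_commutant :: "('a, 'b) monoid_scheme \<Rightarrow> (('a \<Rightarrow> complex) \<Rightarrow> ('a \<Rightarrow> complex)) set" where
  "right_commutant G = commutant G (rreg G ` carrier G)"

definition left_conv :: "('a, 'b) monoid_scheme \<Rightarrow> ('a \<Rightarrow> complex) \<Rightarrow> ('a \<Rightarrow> complex) \<Rightarrow> ('a \<Rightarrow> complex)"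
  where
  "left_conv G a = (\<lambda>\<xi> h. \<Sum>k\<in>supp a. a k * lreg G k \<xi> h)"

definition conjugate :: "('a, 'b) monoid_scheme \<Rightarrow> 'a \<Rightarrow> ('a \<Rightarrow> complex) \<Rightarrow> ('a \<Rightarrow> complex)" where
  "conjugate G g \<xi> = lreg G g (rreg G g \<xi>)"

definition star_conv :: "('a, 'b) monoid_scheme \<Rightarrow> ('a \<Rightarrow> complex) \<Rightarrow> ('a \<Rightarrow> complex) \<Rightarrow> ('a \<Rightarrow> complex)"
  where
  "star_conv G a b = (\<lambda>h. if h \<in> carrier G then inner_l2 G a (rreg G h b) else 0)"

lemma supp_zero: "supp (\<lambda>_. 0) = {}"
  by (simp add: supp_def)

lemma supp_add: "supp (\<lambda>k. a k + b k) \<subseteq> supp a \<union> supp b"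
  by (auto simp: supp_def)

lemma supp_scale: "supp (\<lambda>k. z * a k) \<subseteq> supp a"
  by (auto simp: supp_def)

lemma cutoff_eq_self: "supp \<xi> \<subseteq> F \<Longrightarrow> cutoff F \<xi> = \<xi>"
  by (auto simp: cutoff_def supp_def fun_eq_iff)

lemma inner_cong_supp:
  assumes "\<And>k. k \<in> carrier G \<Longrightarrow> k \<in> supp a \<Longrightarrow> b k = b' k"
  shows "inner_l2 G a b = inner_l2 G a b'"
  unfolding inner_l2_def by (rule infsum_cong) (use assms in \<open>auto simp: supp_def\<close>)

lemma l2_supp: "a \<in> l2 G \<Longrightarrow> supp a \<subseteq> carrier G"
  using l2_outside unfolding supp_def by fastforce

lemma
  fixes \<xi> :: "'a \<Rightarrow> complex" and \<pi> :: "'a \<Rightarrow> 'a"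
  assumes \<pi>_bij: "bij_betw \<pi> (carrier G) (carrier G)"
  defines "reindex \<equiv> \<lambda>\<xi> h. if h \<in> carrier G then \<xi> (\<pi> h) else 0"
  shows l2_reindex: "\<xi> \<in> l2 G \<Longrightarrow> reindex \<xi> \<in> l2 G"
    and norm_reindex: "norm_l2 G (reindex \<xi>) = norm_l2 G \<xi>"
    and inner_reindex: "inner_l2 G (reindex \<xi>) (reindex \<eta>) = inner_l2 G \<xi> \<eta>"
proof -
  have norm_sq: "(cmod (reindex \<xi> h))\<^sup>2 = (cmod (\<xi> (\<pi> h)))\<^sup>2" if "h \<in> carrier G" for h
    using that by (simp add: reindex_def)
  show "reindex \<xi> \<in> l2 G" if "\<xi> \<in> l2 G"
    using summable_on_reindex_bij_betw[OF \<pi>_bij, of "\<lambda>h. (cmod (\<xi> h))\<^sup>2"] l2_summable[OF that]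
      summable_on_cong[of "carrier G", OF norm_sq]
    by (auto simp: l2_def reindex_def)
  show "norm_l2 G (reindex \<xi>) = norm_l2 G \<xi>"
    using infsum_reindex_bij_betw[OF \<pi>_bij, of "\<lambda>h. (cmod (\<xi> h))\<^sup>2"]
      infsum_cong[of "carrier G", OF norm_sq]
    by (simp add: norm_l2_def)
  have "inner_l2 G (reindex \<xi>) (reindex \<eta>) = infsum (\<lambda>h. cnj (\<xi> (\<pi> h)) * \<eta> (\<pi> h)) (carrier G)"
    unfolding inner_l2_def by (rule infsum_cong) (simp add: reindex_def)
  then show "inner_l2 G (reindex \<xi>) (reindex \<eta>) = inner_l2 G \<xi> \<eta>"
    using infsum_reindex_bij_betw[OF \<pi>_bij, of "\<lambda>h. cnj (\<xi> h) * \<eta> h"] by (simp add: inner_l2_def)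
qed

context group
begin

lemma lreg_apply: "\<xi> \<in> l2 G \<Longrightarrow> h \<in> carrier G \<Longrightarrow> lreg G g \<xi> h = \<xi> (inv g \<otimes> h)"
  by (simp add: lreg_def)

lemma rreg_apply: "\<xi> \<in> l2 G \<Longrightarrow> h \<in> carrier G \<Longrightarrow> rreg G g \<xi> h = \<xi> (h \<otimes> g)"
  by (simp add: rreg_def)

lemma bij_betw_left_mult: "g \<in> carrier G \<Longrightarrow> bij_betw (\<lambda>h. g \<otimes> h) (carrier G) (carrier G)"
  by (rule bij_betwI[where g="\<lambda>h. inv g \<otimes> h"]) (auto simp flip: m_assoc)

lemma bij_betw_right_mult: "g \<in> carrier G \<Longrightarrow> bij_betw (\<lambda>h. h \<otimes> g) (carrier G) (carrier G)"
  by (rule bij_betwI[where g="\<lambda>h. h \<otimes> inv g"]) (auto simp: m_assoc)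

lemma
  assumes "g \<in> carrier G" "\<xi> \<in> l2 G"
  shows l2_lreg: "lreg G g \<xi> \<in> l2 G"
    and norm_lreg: "norm_l2 G (lreg G g \<xi>) = norm_l2 G \<xi>"
    and inner_lreg: "\<eta> \<in> l2 G \<Longrightarrow> inner_l2 G (lreg G g \<xi>) (lreg G g \<eta>) = inner_l2 G \<xi> \<eta>"
  unfolding lreg_def using assms
  by (simp_all add: l2_reindex[OF bij_betw_left_mult] norm_reindex[OF bij_betw_left_mult]
      inner_reindex[OF bij_betw_left_mult])

lemma
  assumes "g \<in> carrier G" "\<xi> \<in> l2 G"
  shows l2_rreg: "rreg G g \<xi> \<in> l2 G"
    and norm_rreg: "norm_l2 G (rreg G g \<xi>) = norm_l2 G \<xi>"
    and inner_rreg: "\<eta> \<in> l2 G \<Longrightarrow> inner_l2 G (rreg G g \<xi>) (rreg G g \<eta>) = inner_l2 G \<xi> \<eta>"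
  unfolding rreg_def using assms
  by (simp_all add: l2_reindex[OF bij_betw_right_mult] norm_reindex[OF bij_betw_right_mult]
      inner_reindex[OF bij_betw_right_mult])

lemma lreg_Bop: "g \<in> carrier G \<Longrightarrow> lreg G g \<in> Bop G"
  by (rule BopI[where C=1]) (simp_all add: l2_lreg norm_lreg, auto simp: lreg_def l2_add l2_scale)

lemma rreg_Bop: "g \<in> carrier G \<Longrightarrow> rreg G g \<in> Bop G"
  by (rule BopI[where C=1]) (simp_all add: l2_rreg norm_rreg, auto simp: rreg_def l2_add l2_scale)

lemma lreg_one: "\<xi> \<in> l2 G \<Longrightarrow> lreg G \<one> \<xi> = \<xi>"
  by (auto simp: lreg_def l2_outside)

lemma rreg_one: "\<xi> \<in> l2 G \<Longrightarrow> rreg G \<one> \<xi> = \<xi>"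
  by (auto simp: rreg_def l2_outside)

lemma lreg_lreg:
  assumes "g \<in> carrier G" "h \<in> carrier G"
  shows "lreg G g (lreg G h \<xi>) = lreg G (g \<otimes> h) \<xi>"
proof (cases "\<xi> \<in> l2 G")
  case True
  then show ?thesis
    using assms l2_lreg[of h \<xi>] by (auto simp: lreg_def inv_mult_group m_assoc)
qed (simp add: lreg_def l2_zero)

lemma rreg_rreg:
  assumes "g \<in> carrier G" "h \<in> carrier G" "\<xi> \<in> l2 G"
  shows "rreg G g (rreg G h \<xi>) = rreg G (g \<otimes> h) \<xi>"
  using assms l2_rreg[of h \<xi>] by (auto simp: rreg_def m_assoc)

lemma lreg_rreg:
  assumes "g \<in> carrier G" "h \<in> carrier G" "\<xi> \<in> l2 G"
  shows "lreg G g (rreg G h \<xi>) = rreg G h (lreg G g \<xi>)"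
  using assms l2_rreg[of h \<xi>] l2_lreg[of g \<xi>] by (auto simp: lreg_def rreg_def m_assoc)

lemma is_adjoint_lreg:
  assumes "g \<in> carrier G"
  shows "is_adjoint G (lreg G g) (lreg G (inv g))"
  unfolding is_adjoint_def
proof (intro ballI)
  fix \<xi> \<eta> assume "\<xi> \<in> l2 G" "\<eta> \<in> l2 G"
  then show "inner_l2 G (lreg G (inv g) \<xi>) \<eta> = inner_l2 G \<xi> (lreg G g \<eta>)"
    using inner_lreg[OF assms l2_lreg[OF inv_closed[OF assms]], of \<xi> \<eta>] assms
    by (simp add: lreg_lreg lreg_one)
qed

lemma is_adjoint_rreg:
  assumes "g \<in> carrier G"
  shows "is_adjoint G (rreg G g) (rreg G (inv g))"
  unfolding is_adjoint_def
proof (intro ballI)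
  fix \<xi> \<eta> assume "\<xi> \<in> l2 G" "\<eta> \<in> l2 G"
  then show "inner_l2 G (rreg G (inv g) \<xi>) \<eta> = inner_l2 G \<xi> (rreg G g \<eta>)"
    using inner_rreg[OF assms l2_rreg[OF inv_closed[OF assms]], of \<xi> \<eta>] assms
    by (simp add: rreg_rreg rreg_one)
qed

lemma adj_lreg:
  assumes "g \<in> carrier G"
  shows "adj G (lreg G g) = lreg G (inv g)"
  unfolding adj_def
  using lreg_Bop[OF inv_closed[OF assms]] is_adjoint_lreg[OF assms] is_adjoint_unique
  by (intro some_equality) blast+

lemma lreg_delta:
  assumes "g \<in> carrier G" "k \<in> carrier G"
  shows "lreg G g (delta k) = delta (g \<otimes> k)"
proof
  fix h
  have "inv g \<otimes> h = k \<longleftrightarrow> h = g \<otimes> k" if "h \<in> carrier G"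
    using assms that by (metis inv_closed inv_solve_left)
  then show "lreg G g (delta k) h = delta (g \<otimes> k) h"
    using assms l2_delta[OF assms(2)] by (auto simp: lreg_def) (auto simp: delta_def)
qed

lemma rreg_delta:
  assumes "g \<in> carrier G" "k \<in> carrier G"
  shows "rreg G g (delta k) = delta (k \<otimes> inv g)"
proof
  fix h
  have "h \<otimes> g = k \<longleftrightarrow> h = k \<otimes> inv g" if "h \<in> carrier G"
    using assms that by (metis inv_solve_right)
  then show "rreg G g (delta k) h = delta (k \<otimes> inv g) h"
    using assms l2_delta[OF assms(2)] by (auto simp: rreg_def) (auto simp: delta_def)
qed

lemma is_vNa_right_commutant: "is_vNa G (right_commutant G)"
  unfolding right_commutant_def
proof (rule is_vNa_commutant)
  show "rreg G ` carrier G \<subseteq> Bop G" using rreg_Bop by blast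
  show "\<exists>R'\<in>rreg G ` carrier G. is_adjoint G R R'" if "R \<in> rreg G ` carrier G" for R
    using that is_adjoint_rreg inv_closed by blast
qed

lemma lreg_right_commutant: "g \<in> carrier G \<Longrightarrow> lreg G g \<in> right_commutant G"
  by (auto simp: right_commutant_def commutant_def lreg_Bop lreg_rreg)

lemma grpvN_subset_right_commutant: "grpvN G (carrier G) \<subseteq> right_commutant G"
  unfolding grpvN_def vN_gen_def using is_vNa_right_commutant lreg_right_commutant by blast

lemma right_commutant_Bop: "T \<in> right_commutant G \<Longrightarrow> T \<in> Bop G"
  unfolding right_commutant_def by (rule commutant_Bop)

lemma right_commutant_delta:
  assumes "T \<in> right_commutant G" "k \<in> carrier G"
  shows "T (delta k) = rreg G (inv k) (T (delta \<one>))"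
proof -
  have "T (rreg G (inv k) (delta \<one>)) = rreg G (inv k) (T (delta \<one>))"
    using commutantD[OF assms(1)[unfolded right_commutant_def]] assms(2) l2_delta[of \<one> G] by simp
  then show ?thesis using assms(2) by (simp add: rreg_delta)
qed

lemma right_commutant_delta_apply:
  assumes "T \<in> right_commutant G" "k \<in> carrier G" "h \<in> carrier G"
  shows "T (delta k) h = T (delta \<one>) (h \<otimes> inv k)"
  using Bop_l2[OF right_commutant_Bop[OF assms(1)]] assms(2,3)
  by (simp add: right_commutant_delta[OF assms(1,2)] rreg_apply)

lemma right_commutant_eqI:
  assumes "T \<in> right_commutant G" "S \<in> right_commutant G" "T (delta \<one>) = S (delta \<one>)"
  shows "T = S"
proof (rule Bop_eq_on_delta)
  show "T \<in> Bop G" "S \<in> Bop G" using assms(1,2) right_commutant_Bop by blast+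
  show "T (delta k) = S (delta k)" if "k \<in> carrier G" for k
    using right_commutant_delta[OF assms(1) that] right_commutant_delta[OF assms(2) that] assms(3)
    by simp
qed

lemma
  assumes "finite (supp a)" "supp a \<subseteq> carrier G"
  shows left_conv_right_commutant: "left_conv G a \<in> right_commutant G"
    and left_conv_delta_one: "left_conv G a (delta \<one>) = a"
proof -
  show "left_conv G a \<in> right_commutant G"
    unfolding left_conv_def
    by (rule vNa_sum[OF is_vNa_right_commutant assms(1)])
      (use assms(2) lreg_right_commutant in auto)
  have "left_conv G a (delta \<one>) h = (\<Sum>k\<in>supp a. if h = k then a k else 0)" for h
    unfolding left_conv_def
    by (rule sum.cong) (use assms(2) in \<open>auto simp: lreg_delta subset_iff, auto simp: delta_def\<close>)
  then show "left_conv G a (delta \<one>) = a" using assms(1) by (auto simp: supp_def)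
qed

lemma conjugate_apply:
  assumes "\<xi> \<in> l2 G" "g \<in> carrier G" "h \<in> carrier G"
  shows "conjugate G g \<xi> h = \<xi> (inv g \<otimes> h \<otimes> g)"
  using assms by (simp add: conjugate_def lreg_apply l2_rreg rreg_apply)

lemma l2_conjugate: "\<xi> \<in> l2 G \<Longrightarrow> g \<in> carrier G \<Longrightarrow> conjugate G g \<xi> \<in> l2 G"
  by (simp add: conjugate_def l2_lreg l2_rreg)

lemma inner_conjugate:
  assumes "\<xi> \<in> l2 G" "\<eta> \<in> l2 G" "g \<in> carrier G"
  shows "inner_l2 G \<eta> (conjugate G g \<xi>) = inner_l2 G (conjugate G (inv g) \<eta>) \<xi>"
  using assms is_adjointD[OF is_adjoint_lreg[OF assms(3)], of \<eta> "rreg G g \<xi>"]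
    is_adjointD[OF is_adjoint_rreg[OF assms(3)], of "lreg G (inv g) \<eta>" \<xi>]
  by (simp add: conjugate_def l2_rreg l2_lreg lreg_rreg)

lemma conjugate_right_commutant:
  assumes "T \<in> right_commutant G" "g \<in> carrier G"
  shows "(lreg G g \<circ> T \<circ> lreg G (inv g)) (delta \<one>) = conjugate G g (T (delta \<one>))"
  using right_commutant_delta[OF assms(1) inv_closed[OF assms(2)]] assms(2)
  by (simp add: lreg_delta conjugate_def)

lemma op_bound_conjugate:
  assumes "T \<in> Bop G" "op_bound G C T" "g \<in> carrier G"
  shows "op_bound G C (lreg G g \<circ> T \<circ> lreg G (inv g))"
  unfolding op_bound_def
proof (intro conjI ballI)
  show "0 \<le> C" using assms(2) by (simp add: op_bound_def)
  fix \<xi> assume \<xi>_l2: "\<xi> \<in> l2 G"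
  then show "norm_l2 G ((lreg G g \<circ> T \<circ> lreg G (inv g)) \<xi>) \<le> C * norm_l2 G \<xi>"
    using op_boundD[OF assms(2) l2_lreg[OF inv_closed[OF assms(3)] \<xi>_l2]] Bop_l2[OF assms(1)]
      assms(3)
    by (simp add: norm_lreg)
qed

lemma star_conv_right_commutant:
  assumes T_commutant: "T \<in> right_commutant G" and R_commutant: "R \<in> right_commutant G"
    and S_Bop: "S \<in> Bop G" and S_adjoint: "is_adjoint G T S"
  shows "(S \<circ> R) (delta \<one>) = star_conv G (T (delta \<one>)) (R (delta \<one>))"
proof
  note l2 = Bop_l2[OF right_commutant_Bop[OF T_commutant]]
      Bop_l2[OF right_commutant_Bop[OF R_commutant]]
  fix h show "(S \<circ> R) (delta \<one>) h = star_conv G (T (delta \<one>)) (R (delta \<one>)) h"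
  proof (cases "h \<in> carrier G")
    case True
    have "(S \<circ> R) (delta \<one>) h = inner_l2 G (T (delta h)) (R (delta \<one>))"
      using adjoint_apply[OF is_adjoint_sym[OF S_adjoint] l2(2) True] by simp
    also have "\<dots> = inner_l2 G (T (delta \<one>)) (rreg G h (R (delta \<one>)))"
      unfolding right_commutant_delta[OF T_commutant True]
      by (rule is_adjointD[OF is_adjoint_rreg[OF True] l2])
    finally show ?thesis using True by (simp add: star_conv_def)
  next
    case False
    then show ?thesis using Bop_outside[OF S_Bop] by (simp add: star_conv_def)
  qed
qed

lemma star_conv_supp:
  assumes "a \<in> l2 G" "b \<in> l2 G" "h \<in> supp (star_conv G a b)"
  obtains k where "h \<in> carrier G" "k \<in> supp a" "k \<otimes> h \<in> supp b"
proof -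
  have h_carrier: "h \<in> carrier G" and inner_nonzero: "inner_l2 G a (rreg G h b) \<noteq> 0"
    using assms(3) by (auto simp: supp_def star_conv_def split: if_splits)
  have "inner_l2 G a (\<lambda>_. 0) = 0" by (simp add: inner_l2_def)
  then obtain k where "k \<in> carrier G" "k \<in> supp a" "rreg G h b k \<noteq> 0"
    using inner_nonzero inner_cong_supp[of G a "rreg G h b" "\<lambda>_. 0"] by auto
  then show ?thesis using that h_carrier assms(2) by (auto simp: rreg_apply supp_def)
qed

lemma finite_supp_star_conv:
  assumes a_l2: "a \<in> l2 G" and a_supp_finite: "finite (supp a)" and b_l2: "b \<in> l2 G"
    and b_supp_finite: "finite (supp b)"
  shows "finite (supp (star_conv G a b))"
proof (rule finite_subset)
  show "supp (star_conv G a b) \<subseteq> (\<lambda>(k, l). inv k \<otimes> l) ` (supp a \<times> supp b)"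
  proof
    fix h assume "h \<in> supp (star_conv G a b)"
    then obtain k where h_carrier: "h \<in> carrier G" and k_supp: "k \<in> supp a"
        and kh_supp: "k \<otimes> h \<in> supp b"
      using star_conv_supp a_l2 b_l2 by blast
    moreover have "h = inv k \<otimes> (k \<otimes> h)"
      using h_carrier k_supp l2_supp[OF a_l2] by (auto simp flip: m_assoc)
    ultimately show "h \<in> (\<lambda>(k, l). inv k \<otimes> l) ` (supp a \<times> supp b)"
      by (intro image_eqI[of _ _ "(k, k \<otimes> h)"]) auto
  qed
qed (use a_supp_finite b_supp_finite in blast)

end

subsection \<open>Amenability of locally finite groups\<close>

lemma bounded_sequence_cluster_point:
  fixes m :: "nat \<Rightarrow> 'i \<Rightarrow> real"
  assumes "\<And>n i. m n i \<in> {0..1}"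
  obtains \<mu> where "\<And>K. closed K \<Longrightarrow> \<forall>\<^sub>F n in sequentially. m n \<in> K \<Longrightarrow> \<mu> \<in> K"
proof -
  define U :: "('i \<Rightarrow> real) set" where "U = PiE UNIV (\<lambda>_. {0..1})"
  have "compactin (product_topology (\<lambda>_. euclidean) UNIV) U"
    unfolding U_def by (subst compactin_PiE) auto
  then have "compact U" by (simp add: euclidean_product_topology)
  moreover have "filtermap m sequentially \<noteq> bot" by (simp add: filtermap_bot_iff)
  moreover have "eventually (\<lambda>x. x \<in> U) (filtermap m sequentially)"
    using assms by (simp add: eventually_filtermap U_def PiE_iff)
  ultimately obtain \<mu> where \<mu>_cluster: "inf (nhds \<mu>) (filtermap m sequentially) \<noteq> bot"
    unfolding compact_filter by blast
  have "\<mu> \<in> K" if "closed K" "\<forall>\<^sub>F n in sequentially. m n \<in> K" for K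
  proof (rule ccontr)
    assume "\<mu> \<notin> K"
    then have "eventually (\<lambda>x. x \<in> - K) (nhds \<mu>)"
      using that(1) by (intro eventually_nhds_in_open) auto
    moreover have "eventually (\<lambda>x. x \<in> K) (filtermap m sequentially)"
      using that(2) by (simp add: eventually_filtermap)
    ultimately have "eventually (\<lambda>_. False) (inf (nhds \<mu>) (filtermap m sequentially))"
      unfolding eventually_inf by (intro exI conjI) auto
    then show False using \<mu>_cluster by (simp add: eventually_False)
  qed
  then show ?thesis using that by blast
qed

lemma amenable_grp_if_eventually_invariant_means:
  fixes m :: "nat \<Rightarrow> 'a set \<Rightarrow> real"
  assumes range: "\<And>n A. m n A \<in> {0..1}" and total: "\<And>n. m n (carrier G) = 1"
    and additive: "\<And>n A B. A \<inter> B = {} \<Longrightarrow> m n (A \<union> B) = m n A + m n B"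
    and invariant: "\<And>g A. g \<in> carrier G \<Longrightarrow> A \<subseteq> carrier G \<Longrightarrow>
        \<forall>\<^sub>F n in sequentially. m n (g <#\<^bsub>G\<^esub> A) = m n A"
  shows "amenable_grp G"
proof -
  obtain \<mu> where limit: "\<And>K. closed K \<Longrightarrow> \<forall>\<^sub>F n in sequentially. m n \<in> K \<Longrightarrow> \<mu> \<in> K"
    using bounded_sequence_cluster_point[of m, OF range] by metis
  have limit_eq: "f \<mu> = f' \<mu>"
    if "continuous_on UNIV f" "continuous_on UNIV f'" "\<forall>\<^sub>F n in sequentially. f (m n) = f' (m n)"
    for f f' :: "('a set \<Rightarrow> real) \<Rightarrow> real"
    using limit[of "{x. f x = f' x}"] closed_Collect_eq[OF that(1,2)] that(3) by simp
  have coordinate: "continuous_on UNIV (\<lambda>x :: 'a set \<Rightarrow> real. x A)" for A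
    by (rule continuous_on_product_coordinates)
  show ?thesis
    unfolding amenable_grp_def
  proof (intro exI[of _ \<mu>] conjI allI impI)
    show "\<mu> (carrier G) = 1"
      by (rule limit_eq[OF coordinate continuous_on_const]) (simp add: total)
    show "0 \<le> \<mu> A" for A
      using limit[of "{x. 0 \<le> x A}"] closed_Collect_le[OF continuous_on_const coordinate] range
      by simp
    show "\<mu> (A \<union> B) = \<mu> A + \<mu> B" if "A \<inter> B = {}" for A B
      by (rule limit_eq[OF coordinate continuous_on_add[OF coordinate coordinate]])
        (simp add: additive that)
    show "\<mu> (g <#\<^bsub>G\<^esub> A) = \<mu> A" if "g \<in> carrier G" "A \<subseteq> carrier G" for g A
      by (rule limit_eq[OF coordinate coordinate invariant[OF that]])
  qed
qed

lemma (in group) card_l_coset_Int_subgroup: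
  assumes H_subgroup: "subgroup H G" and g_in_H: "g \<in> H" and A_carrier: "A \<subseteq> carrier G"
  shows "card ((g <# A) \<inter> H) = card (A \<inter> H)"
proof -
  note g_carrier = subgroup.mem_carrier[OF H_subgroup g_in_H]
  have "(g <# A) \<inter> H = (\<lambda>a. g \<otimes> a) ` (A \<inter> H)"
  proof (intro equalityI subsetI)
    fix y assume "y \<in> (g <# A) \<inter> H"
    then obtain a where a_in_A: "a \<in> A" and y_eq: "y = g \<otimes> a" and y_in_H: "y \<in> H"
      by (auto simp: l_coset_def)
    then have "a = inv g \<otimes> y" using g_carrier A_carrier by (auto simp flip: m_assoc)
    then have "a \<in> H"
      using subgroup.m_closed[OF H_subgroup subgroup.m_inv_closed[OF H_subgroup g_in_H] y_in_H]
      by simp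
    then show "y \<in> (\<lambda>a. g \<otimes> a) ` (A \<inter> H)" using a_in_A y_eq y_in_H by blast
  qed (use g_in_H H_subgroup in \<open>auto simp: l_coset_def subgroup.m_closed\<close>)
  moreover have "inj_on (\<lambda>a. g \<otimes> a) (A \<inter> H)"
    using g_carrier A_carrier l_cancel[of g] by (auto simp: inj_on_def subset_iff)
  ultimately show ?thesis by (simp add: card_image)
qed

locale locally_finite_group = group G for G :: "('a, 'b) monoid_scheme" (structure) +
  fixes stage :: "nat \<Rightarrow> 'a set"
  assumes stage_finite: "finite (stage n)"
    and stage_subgroup: "subgroup (stage n) G"
    and stage_mono: "n \<le> m \<Longrightarrow> stage n \<subseteq> stage m"
    and stage_Union: "carrier G = (\<Union>n. stage n)"
begin

lemma stage_carrier: "stage n \<subseteq> carrier G"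
  using stage_subgroup subgroup.subset by blast

lemma carrier_stage:
  assumes "g \<in> carrier G"
  obtains n where "g \<in> stage n"
  using assms stage_Union by blast

lemma stage_mult: "g \<in> stage n \<Longrightarrow> h \<in> stage n \<Longrightarrow> g \<otimes> h \<in> stage n"
  using stage_subgroup by (rule subgroup.m_closed)

lemma stage_inv: "g \<in> stage n \<Longrightarrow> inv g \<in> stage n"
  using stage_subgroup by (rule subgroup.m_inv_closed)

lemma finite_subset_stage:
  assumes "finite F" "F \<subseteq> carrier G"
  obtains n where "F \<subseteq> stage n"
proof -
  have "\<exists>n. F \<subseteq> stage n" using assms
  proof (induction F)
    case (insert g F)
    then obtain n m where "F \<subseteq> stage n" "g \<in> stage m" using stage_Union by auto
    then have "insert g F \<subseteq> stage (max n m)"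
      using stage_mono[of n "max n m"] stage_mono[of m "max n m"] by auto
    then show ?case by blast
  qed simp
  then show ?thesis using that by blast
qed

theorem amenable: "amenable_grp G"
proof (rule amenable_grp_if_eventually_invariant_means)
  define m :: "nat \<Rightarrow> 'a set \<Rightarrow> real" where "m n A = card (A \<inter> stage n) / card (stage n)" for n A
  have pos: "card (stage n) > 0" for n
    using stage_finite subgroup.one_closed[OF stage_subgroup] by (auto simp: card_gt_0_iff)
  have "card (A \<inter> stage n) \<le> card (stage n)" for n A
    using stage_finite by (intro card_mono) auto
  then show "m n A \<in> {0..1}" for n A using pos[of n] by (auto simp: m_def)
  show "m n (carrier G) = 1" for n
    using pos[of n] stage_carrier[of n] by (simp add: m_def Int_absorb1)
  show "m n (A \<union> B) = m n A + m n B" if "A \<inter> B = {}" for n A B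
  proof -
    have "card ((A \<union> B) \<inter> stage n) = card (A \<inter> stage n) + card (B \<inter> stage n)"
      using that stage_finite by (subst Int_Un_distrib2, intro card_Un_disjoint) auto
    then show ?thesis by (simp add: m_def add_divide_distrib)
  qed
  show "\<forall>\<^sub>F n in sequentially. m n (g <# A) = m n A"
    if g_carrier: "g \<in> carrier G" and A_carrier: "A \<subseteq> carrier G" for g A
  proof -
    obtain N where "g \<in> stage N" using g_carrier by (rule carrier_stage)
    then have "m n (g <# A) = m n A" if "n \<ge> N" for n
      using card_l_coset_Int_subgroup[OF stage_subgroup _ A_carrier] stage_mono[OF that]
      by (auto simp: m_def)
    then show ?thesis by (rule eventually_sequentiallyI)
  qed
qed

end

subsection \<open>Invariant von Neumann subalgebras\<close>

locale escaping_group = locally_finite_group +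
  assumes escape: "\<exists>c :: nat \<Rightarrow> 'a. (\<forall>i. c i \<in> carrier G) \<and>
     (\<forall>i. \<forall>g\<in>stage n. inv (c i) \<otimes> g \<otimes> c i = g) \<and>
     (\<forall>g\<in>carrier G - stage n. \<forall>N. \<forall>\<^sub>F i in sequentially. inv (c i) \<otimes> g \<otimes> c i \<notin> stage N)"
begin

theorem icc:
  assumes "stage 0 = {\<one>}"
  shows "icc_grp G"
  unfolding icc_grp_def
proof (intro ballI impI notI)
  fix g assume g_carrier: "g \<in> carrier G" and g_nontrivial: "g \<noteq> \<one>"
    and fin: "finite {h \<otimes> g \<otimes> inv h | h. h \<in> carrier G}"
  obtain c where c_carrier: "\<And>i. c i \<in> carrier G"
      and c_escapes: "\<And>N. \<forall>\<^sub>F i in sequentially. inv (c i) \<otimes> g \<otimes> c i \<notin> stage N"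
    using escape[of 0] g_carrier g_nontrivial assms by blast
  obtain N where class_in_stage: "{h \<otimes> g \<otimes> inv h | h. h \<in> carrier G} \<subseteq> stage N"
    using finite_subset_stage[OF fin] g_carrier by blast
  obtain i where "inv (c i) \<otimes> g \<otimes> c i \<notin> stage N"
    using eventually_happens'[OF sequentially_bot c_escapes] by blast
  moreover have "inv (c i) \<otimes> g \<otimes> c i \<in> {h \<otimes> g \<otimes> inv h | h. h \<in> carrier G}"
    using c_carrier[of i] by (intro CollectI exI[of _ "inv (c i)"]) auto
  ultimately show False using class_in_stage by blast
qed

lemma supp_cutoff_stage:
  fixes a :: "'a \<Rightarrow> complex"
  shows "finite (supp (cutoff (stage n) a))" "supp (cutoff (stage n) a) \<subseteq> carrier G"
proof -
  have "supp (cutoff (stage n) a) \<subseteq> stage n" by (auto simp: supp_def cutoff_def)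
  then show "finite (supp (cutoff (stage n) a))" "supp (cutoff (stage n) a) \<subseteq> carrier G"
    using stage_finite[of n] stage_carrier[of n] finite_subset by blast+
qed

lemma conjugates_tendsto_0:
  assumes \<xi>_l2: "\<xi> \<in> l2 G" and c_carrier: "\<And>i. c i \<in> carrier G" and h_carrier: "h \<in> carrier G"
    and h_escapes: "\<And>N. \<forall>\<^sub>F i in sequentially. inv (c i) \<otimes> h \<otimes> c i \<notin> stage N"
  shows "(\<lambda>i. conjugate G (c i) \<xi> h) \<longlonglongrightarrow> 0"
proof (rule tendstoI)
  fix \<epsilon> :: real assume "\<epsilon> > 0"
  then obtain F where F_finite: "finite F" and F_carrier: "F \<subseteq> carrier G"
      and small_outside_F: "\<And>h. h \<notin> F \<Longrightarrow> cmod (\<xi> h) < \<epsilon>"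
    using l2_vanishes_at_infinity[OF \<xi>_l2] by blast
  obtain N where "F \<subseteq> stage N" using F_finite F_carrier by (rule finite_subset_stage)
  then show "\<forall>\<^sub>F i in sequentially. dist (conjugate G (c i) \<xi> h) 0 < \<epsilon>"
    using small_outside_F
    by (intro eventually_mono[OF h_escapes[of N]])
      (auto simp: conjugate_apply \<xi>_l2 c_carrier h_carrier)
qed

lemma conjugates_tendsto_cutoff:
  obtains c where "\<And>i. c i \<in> carrier G"
    and "\<And>\<xi> h. \<xi> \<in> l2 G \<Longrightarrow> (\<lambda>i. conjugate G (c i) \<xi> h) \<longlonglongrightarrow> cutoff (stage n) \<xi> h"
proof -
  obtain c where c_carrier: "\<And>i. c i \<in> carrier G"
    and c_fixes: "\<And>i g. g \<in> stage n \<Longrightarrow> inv (c i) \<otimes> g \<otimes> c i = g"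
    and c_escapes: "\<And>g N. g \<in> carrier G \<Longrightarrow> g \<notin> stage n \<Longrightarrow>
      \<forall>\<^sub>F i in sequentially. inv (c i) \<otimes> g \<otimes> c i \<notin> stage N"
    using escape[of n] by blast
  have "(\<lambda>i. conjugate G (c i) \<xi> h) \<longlonglongrightarrow> cutoff (stage n) \<xi> h" if \<xi>_l2: "\<xi> \<in> l2 G" for \<xi> h
  proof -
    consider (in_stage) "h \<in> stage n" | (outside) "h \<notin> carrier G"
      | (escaping) "h \<in> carrier G" "h \<notin> stage n" by blast
    then show ?thesis
    proof cases
      case in_stage
      then have "h \<in> carrier G" using stage_carrier by blast
      then show ?thesis
        using in_stage by (simp add: conjugate_apply \<xi>_l2 c_carrier c_fixes cutoff_def)
    next
      case outside
      then show ?thesis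
        using stage_carrier l2_outside[OF l2_conjugate[OF \<xi>_l2 c_carrier] outside]
        by (auto simp: cutoff_def)
    next
      case escaping
      then have "(\<lambda>i. conjugate G (c i) \<xi> h) \<longlonglongrightarrow> 0"
        by (intro conjugates_tendsto_0 \<xi>_l2 c_carrier c_escapes)
      then show ?thesis using escaping by (simp add: cutoff_def)
    qed
  qed
  then show ?thesis using that c_carrier by blast
qed

end

locale invariant_vNa = escaping_group +
  fixes M :: "(('a \<Rightarrow> complex) \<Rightarrow> 'a \<Rightarrow> complex) set"
  assumes vNa: "is_vNa G M" and M_sub: "M \<subseteq> grpvN G (carrier G)" and M_inv: "G_invariant G M"
begin

lemma M_right_commutant: "T \<in> M \<Longrightarrow> T \<in> right_commutant G"
  using M_sub grpvN_subset_right_commutant by blast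

lemma M_Bop: "T \<in> M \<Longrightarrow> T \<in> Bop G"
  using M_right_commutant right_commutant_Bop by blast

lemma conj_in_M: "T \<in> M \<Longrightarrow> g \<in> carrier G \<Longrightarrow> lreg G g \<circ> T \<circ> lreg G (inv g) \<in> M"
  using M_inv adj_lreg unfolding G_invariant_def by fastforce

text \<open>
  Conjugation by the elements of an escaping sequence fixes the coefficients on \<open>stage n\<close> and moves
  all others to infinity, so the truncation is a weak limit of elements of \<open>M\<close>.
\<close>

lemma
  assumes T_in_M: "T \<in> M" and T_bound: "op_bound G C T"
  shows cutoff_in_M: "left_conv G (cutoff (stage n) (T (delta \<one>))) \<in> M" (is "?S \<in> M")
    and op_bound_cutoff: "op_bound G C (left_conv G (cutoff (stage n) (T (delta \<one>))))"
proof -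
  obtain c where c_carrier: "\<And>i. c i \<in> carrier G"
    and c_tendsto_cutoff: "\<And>\<xi> h. \<xi> \<in> l2 G \<Longrightarrow> (\<lambda>i. conjugate G (c i) \<xi> h) \<longlonglongrightarrow> cutoff (stage n) \<xi> h"
    using conjugates_tendsto_cutoff by blast
  define T' where "T' i = lreg G (c i) \<circ> T \<circ> lreg G (inv (c i))" for i
  have T'_M: "T' i \<in> M" for i unfolding T'_def by (rule conj_in_M[OF T_in_M c_carrier])
  have T'_bound: "op_bound G C (T' i)" for i
    unfolding T'_def by (rule op_bound_conjugate[OF M_Bop[OF T_in_M] T_bound c_carrier])
  have S_commutant: "?S \<in> right_commutant G"
      and S_delta_one: "?S (delta \<one>) = cutoff (stage n) (T (delta \<one>))"
    by (intro left_conv_right_commutant left_conv_delta_one supp_cutoff_stage)+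
  have "(\<lambda>i. T' i (delta \<one>) h) \<longlonglongrightarrow> ?S (delta \<one>) h" for h
    unfolding T'_def conjugate_right_commutant[OF M_right_commutant[OF T_in_M] c_carrier]
      S_delta_one
    by (rule c_tendsto_cutoff[OF Bop_l2[OF M_Bop[OF T_in_M]]])
  then have lim: "(\<lambda>i. T' i (delta k) h) \<longlonglongrightarrow> ?S (delta k) h"
      if "h \<in> carrier G" "k \<in> carrier G" for h k
    unfolding right_commutant_delta_apply[OF M_right_commutant[OF T'_M] that(2,1)]
      right_commutant_delta_apply[OF S_commutant that(2,1)] .
  show "?S \<in> M"
    by (rule vNa_limit[OF vNa T'_M T'_bound right_commutant_Bop[OF S_commutant] lim])
  show "op_bound G C ?S"
    by (rule op_bound_limit[OF M_Bop[OF T'_M] T'_bound right_commutant_Bop[OF S_commutant] lim])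
qed

definition fin_coeffs :: "('a \<Rightarrow> complex) set" where
  "fin_coeffs = {a. finite (supp a) \<and> (\<exists>T\<in>M. T (delta \<one>) = a)}"

definition group_part :: "'a set" where
  "group_part = {g \<in> carrier G. lreg G g \<in> M}"

lemma fin_coeffsI: "T \<in> M \<Longrightarrow> finite (supp (T (delta \<one>))) \<Longrightarrow> T (delta \<one>) \<in> fin_coeffs"
  by (auto simp: fin_coeffs_def)

lemma fin_coeffsE:
  assumes "a \<in> fin_coeffs"
  obtains T where "T \<in> M" "a = T (delta \<one>)" "finite (supp a)"
  using assms by (auto simp: fin_coeffs_def)

lemma fin_coeffs_finite: "a \<in> fin_coeffs \<Longrightarrow> finite (supp a)"
  by (simp add: fin_coeffs_def)

lemma fin_coeffs_l2: "a \<in> fin_coeffs \<Longrightarrow> a \<in> l2 G"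
  by (auto elim!: fin_coeffsE intro: Bop_l2 M_Bop)

lemma fin_coeffs_supp_carrier: "a \<in> fin_coeffs \<Longrightarrow> k \<in> supp a \<Longrightarrow> k \<in> carrier G"
  using l2_supp fin_coeffs_l2 by blast

lemma fin_coeffs_cutoff:
  assumes "a \<in> fin_coeffs"
  shows "cutoff (stage n) a \<in> fin_coeffs"
proof -
  obtain T where T_in_M: "T \<in> M" and a_eq: "a = T (delta \<one>)" using assms by (rule fin_coeffsE)
  obtain C where "op_bound G C T" using Bop_bounded M_Bop T_in_M by blast
  then show ?thesis
    using fin_coeffsI[OF cutoff_in_M[OF T_in_M, of C n]] supp_cutoff_stage
    by (simp add: left_conv_delta_one a_eq)
qed

lemma fin_coeffs_add:
  assumes a_fin: "a \<in> fin_coeffs" and b_fin: "b \<in> fin_coeffs"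
  shows "(\<lambda>k. a k + b k) \<in> fin_coeffs"
proof -
  obtain T S where "T \<in> M" "a = T (delta \<one>)" "S \<in> M" "b = S (delta \<one>)"
    using a_fin b_fin by (auto elim!: fin_coeffsE)
  moreover have "finite (supp (\<lambda>k. a k + b k))"
    using fin_coeffs_finite[OF a_fin] fin_coeffs_finite[OF b_fin]
    by (intro finite_subset[OF supp_add]) simp
  ultimately show ?thesis using fin_coeffsI[OF is_vNaD(3)[OF vNa, of T S]] by simp
qed

lemma fin_coeffs_scale:
  assumes a_fin: "a \<in> fin_coeffs"
  shows "(\<lambda>k. z * a k) \<in> fin_coeffs"
proof -
  obtain T where "T \<in> M" "a = T (delta \<one>)" using a_fin by (rule fin_coeffsE)
  moreover have "finite (supp (\<lambda>k. z * a k))"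
    by (rule finite_subset[OF supp_scale fin_coeffs_finite[OF a_fin]])
  ultimately show ?thesis using fin_coeffsI[OF is_vNaD(4)[OF vNa, of T z]] by simp
qed

lemma fin_coeffs_conjugate:
  assumes a_fin: "a \<in> fin_coeffs" and g_carrier: "g \<in> carrier G"
  shows "conjugate G g a \<in> fin_coeffs"
proof -
  obtain T where T_in_M: "T \<in> M" and a_eq: "a = T (delta \<one>)" using a_fin by (rule fin_coeffsE)
  have "supp (conjugate G g a) \<subseteq> (\<lambda>k. g \<otimes> k \<otimes> inv g) ` supp a"
  proof
    fix k assume "k \<in> supp (conjugate G g a)"
    moreover from this have k_carrier: "k \<in> carrier G"
      using l2_supp l2_conjugate fin_coeffs_l2[OF a_fin] g_carrier by blast
    ultimately have "inv g \<otimes> k \<otimes> g \<in> supp a"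
      using conjugate_apply[OF fin_coeffs_l2[OF a_fin] g_carrier k_carrier] by (simp add: supp_def)
    moreover have "k = g \<otimes> (inv g \<otimes> k \<otimes> g) \<otimes> inv g"
      using k_carrier g_carrier by (simp add: m_assoc) (simp flip: m_assoc)
    ultimately show "k \<in> (\<lambda>k. g \<otimes> k \<otimes> inv g) ` supp a" by blast
  qed
  then have "finite (supp (conjugate G g a))"
    using fin_coeffs_finite[OF a_fin] finite_surj by blast
  then show ?thesis
    using fin_coeffsI[OF conj_in_M[OF T_in_M g_carrier]]
    unfolding conjugate_right_commutant[OF M_right_commutant[OF T_in_M] g_carrier] a_eq by blast
qed

lemma fin_coeffs_star_conv:
  assumes a_fin: "a \<in> fin_coeffs" and b_fin: "b \<in> fin_coeffs"
  shows "star_conv G a b \<in> fin_coeffs"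
proof -
  obtain T where T_in_M: "T \<in> M" and a_eq: "a = T (delta \<one>)" using a_fin by (rule fin_coeffsE)
  obtain R where R_in_M: "R \<in> M" and b_eq: "b = R (delta \<one>)" using b_fin by (rule fin_coeffsE)
  obtain S where S_in_M: "S \<in> M" and S_adjoint: "is_adjoint G T S"
    using is_vNaD(6)[OF vNa T_in_M] by blast
  have "finite (supp (star_conv G a b))"
    using a_fin b_fin by (intro finite_supp_star_conv fin_coeffs_l2 fin_coeffs_finite)
  moreover have "(S \<circ> R) (delta \<one>) = star_conv G a b"
    unfolding a_eq b_eq
    by (intro star_conv_right_commutant M_right_commutant M_Bop T_in_M R_in_M S_in_M S_adjoint)
  ultimately show ?thesis using fin_coeffsI[OF is_vNaD(5)[OF vNa S_in_M R_in_M]] by simp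
qed

lemma group_part_iff: "g \<in> group_part \<longleftrightarrow> g \<in> carrier G \<and> delta g \<in> fin_coeffs"
proof
  assume g_group_part: "g \<in> group_part"
  have "finite (supp (delta g))" by (simp add: supp_def delta_def)
  then show "g \<in> carrier G \<and> delta g \<in> fin_coeffs"
    using g_group_part fin_coeffsI[of "lreg G g"] by (simp add: group_part_def lreg_delta)
next
  assume g_carrier: "g \<in> carrier G \<and> delta g \<in> fin_coeffs"
  then obtain T where T_in_M: "T \<in> M" and T_delta_one: "delta g = T (delta \<one>)"
    by (blast elim: fin_coeffsE)
  have "T = lreg G g"
    using g_carrier T_delta_one
    by (intro right_commutant_eqI M_right_commutant[OF T_in_M] lreg_right_commutant)
      (simp_all add: lreg_delta)
  then show "g \<in> group_part" using g_carrier T_in_M by (simp add: group_part_def)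
qed

lemma group_part_normal: "group_part \<lhd> G"
proof (rule normal_invI)
  have one: "\<one> \<in> group_part"
  proof -
    have "lreg G \<one> = idop G"
      using lreg_Bop[OF one_closed] Bop_idop by (rule Bop_ext) (simp add: lreg_one idop_def)
    then show ?thesis using is_vNaD(2)[OF vNa] by (simp add: group_part_def)
  qed
  show "subgroup group_part G"
  proof (rule subgroupI)
    fix g h assume g_group_part: "g \<in> group_part" and h_group_part: "h \<in> group_part"
    have "lreg G g \<circ> lreg G h = lreg G (g \<otimes> h)"
      using g_group_part h_group_part by (auto simp: group_part_def lreg_lreg)
    then show "g \<otimes> h \<in> group_part"
      using g_group_part h_group_part is_vNaD(5)[OF vNa, of "lreg G g" "lreg G h"]
      by (simp add: group_part_def)
    obtain S where S_in_M: "S \<in> M" and S_adjoint: "is_adjoint G (lreg G g) S"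
      using is_vNaD(6)[OF vNa] g_group_part by (auto simp: group_part_def)
    have "S = lreg G (inv g)"
      using g_group_part
      by (intro is_adjoint_unique[OF M_Bop[OF S_in_M] _ S_adjoint] lreg_Bop is_adjoint_lreg)
        (simp_all add: group_part_def)
    then show "inv g \<in> group_part" using S_in_M g_group_part by (simp add: group_part_def)
  qed (use one in \<open>auto simp: group_part_def\<close>)
  fix x g assume x_carrier: "x \<in> carrier G" and g_group_part: "g \<in> group_part"
  have "lreg G x \<circ> lreg G g \<circ> lreg G (inv x) = lreg G (x \<otimes> g \<otimes> inv x)"
    using x_carrier g_group_part by (auto simp: group_part_def lreg_lreg m_assoc)
  then show "x \<otimes> g \<otimes> inv x \<in> group_part"
    using conj_in_M[of "lreg G g" x] x_carrier g_group_part by (simp add: group_part_def)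
qed

lemma group_part_subgroup: "subgroup group_part G"
  using group_part_normal normal_imp_subgroup by blast

lemma fin_coeffs_one: "delta \<one> \<in> fin_coeffs"
  using group_part_iff subgroup.one_closed[OF group_part_subgroup] by blast

lemma fin_coeffs_lreg:
  assumes a_fin: "a \<in> fin_coeffs" and g_group_part: "g \<in> group_part"
  shows "lreg G g a \<in> fin_coeffs"
proof -
  have g_carrier: "g \<in> carrier G" and inv_g_carrier: "inv g \<in> carrier G"
      and delta_inv_g_fin: "delta (inv g) \<in> fin_coeffs"
    using g_group_part subgroup.m_inv_closed[OF group_part_subgroup g_group_part]
    by (auto simp: group_part_iff)
  have "lreg G g a = star_conv G (delta (inv g)) a"
    using fin_coeffs_l2[OF a_fin] g_carrier inv_g_carrier delta_inv_g_fin
    by (auto simp: star_conv_def inner_delta_left rreg_apply lreg_def)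
  then show ?thesis using fin_coeffs_star_conv[OF delta_inv_g_fin a_fin] by simp
qed

lemma fin_coeffs_rreg:
  assumes a_fin: "a \<in> fin_coeffs" and g_group_part: "g \<in> group_part"
  shows "rreg G g a \<in> fin_coeffs"
proof -
  have g_carrier: "g \<in> carrier G" and inv_group_part: "inv g \<in> group_part"
    using g_group_part subgroup.m_inv_closed[OF group_part_subgroup g_group_part]
    by (auto simp: group_part_iff)
  have "conjugate G g (lreg G (inv g) a) = rreg G g a"
    using fin_coeffs_l2[OF a_fin] g_carrier
    by (simp add: conjugate_def l2_rreg lreg_rreg[symmetric] lreg_lreg lreg_one)
  then show ?thesis
    using fin_coeffs_conjugate[OF fin_coeffs_lreg[OF a_fin inv_group_part] g_carrier] by simp
qed

lemma M_eq_grpvN: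
  assumes supp: "\<And>a. a \<in> fin_coeffs \<Longrightarrow> supp a \<subseteq> group_part"
  shows "M = grpvN G group_part"
proof
  have "lreg G ` group_part \<subseteq> M" by (auto simp: group_part_def)
  then show "grpvN G group_part \<subseteq> M" unfolding grpvN_def vN_gen_def using vNa by blast
  show "M \<subseteq> grpvN G group_part"
    unfolding grpvN_def vN_gen_def
  proof (intro subsetI InterI)
    fix T M' assume T_in_M: "T \<in> M" and "M' \<in> {M. is_vNa G M \<and> lreg G ` group_part \<subseteq> M}"
    then have M'_vNa: "is_vNa G M'" and lreg_in_M': "lreg G ` group_part \<subseteq> M'" by auto
    obtain C where T_bound: "op_bound G C T" using Bop_bounded M_Bop T_in_M by blast
    define t where "t n = cutoff (stage n) (T (delta \<one>))" for n
    have t_commutant: "left_conv G (t n) \<in> right_commutant G"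
        and t_delta_one: "left_conv G (t n) (delta \<one>) = t n" for n
      unfolding t_def by (intro left_conv_right_commutant left_conv_delta_one supp_cutoff_stage)+
    have t_fin: "t n \<in> fin_coeffs" for n
      using fin_coeffsI[OF cutoff_in_M[OF T_in_M T_bound, of n]] t_delta_one supp_cutoff_stage(1)
      by (simp add: t_def)
    have t_M': "left_conv G (t n) \<in> M'" for n
      unfolding left_conv_def
      by (rule vNa_sum[OF M'_vNa fin_coeffs_finite[OF t_fin]])
        (use supp[OF t_fin] lreg_in_M' in blast)
    have t_bound: "op_bound G C (left_conv G (t n))" for n
      unfolding t_def by (rule op_bound_cutoff[OF T_in_M T_bound])
    show "T \<in> M'"
    proof (rule vNa_limit[OF M'_vNa t_M' t_bound M_Bop[OF T_in_M]])
      fix h k assume h_carrier: "h \<in> carrier G" and k_carrier: "k \<in> carrier G"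
      obtain m where "h \<otimes> inv k \<in> stage m"
        using h_carrier k_carrier carrier_stage[of "h \<otimes> inv k"] by auto
      then have "\<forall>\<^sub>F n in sequentially. t n (h \<otimes> inv k) = T (delta \<one>) (h \<otimes> inv k)"
        using stage_mono by (intro eventually_sequentiallyI[of m]) (auto simp: t_def cutoff_def)
      then show "(\<lambda>n. left_conv G (t n) (delta k) h) \<longlonglongrightarrow> T (delta k) h"
        unfolding right_commutant_delta_apply[OF t_commutant k_carrier h_carrier] t_delta_one
          right_commutant_delta_apply[OF M_right_commutant[OF T_in_M] k_carrier h_carrier]
        by (rule tendsto_eventually)
    qed
  qed
qed

end

subsection \<open>The conditional expectation on group elements\<close>

definition lin_subspace :: "('a \<Rightarrow> complex) set \<Rightarrow> bool" where
  "lin_subspace V \<longleftrightarrow> (\<lambda>_. 0) \<in> V \<and> (\<forall>a\<in>V. \<forall>b\<in>V. (\<lambda>k. a k + b k) \<in> V) \<and> (\<forall>a\<in>V. \<forall>z. (\<lambda>k. z * a k) \<in> V)"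

definition has_projections :: "('a, 'b) monoid_scheme \<Rightarrow> ('a \<Rightarrow> complex) set \<Rightarrow> bool" where
  "has_projections G V \<longleftrightarrow> (\<forall>\<eta>\<in>l2 G. \<exists>\<xi>\<in>V. \<forall>y\<in>V. inner_l2 G y \<xi> = inner_l2 G y \<eta>)"

lemma lin_subspaceD:
  assumes "lin_subspace V"
  shows "(\<lambda>_. 0) \<in> V" "a \<in> V \<Longrightarrow> b \<in> V \<Longrightarrow> (\<lambda>k. a k + b k) \<in> V" "a \<in> V \<Longrightarrow> (\<lambda>k. z * a k) \<in> V"
  using assms by (auto simp: lin_subspace_def)

lemma lin_subspace_diff_scaled:
  assumes "lin_subspace V" "a \<in> V" "b \<in> V"
  shows "(\<lambda>k. a k - z * b k) \<in> V"
  using lin_subspaceD(2)[OF assms(1,2) lin_subspaceD(3)[OF assms(1,3), of "- z"]] by simp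

lemma has_projections_orthogonal_extension:
  assumes V_subspace: "lin_subspace V" and V_l2: "V \<subseteq> l2 G" and W_projections: "has_projections G W"
    and W_in_V: "W \<subseteq> V" and w_in_V: "w \<in> V" and w_nonzero: "inner_l2 G w w \<noteq> 0"
    and orthogonal: "\<And>y. y \<in> W \<Longrightarrow> inner_l2 G y w = 0"
    and split: "\<And>y. y \<in> V \<Longrightarrow> \<exists>s. (\<lambda>k. y k - s * w k) \<in> W"
  shows "has_projections G V"
  unfolding has_projections_def
proof
  fix \<eta> assume \<eta>_l2: "\<eta> \<in> l2 G"
  have V_elem_l2: "y \<in> l2 G" if "y \<in> V" for y using V_l2 that by blast
  obtain \<xi>' where \<xi>'_in_W: "\<xi>' \<in> W" and \<xi>'_inner: "\<And>y. y \<in> W \<Longrightarrow> inner_l2 G y \<xi>' = inner_l2 G y \<eta>"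
    using W_projections \<eta>_l2 unfolding has_projections_def by blast
  have \<xi>'_in_V: "\<xi>' \<in> V" using \<xi>'_in_W W_in_V by blast
  define z where "z = inner_l2 G w \<eta> / inner_l2 G w w"
  define \<xi> where "\<xi> = (\<lambda>k. \<xi>' k + z * w k)"
  have \<xi>_in_V: "\<xi> \<in> V"
    unfolding \<xi>_def by (intro lin_subspaceD[OF V_subspace] \<xi>'_in_V w_in_V)
  have inner_\<xi>: "inner_l2 G y \<xi> = inner_l2 G y \<xi>' + z * inner_l2 G y w" if "y \<in> V" for y
    unfolding \<xi>_def using that V_elem_l2 V_elem_l2[OF \<xi>'_in_V] V_elem_l2[OF w_in_V]
    by (simp add: inner_add_right l2_scale inner_scale_right)
  have "inner_l2 G w \<xi>' = 0" using orthogonal[OF \<xi>'_in_W] by (subst inner_cnj) simp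
  then have inner_w: "inner_l2 G w \<xi> = inner_l2 G w \<eta>"
    using inner_\<xi>[OF w_in_V] w_nonzero by (simp add: z_def)
  have "inner_l2 G y \<xi> = inner_l2 G y \<eta>" if y_in_V: "y \<in> V" for y
  proof -
    obtain s where remainder_in_W: "(\<lambda>k. y k - s * w k) \<in> W" using split[OF y_in_V] by blast
    define y' where "y' = (\<lambda>k. y k - s * w k)"
    have y'_in_W: "y' \<in> W" and y'_in_V: "y' \<in> V" using remainder_in_W W_in_V by (auto simp: y'_def)
    have inner_y: "inner_l2 G y \<zeta> = inner_l2 G y' \<zeta> + cnj s * inner_l2 G w \<zeta>" if "\<zeta> \<in> l2 G" for \<zeta>
    proof -
      have "y = (\<lambda>k. y' k + s * w k)" by (simp add: y'_def)
      then show ?thesis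
        using inner_add_left[OF that V_elem_l2[OF y'_in_V] l2_scale[OF V_elem_l2[OF w_in_V]], of s]
        by (simp add: inner_scale_left)
    qed
    have "inner_l2 G y' \<xi> = inner_l2 G y' \<eta>"
      using inner_\<xi>[OF y'_in_V] orthogonal[OF y'_in_W] \<xi>'_inner[OF y'_in_W] by simp
    then show ?thesis by (simp only: inner_y[OF V_elem_l2[OF \<xi>_in_V]] inner_y[OF \<eta>_l2] inner_w)
  qed
  then show "\<exists>\<xi>\<in>V. \<forall>y\<in>V. inner_l2 G y \<xi> = inner_l2 G y \<eta>" using \<xi>_in_V by blast
qed

lemma has_projections_extension:
  assumes V_subspace: "lin_subspace V" and V_l2: "V \<subseteq> l2 G" and W_subspace: "lin_subspace W"
    and W_projections: "has_projections G W" and W_in_V: "W \<subseteq> V"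
    and v_in_V: "v \<in> V" and v_notin_W: "v \<notin> W" and split: "\<And>y. y \<in> V \<Longrightarrow> \<exists>s. (\<lambda>k. y k - s * v k) \<in> W"
  shows "has_projections G V"
proof -
  have V_elem_l2: "y \<in> l2 G" if "y \<in> V" for y using V_l2 that by blast
  obtain v' where v'_in_W: "v' \<in> W" and v'_inner: "\<And>y. y \<in> W \<Longrightarrow> inner_l2 G y v' = inner_l2 G y v"
    using W_projections V_elem_l2[OF v_in_V] unfolding has_projections_def by blast
  have v'_in_V: "v' \<in> V" using v'_in_W W_in_V by blast
  define w where "w = (\<lambda>k. v k - v' k)"
  have w_in_V: "w \<in> V"
    using lin_subspace_diff_scaled[OF V_subspace v_in_V v'_in_V, of 1] by (simp add: w_def)
  show ?thesis
  proof (rule has_projections_orthogonal_extension[OF V_subspace V_l2 W_projections W_in_V w_in_V])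
    have "v \<noteq> v'" using v_notin_W v'_in_W by blast
    then have "w \<noteq> (\<lambda>_. 0)" by (auto simp: w_def fun_eq_iff)
    then show "inner_l2 G w w \<noteq> 0"
      using norm_l2_eq_0[OF V_elem_l2[OF w_in_V]]
      by (auto simp: inner_self[OF V_elem_l2[OF w_in_V]])
    show "inner_l2 G y w = 0" if "y \<in> W" for y
      unfolding w_def
      using that v'_inner[OF that] W_in_V V_elem_l2 V_elem_l2[OF v'_in_V] V_elem_l2[OF v_in_V]
      by (subst inner_diff_right) auto
    show "\<exists>s. (\<lambda>k. y k - s * w k) \<in> W" if y_in_V: "y \<in> V" for y
    proof -
      obtain s where "(\<lambda>k. y k - s * v k) \<in> W" using split[OF y_in_V] by blast
      from lin_subspaceD(2)[OF W_subspace this lin_subspaceD(3)[OF W_subspace v'_in_W, of s]]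
      have "(\<lambda>k. y k - s * w k) \<in> W" by (simp add: w_def algebra_simps)
      then show ?thesis by blast
    qed
  qed
qed

lemma has_projections_finite_support:
  assumes "finite F" "F \<subseteq> carrier G" "lin_subspace V" "\<And>a. a \<in> V \<Longrightarrow> supp a \<subseteq> F"
  shows "has_projections G V"
  using assms
proof (induction F arbitrary: V)
  case empty
  have "inner_l2 G y (\<lambda>_. 0) = inner_l2 G y \<eta>" if "y \<in> V" for y \<eta>
    using empty(3)[OF that] by (intro inner_cong_supp) auto
  then show ?case using lin_subspaceD(1)[OF empty(2)] unfolding has_projections_def by blast
next
  case (insert x F)
  define W where "W = {y \<in> V. y x = 0}"
  have W_subspace: "lin_subspace W" and W_in_V: "W \<subseteq> V"
    using insert.prems(2) by (auto simp: W_def lin_subspace_def)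
  have W_proj: "has_projections G W"
  proof (rule insert.IH[OF _ W_subspace])
    show "supp a \<subseteq> F" if "a \<in> W" for a
      using insert.prems(3)[of a] that by (auto simp: W_def supp_def)
  qed (use insert.prems(1) in auto)
  have V_l2: "V \<subseteq> l2 G"
  proof
    fix a assume "a \<in> V"
    then show "a \<in> l2 G"
      using insert.prems(1,3) insert.hyps(1)
      by (intro l2_finite_support[of "insert x F"]) (auto simp: supp_def)
  qed
  show ?case
  proof (cases "V = W")
    case False
    then obtain v where v_in_V: "v \<in> V" and v_nonzero: "v x \<noteq> 0" by (auto simp: W_def)
    show ?thesis
    proof (rule has_projections_extension[OF insert.prems(2) V_l2 W_subspace W_proj W_in_V v_in_V])
      show "\<exists>s. (\<lambda>k. y k - s * v k) \<in> W" if "y \<in> V" for y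
        using lin_subspace_diff_scaled[OF insert.prems(2) that v_in_V, where z="y x / v x"]
          v_nonzero
        by (intro exI[of _ "y x / v x"]) (simp add: W_def)
    qed (use v_nonzero in \<open>simp add: W_def\<close>)
  qed (use W_proj in simp)
qed

context invariant_vNa
begin

text \<open>
  The coefficients of the conditional expectation onto \<open>M\<close> of the unitary of \<open>g\<close>. For \<open>g\<close> in a
  stage the orthogonal projection exists by finite dimension, so completeness of \<open>M\<close> plays no role.
\<close>

definition cond_exp :: "'a \<Rightarrow> 'a \<Rightarrow> complex" where
  "cond_exp g = (SOME \<xi>. \<xi> \<in> fin_coeffs \<and> (\<forall>y\<in>fin_coeffs. inner_l2 G y \<xi> = cnj (y g)))"

lemma cond_exp_exists:
  assumes "g \<in> stage n"
  shows "\<exists>\<xi>\<in>fin_coeffs. supp \<xi> \<subseteq> stage n \<and> (\<forall>y\<in>fin_coeffs. inner_l2 G y \<xi> = cnj (y g))"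
proof -
  have g_carrier: "g \<in> carrier G" using assms stage_carrier by blast
  define V where "V = {a \<in> fin_coeffs. supp a \<subseteq> stage n}"
  have "(\<lambda>_. 0) \<in> fin_coeffs" using fin_coeffs_scale[OF fin_coeffs_one, of 0] by simp
  then have "lin_subspace V"
    by (auto simp: lin_subspace_def V_def supp_zero intro: fin_coeffs_add fin_coeffs_scale
        dest!: subsetD[OF supp_add] subsetD[OF supp_scale])
  then have "has_projections G V"
    by (rule has_projections_finite_support[OF stage_finite[of n] stage_carrier]) (simp add: V_def)
  then obtain \<xi> where \<xi>_in_V: "\<xi> \<in> V"
      and \<xi>_inner: "\<And>y. y \<in> V \<Longrightarrow> inner_l2 G y \<xi> = inner_l2 G y (delta g)"
    unfolding has_projections_def using l2_delta[OF g_carrier] by blast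
  have cutoff_\<xi>: "cutoff (stage n) \<xi> = \<xi>" using \<xi>_in_V by (intro cutoff_eq_self) (simp add: V_def)
  have "inner_l2 G y \<xi> = cnj (y g)" if "y \<in> fin_coeffs" for y
  proof -
    have "cutoff (stage n) y \<in> V"
      using fin_coeffs_cutoff[OF that] by (auto simp: V_def cutoff_def supp_def)
    then have "inner_l2 G (cutoff (stage n) y) \<xi> = cnj (cutoff (stage n) y g)"
      by (simp add: \<xi>_inner inner_delta_right[OF g_carrier])
    then show ?thesis using assms by (simp add: inner_cutoff_left cutoff_\<xi>) (simp add: cutoff_def)
  qed
  then show ?thesis using \<xi>_in_V by (auto simp: V_def)
qed

lemma
  assumes "g \<in> carrier G"
  shows cond_exp_fin_coeffs: "cond_exp g \<in> fin_coeffs"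
    and inner_cond_exp: "y \<in> fin_coeffs \<Longrightarrow> inner_l2 G y (cond_exp g) = cnj (y g)"
proof -
  obtain n where "g \<in> stage n" using assms by (rule carrier_stage)
  from cond_exp_exists[OF this]
  have "\<exists>\<xi>. \<xi> \<in> fin_coeffs \<and> (\<forall>y\<in>fin_coeffs. inner_l2 G y \<xi> = cnj (y g))" by blast
  then have "cond_exp g \<in> fin_coeffs \<and> (\<forall>y\<in>fin_coeffs. inner_l2 G y (cond_exp g) = cnj (y g))"
    unfolding cond_exp_def by (rule someI_ex)
  then show "cond_exp g \<in> fin_coeffs" "y \<in> fin_coeffs \<Longrightarrow> inner_l2 G y (cond_exp g) = cnj (y g)"
    by auto
qed

lemma cond_exp_l2: "g \<in> carrier G \<Longrightarrow> cond_exp g \<in> l2 G"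
  by (rule fin_coeffs_l2[OF cond_exp_fin_coeffs])

lemma cond_exp_eqI:
  assumes g_carrier: "g \<in> carrier G" and \<xi>_fin: "\<xi> \<in> fin_coeffs"
    and inner: "\<And>y. y \<in> fin_coeffs \<Longrightarrow> inner_l2 G y \<xi> = cnj (y g)"
  shows "cond_exp g = \<xi>"
proof -
  let ?d = "\<lambda>k. cond_exp g k - \<xi> k"
  note l2 = cond_exp_l2[OF g_carrier] fin_coeffs_l2[OF \<xi>_fin]
  have d_fin: "?d \<in> fin_coeffs"
    using fin_coeffs_add[OF cond_exp_fin_coeffs[OF g_carrier] fin_coeffs_scale[OF \<xi>_fin, of "-1"]]
    by simp
  then have "inner_l2 G ?d ?d = 0"
    using inner_cond_exp[OF g_carrier d_fin] inner[OF d_fin]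
    by (subst inner_diff_right[OF fin_coeffs_l2[OF d_fin] l2]) simp
  then have "norm_l2 G ?d = 0" using inner_self[OF fin_coeffs_l2[OF d_fin]] by simp
  from fun_cong[OF norm_l2_eq_0[OF fin_coeffs_l2[OF d_fin] this]] show ?thesis
    by (simp add: fun_eq_iff)
qed

lemma cond_exp_supp_stage:
  assumes "g \<in> stage n"
  shows "supp (cond_exp g) \<subseteq> stage n"
proof -
  obtain \<xi> where \<xi>_fin: "\<xi> \<in> fin_coeffs" and \<xi>_supp_stage: "supp \<xi> \<subseteq> stage n"
      and \<xi>_inner: "\<forall>y\<in>fin_coeffs. inner_l2 G y \<xi> = cnj (y g)"
    using cond_exp_exists[OF assms] by blast
  have "cond_exp g = \<xi>"
    using assms stage_carrier \<xi>_fin \<xi>_supp_stage \<xi>_inner by (intro cond_exp_eqI) auto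
  then show ?thesis using \<xi>_supp_stage by simp
qed

lemma cond_exp_self:
  assumes "g \<in> carrier G"
  shows "cond_exp g g = complex_of_real ((norm_l2 G (cond_exp g))\<^sup>2)"
proof -
  have "cnj (cond_exp g g) = complex_of_real ((norm_l2 G (cond_exp g))\<^sup>2)"
    using inner_cond_exp[OF assms cond_exp_fin_coeffs[OF assms]]
      inner_self[OF cond_exp_l2[OF assms]]
    by simp
  then show ?thesis by (metis complex_cnj_complex_of_real complex_cnj_cnj)
qed

lemma cond_exp_self_nonzero:
  assumes y_fin: "y \<in> fin_coeffs" and g_supp: "g \<in> supp y"
  shows "cond_exp g g \<noteq> 0"
proof
  have g_carrier: "g \<in> carrier G" using fin_coeffs_supp_carrier[OF y_fin g_supp] .
  assume "cond_exp g g = 0"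
  then have "norm_l2 G (cond_exp g) = 0"
    unfolding cond_exp_self[OF g_carrier] of_real_eq_0_iff by simp
  from norm_l2_eq_0[OF cond_exp_l2[OF g_carrier] this]
  have "inner_l2 G y (cond_exp g) = 0" by (simp add: inner_l2_def)
  then show False using inner_cond_exp[OF g_carrier y_fin] g_supp by (simp add: supp_def)
qed

lemma cond_exp_one:
  assumes "g \<in> carrier G" "g \<noteq> \<one>"
  shows "cond_exp g \<one> = 0"
  using inner_cond_exp[OF assms(1) fin_coeffs_one] assms(2)
  by (simp add: inner_delta_left) (simp add: delta_def)

lemma group_part_if_cond_exp_self_eq_1:
  assumes g_carrier: "g \<in> carrier G" and one: "cond_exp g g = 1"
  shows "g \<in> group_part"
proof -
  let ?d = "\<lambda>k. delta g k - cond_exp g k"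
  note l2 = l2_delta[OF g_carrier] cond_exp_l2[OF g_carrier]
  have "inner_l2 G (delta g) (delta g) = 1"
    using inner_delta_left[OF g_carrier, of "delta g"] by (simp add: delta_def)
  moreover have "inner_l2 G (cond_exp g) (cond_exp g) = 1"
    using inner_cond_exp[OF g_carrier cond_exp_fin_coeffs[OF g_carrier]] one by simp
  ultimately have "inner_l2 G ?d ?d = 0"
    using one
    by (simp add: inner_diff_left inner_diff_right l2 l2_diff inner_delta_left[OF g_carrier]
      inner_delta_right[OF g_carrier])
  then have "norm_l2 G ?d = 0" using inner_self[OF l2_diff[OF l2]] by simp
  then have "cond_exp g = delta g"
    using norm_l2_eq_0[OF l2_diff[OF l2]] by (simp add: fun_eq_iff)
  then show ?thesis using cond_exp_fin_coeffs[OF g_carrier] g_carrier by (simp add: group_part_iff)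
qed

lemma group_part_if_cond_exp_supp:
  assumes g_carrier: "g \<in> carrier G" and supp: "supp (cond_exp g) \<subseteq> {g}"
    and nonzero: "cond_exp g g \<noteq> 0"
  shows "g \<in> group_part"
proof (rule group_part_if_cond_exp_self_eq_1[OF g_carrier])
  have "norm_l2 G (cond_exp g) = cmod (cond_exp g g)"
    using norm_l2_finite_support[of "{g}" G "cond_exp g"] supp g_carrier by (auto simp: supp_def)
  then have square: "cond_exp g g = complex_of_real ((cmod (cond_exp g g))\<^sup>2)"
    using cond_exp_self[OF g_carrier] by simp
  then have "cmod (cond_exp g g) = (cmod (cond_exp g g))\<^sup>2" by (metis abs_power2 norm_of_real)
  then have "cmod (cond_exp g g) = 1" using nonzero by (simp add: power2_eq_square)
  then show "cond_exp g g = 1" using square by simp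
qed

lemma cond_exp_conjugate:
  assumes g_carrier: "g \<in> carrier G" and h_carrier: "h \<in> carrier G"
  shows "cond_exp (h \<otimes> g \<otimes> inv h) = conjugate G h (cond_exp g)"
proof (rule cond_exp_eqI)
  show "conjugate G h (cond_exp g) \<in> fin_coeffs"
    by (rule fin_coeffs_conjugate[OF cond_exp_fin_coeffs[OF g_carrier] h_carrier])
  fix y assume y_fin: "y \<in> fin_coeffs"
  have "inner_l2 G y (conjugate G h (cond_exp g)) = cnj (conjugate G (inv h) y g)"
    using inner_cond_exp[OF g_carrier fin_coeffs_conjugate[OF y_fin inv_closed[OF h_carrier]]]
      inner_conjugate[OF cond_exp_l2[OF g_carrier] fin_coeffs_l2[OF y_fin] h_carrier] by simp
  then show "inner_l2 G y (conjugate G h (cond_exp g)) = cnj (y (h \<otimes> g \<otimes> inv h))"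
    using g_carrier h_carrier by (simp add: conjugate_apply fin_coeffs_l2[OF y_fin])
qed (use g_carrier h_carrier in simp)

lemma cond_exp_centralizer:
  assumes "g \<in> carrier G" "h \<in> carrier G" "k \<in> carrier G" "h \<otimes> g = g \<otimes> h"
  shows "cond_exp g (h \<otimes> k \<otimes> inv h) = cond_exp g k"
proof -
  have "h \<otimes> g \<otimes> inv h = g" using assms by (simp add: m_assoc)
  then have "cond_exp g (h \<otimes> k \<otimes> inv h) = conjugate G h (cond_exp g) (h \<otimes> k \<otimes> inv h)"
    using cond_exp_conjugate[OF assms(1,2)] by simp
  also have "\<dots> = cond_exp g (inv h \<otimes> (h \<otimes> k \<otimes> inv h) \<otimes> h)"
    using assms by (simp add: conjugate_apply cond_exp_l2)
  also have "inv h \<otimes> (h \<otimes> k \<otimes> inv h) \<otimes> h = k"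
    using assms by (simp add: m_assoc) (simp flip: m_assoc)
  finally show ?thesis .
qed

lemma cond_exp_left_mult:
  assumes g_carrier: "g \<in> carrier G" and f_group_part: "f \<in> group_part"
  shows "cond_exp (f \<otimes> g) = lreg G f (cond_exp g)"
proof (rule cond_exp_eqI)
  have f_carrier: "f \<in> carrier G" and inv_group_part: "inv f \<in> group_part"
    using f_group_part subgroup.m_inv_closed[OF group_part_subgroup f_group_part]
    by (auto simp: group_part_def)
  show "f \<otimes> g \<in> carrier G" using f_carrier g_carrier by simp
  show "lreg G f (cond_exp g) \<in> fin_coeffs"
    by (rule fin_coeffs_lreg[OF cond_exp_fin_coeffs[OF g_carrier] f_group_part])
  fix y assume y_fin: "y \<in> fin_coeffs"
  have "inner_l2 G y (lreg G f (cond_exp g)) = cnj (lreg G (inv f) y g)"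
    using inner_cond_exp[OF g_carrier fin_coeffs_lreg[OF y_fin inv_group_part]]
      is_adjointD[OF is_adjoint_lreg[OF f_carrier] fin_coeffs_l2[OF y_fin]
          cond_exp_l2[OF g_carrier]] by simp
  then show "inner_l2 G y (lreg G f (cond_exp g)) = cnj (y (f \<otimes> g))"
    using f_carrier g_carrier by (simp add: lreg_apply fin_coeffs_l2[OF y_fin])
qed

lemma cond_exp_right_mult:
  assumes g_carrier: "g \<in> carrier G" and f_group_part: "f \<in> group_part"
  shows "cond_exp (g \<otimes> f) = rreg G (inv f) (cond_exp g)"
proof (rule cond_exp_eqI)
  have f_carrier: "f \<in> carrier G" and inv_group_part: "inv f \<in> group_part"
    using f_group_part subgroup.m_inv_closed[OF group_part_subgroup f_group_part]
    by (auto simp: group_part_def)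
  show "g \<otimes> f \<in> carrier G" using f_carrier g_carrier by simp
  show "rreg G (inv f) (cond_exp g) \<in> fin_coeffs"
    by (rule fin_coeffs_rreg[OF cond_exp_fin_coeffs[OF g_carrier] inv_group_part])
  fix y assume y_fin: "y \<in> fin_coeffs"
  have "inner_l2 G y (rreg G (inv f) (cond_exp g)) = cnj (rreg G f y g)"
    using inner_cond_exp[OF g_carrier fin_coeffs_rreg[OF y_fin f_group_part]] f_carrier
      is_adjointD[OF is_adjoint_rreg[OF inv_closed[OF f_carrier]] fin_coeffs_l2[OF y_fin]
          cond_exp_l2[OF g_carrier]] by simp
  then show "inner_l2 G y (rreg G (inv f) (cond_exp g)) = cnj (y (g \<otimes> f))"
    using f_carrier g_carrier by (simp add: rreg_apply fin_coeffs_l2[OF y_fin])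
qed

end

definition commutator :: "('a, 'b) monoid_scheme \<Rightarrow> 'a \<Rightarrow> 'a \<Rightarrow> 'a" where
  "commutator G g c = inv\<^bsub>G\<^esub> g \<otimes>\<^bsub>G\<^esub> c \<otimes>\<^bsub>G\<^esub> g \<otimes>\<^bsub>G\<^esub> inv\<^bsub>G\<^esub> c"

context group
begin

lemma commutator_closed: "g \<in> carrier G \<Longrightarrow> c \<in> carrier G \<Longrightarrow> commutator G g c \<in> carrier G"
  by (simp add: commutator_def)

lemma commutator_eq_one:
  assumes "g \<in> carrier G" "c \<in> carrier G" "commutator G g c = \<one>"
  shows "inv c \<otimes> g \<otimes> c = g"
proof -
  have "g \<otimes> commutator G g c \<otimes> c = g \<otimes> c" using assms by simp
  moreover have "g \<otimes> commutator G g c \<otimes> c = c \<otimes> g"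
    using assms(1,2) by (simp add: commutator_def m_assoc) (simp flip: m_assoc)
  ultimately have "inv c \<otimes> g \<otimes> c = inv c \<otimes> (c \<otimes> g)" using assms(1,2) by (simp add: m_assoc)
  then show ?thesis using assms(1,2) by (simp flip: m_assoc)
qed

context
  fixes B :: "'a set" and g c :: 'a and p :: "'a \<Rightarrow> complex"
  assumes B_subgroup: "subgroup B G" and B_normalized: "\<And>f. f \<in> B \<Longrightarrow> inv g \<otimes> f \<otimes> g \<in> B"
    and c_centralizes: "\<And>f. f \<in> B \<Longrightarrow> c \<otimes> f = f \<otimes> c"
    and g_carrier: "g \<in> carrier G" and c_carrier: "c \<in> carrier G" and p_l2: "p \<in> l2 G"
    and p_supp_coset: "supp p \<subseteq> B #> g"
begin

lemma star_conv_conjugate_commutator: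
  "star_conv G p (conjugate G c p) (commutator G g c) = complex_of_real ((norm_l2 G p)\<^sup>2)"
proof -
  note [simp] = g_carrier c_carrier l2_conjugate[OF p_l2 c_carrier]
      commutator_closed[OF g_carrier c_carrier]
  let ?\<rho> = "commutator G g c"
  have "rreg G ?\<rho> (conjugate G c p) k = p k"
    if k_carrier: "k \<in> carrier G" and k_supp: "k \<in> supp p" for k
  proof -
    obtain f where f_in_B: "f \<in> B" and k_eq: "k = f \<otimes> g"
      using p_supp_coset k_supp by (auto simp: r_coset_def)
    have [simp]: "f \<in> carrier G" using subgroup.mem_carrier[OF B_subgroup f_in_B] .
    have "inv c \<otimes> (k \<otimes> ?\<rho>) \<otimes> c = inv c \<otimes> (f \<otimes> c) \<otimes> g"
      unfolding k_eq commutator_def by (simp add: m_assoc) (simp flip: m_assoc)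
    also have "\<dots> = k" unfolding c_centralizes[OF f_in_B, symmetric] k_eq by (simp flip: m_assoc)
    finally show ?thesis using k_carrier by (simp add: rreg_apply conjugate_apply p_l2)
  qed
  then have "inner_l2 G p (rreg G ?\<rho> (conjugate G c p)) = inner_l2 G p p"
    by (rule inner_cong_supp)
  then show ?thesis using inner_self[OF p_l2] by (simp add: star_conv_def)
qed

lemma supp_star_conv_conjugate:
  "supp (star_conv G p (conjugate G c p)) \<subseteq> B #> commutator G g c"
proof
  fix h assume "h \<in> supp (star_conv G p (conjugate G c p))"
  then obtain k where [simp]: "h \<in> carrier G" and k_supp: "k \<in> supp p"
      and kh_supp: "k \<otimes> h \<in> supp (conjugate G c p)"
    using star_conv_supp[OF p_l2 l2_conjugate[OF p_l2 c_carrier]] by blast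
  have [simp]: "k \<in> carrier G" using k_supp l2_supp[OF p_l2] by blast
  have "inv c \<otimes> (k \<otimes> h) \<otimes> c \<in> supp p"
    using kh_supp g_carrier c_carrier by (simp add: supp_def conjugate_apply p_l2)
  then obtain f' where f'_in_B: "f' \<in> B" and f'_eq: "inv c \<otimes> (k \<otimes> h) \<otimes> c = f' \<otimes> g"
    using p_supp_coset by (auto simp: r_coset_def)
  obtain f where f_in_B: "f \<in> B" and k_eq: "k = f \<otimes> g"
    using p_supp_coset k_supp by (auto simp: r_coset_def)
  note [simp] = g_carrier c_carrier subgroup.mem_carrier[OF B_subgroup f_in_B]
      subgroup.mem_carrier[OF B_subgroup f'_in_B]
  have "k \<otimes> h = c \<otimes> (f' \<otimes> g) \<otimes> inv c"
    unfolding f'_eq[symmetric] by (simp add: m_assoc) (simp flip: m_assoc)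
  then have "h = inv k \<otimes> (c \<otimes> (f' \<otimes> g) \<otimes> inv c)" by (simp add: inv_solve_left)
  also have "\<dots> = inv g \<otimes> inv f \<otimes> (c \<otimes> f') \<otimes> g \<otimes> inv c"
    unfolding k_eq by (simp add: inv_mult_group m_assoc)
  also have "\<dots> = (inv g \<otimes> (inv f \<otimes> f') \<otimes> g) \<otimes> commutator G g c"
    unfolding c_centralizes[OF f'_in_B] commutator_def by (simp add: m_assoc) (simp flip: m_assoc)
  finally have "h = (inv g \<otimes> (inv f \<otimes> f') \<otimes> g) \<otimes> commutator G g c" .
  moreover have "inv g \<otimes> (inv f \<otimes> f') \<otimes> g \<in> B"
    using B_subgroup B_normalized f_in_B f'_in_B by (meson subgroup.m_closed subgroup.m_inv_closed)
  ultimately show "h \<in> B #> commutator G g c" unfolding r_coset_def by blast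
qed

end

end

definition generic_element :: "('a, 'b) monoid_scheme \<Rightarrow> 'a set \<Rightarrow> 'a set \<Rightarrow> 'a \<Rightarrow> bool" where
  "generic_element G H A f \<longleftrightarrow> f \<in> A \<and> (\<forall>r\<in>H. inv\<^bsub>G\<^esub> f \<otimes>\<^bsub>G\<^esub> r \<otimes>\<^bsub>G\<^esub> f \<in> H \<longrightarrow> r \<in> A)"

lemma generic_elementD:
  assumes "generic_element G H A f"
  shows "f \<in> A" "r \<in> H \<Longrightarrow> inv\<^bsub>G\<^esub> f \<otimes>\<^bsub>G\<^esub> r \<otimes>\<^bsub>G\<^esub> f \<in> H \<Longrightarrow> r \<in> A"
  using assms by (simp_all add: generic_element_def)
locale generic_invariant_vNa = invariant_vNa +
  fixes A :: "'a set"
  assumes A_normal: "A \<lhd> G"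
    and A_comm: "f \<in> A \<Longrightarrow> f' \<in> A \<Longrightarrow> f \<otimes> f' = f' \<otimes> f"
    and A_generic: "\<exists>f. generic_element G (stage n) A f"
begin

lemma A_subgroup: "subgroup A G"
  using A_normal normal_imp_subgroup by blast

lemma A_carrier: "f \<in> A \<Longrightarrow> f \<in> carrier G"
  by (rule subgroup.mem_carrier[OF A_subgroup])

lemma A_conj: "x \<in> carrier G \<Longrightarrow> f \<in> A \<Longrightarrow> x \<otimes> f \<otimes> inv x \<in> A"
  using A_normal normal_inv_iff by blast

lemma A_conj_inv: "x \<in> carrier G \<Longrightarrow> f \<in> A \<Longrightarrow> inv x \<otimes> f \<otimes> x \<in> A"
  using A_conj[of "inv x" f] by simp

lemma generic_translate_eq_cutoff:
  assumes a_supp_stage: "supp a \<subseteq> stage n" and k0_stage: "k0 \<in> stage n" and k_supp: "k \<in> supp a"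
    and generic: "generic_element G (stage n) A f"
  shows "a (inv f \<otimes> (k \<otimes> inv k0) \<otimes> f \<otimes> k0) = cutoff (A #> k0) a k"
proof -
  note f = generic_elementD[OF generic]
  have k_stage: "k \<in> stage n" using a_supp_stage k_supp by blast
  have carrier: "k0 \<in> carrier G" "k \<in> carrier G" using k0_stage k_stage stage_carrier by blast+
  define r where "r = k \<otimes> inv k0"
  have r_stage: "r \<in> stage n" unfolding r_def by (intro stage_mult stage_inv k_stage k0_stage)
  then have [simp]: "r \<in> carrier G" "k0 \<in> carrier G" "f \<in> carrier G"
    using stage_carrier carrier A_carrier[OF f(1)] by blast+
  have coset: "k \<in> A #> k0 \<longleftrightarrow> r \<in> A"
    unfolding r_def using carrier by (intro subgroup.rcos_module[OF A_subgroup is_group])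
  have "a (inv f \<otimes> r \<otimes> f \<otimes> k0) = cutoff (A #> k0) a k"
  proof (cases "r \<in> A")
    case True
    have "inv f \<otimes> r \<otimes> f = inv f \<otimes> (r \<otimes> f)" by (simp add: m_assoc)
    also have "\<dots> = r" unfolding A_comm[OF True f(1)] by (simp flip: m_assoc)
    finally have "inv f \<otimes> r \<otimes> f \<otimes> k0 = k" using carrier by (simp add: r_def m_assoc)
    then show ?thesis using True coset by (simp add: cutoff_def)
  next
    case False
    have "inv f \<otimes> r \<otimes> f \<otimes> k0 \<notin> supp a"
    proof
      assume "inv f \<otimes> r \<otimes> f \<otimes> k0 \<in> supp a"
      then have "inv f \<otimes> r \<otimes> f \<otimes> k0 \<otimes> inv k0 \<in> stage n"
        using a_supp_stage stage_mult[OF _ stage_inv[OF k0_stage]] by blast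
      then have "inv f \<otimes> r \<otimes> f \<in> stage n" by (simp add: m_assoc)
      then show False using f(2)[OF r_stage] False by blast
    qed
    then show ?thesis using False coset by (simp add: cutoff_def supp_def)
  qed
  then show ?thesis by (simp add: r_def)
qed

text \<open>
  The coefficient is the sum of \<open>cnj (a k) * a r\<close> over \<open>k\<close>, where \<open>r = inv f (k (inv k0)) f k0\<close>. As \<open>f\<close> is
  generic, \<open>r = k\<close> for \<open>k \<in> A #> k0\<close>, and \<open>r\<close> lies outside \<open>stage n\<close> otherwise.
\<close>

lemma star_conv_generic_coeff:
  assumes a_l2: "a \<in> l2 G" and a_supp_stage: "supp a \<subseteq> stage n" and k0_stage: "k0 \<in> stage n"
    and generic: "generic_element G (stage n) A f"
  shows "star_conv G a (conjugate G f a) (commutator G k0 f)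
    = complex_of_real ((norm_l2 G (cutoff (A #> k0) a))\<^sup>2)"
proof -
  let ?h = "commutator G k0 f"
  have [simp]: "k0 \<in> carrier G" "f \<in> carrier G"
    using k0_stage stage_carrier A_carrier[OF generic_elementD(1)[OF generic]] by blast+
  then have [simp]: "?h \<in> carrier G" by (rule commutator_closed)
  have "rreg G ?h (conjugate G f a) k = cutoff (A #> k0) a k" if "k \<in> carrier G" "k \<in> supp a" for k
  proof -
    have "inv f \<otimes> (k \<otimes> ?h) \<otimes> f = inv f \<otimes> (k \<otimes> inv k0) \<otimes> f \<otimes> k0"
      using that(1) by (simp add: commutator_def m_assoc)
    then have "rreg G ?h (conjugate G f a) k = a (inv f \<otimes> (k \<otimes> inv k0) \<otimes> f \<otimes> k0)"
      using that(1) by (simp add: rreg_apply conjugate_apply l2_conjugate a_l2)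
    then show ?thesis
      using generic_translate_eq_cutoff[OF a_supp_stage k0_stage that(2) generic] by simp
  qed
  then have "inner_l2 G a (rreg G ?h (conjugate G f a)) = inner_l2 G a (cutoff (A #> k0) a)"
    by (rule inner_cong_supp)
  then show ?thesis using inner_cutoff_self[OF a_l2] by (simp add: star_conv_def)
qed

lemma nontrivial_cond_exp_in_A:
  assumes a_fin: "a \<in> fin_coeffs" and k0_supp: "k0 \<in> supp a" and k0_nontrivial: "k0 \<noteq> \<one>"
  shows "\<exists>f\<in>A. f \<noteq> \<one> \<and> cond_exp f f \<noteq> 0"
proof (cases "k0 \<in> A")
  case True
  then show ?thesis using k0_nontrivial cond_exp_self_nonzero[OF a_fin k0_supp] by blast
next
  case False
  obtain n where a_supp_stage: "supp a \<subseteq> stage n"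
    using finite_subset_stage[OF fin_coeffs_finite[OF a_fin] l2_supp[OF fin_coeffs_l2[OF a_fin]]] .
  then have k0_stage: "k0 \<in> stage n" using k0_supp by blast
  obtain f where generic: "generic_element G (stage n) A f" using A_generic[of n] by blast
  note f = generic_elementD[OF generic]
  have carrier: "k0 \<in> carrier G" "f \<in> carrier G"
    using fin_coeffs_supp_carrier[OF a_fin k0_supp] A_carrier[OF f(1)] by auto
  let ?h = "commutator G k0 f"
  have "?h \<in> A"
    using A_conj_inv[OF carrier(1) f(1)] f(1) A_subgroup
    by (simp add: commutator_def subgroup.m_closed subgroup.m_inv_closed)
  moreover have "?h \<noteq> \<one>"
    using commutator_eq_one[OF carrier] f(2)[OF k0_stage] k0_stage False by auto
  moreover have "?h \<in> supp (star_conv G a (conjugate G f a))"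
  proof -
    have "k0 \<in> A #> k0" using rcos_self[OF carrier(1) A_subgroup] .
    then have "cutoff (A #> k0) a k0 \<noteq> 0" using k0_supp by (simp add: cutoff_def supp_def)
    then have "norm_l2 G (cutoff (A #> k0) a) \<noteq> 0"
      using norm_l2_eq_0[OF l2_cutoff[OF fin_coeffs_l2[OF a_fin]]] by metis
    then show ?thesis
      using star_conv_generic_coeff[OF fin_coeffs_l2[OF a_fin] a_supp_stage k0_stage generic]
      by (simp add: supp_def)
  qed
  then have "cond_exp ?h ?h \<noteq> 0"
    by (rule cond_exp_self_nonzero[OF fin_coeffs_star_conv[OF a_fin
      fin_coeffs_conjugate[OF a_fin carrier(2)]]])
  ultimately show ?thesis by blast
qed

lemma cond_exp_supp_coset:
  assumes A_group_part: "A \<subseteq> group_part" and g_stage: "g \<in> stage n"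
  shows "supp (cond_exp g) \<subseteq> (A \<inter> stage n) #> g"
proof
  fix k assume k_supp: "k \<in> supp (cond_exp g)"
  have k_stage: "k \<in> stage n" using cond_exp_supp_stage[OF g_stage] k_supp by blast
  have [simp]: "g \<in> carrier G" "k \<in> carrier G" using g_stage k_stage stage_carrier by blast+
  obtain f where "generic_element G (stage n) A f" using A_generic[of n] by blast
  note f = generic_elementD[OF this]
  note [simp] = A_carrier[OF f(1)]
  define f' where "f' = g \<otimes> inv f \<otimes> inv g"
  have "inv f \<in> A" using subgroup.m_inv_closed[OF A_subgroup f(1)] .
  then have f'_in_A: "f' \<in> A" unfolding f'_def by (rule A_conj[rotated]) simp
  note [simp] = A_carrier[OF f'_in_A]
  have "inv f \<in> group_part" "f' \<in> group_part" using A_group_part \<open>inv f \<in> A\<close> f'_in_A by blast+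
  then have "lreg G f' (cond_exp g) = rreg G f (cond_exp g)"
    using cond_exp_left_mult[of g f'] cond_exp_right_mult[of g "inv f"]
    by (simp add: f'_def m_assoc)
  from fun_cong[OF this, of "f' \<otimes> k"]
  have "cond_exp g (inv f' \<otimes> (f' \<otimes> k)) = cond_exp g (f' \<otimes> k \<otimes> f)"
    using cond_exp_l2[of g] by (simp add: lreg_apply rreg_apply)
  moreover have "inv f' \<otimes> (f' \<otimes> k) = k" by (simp flip: m_assoc)
  ultimately have "cond_exp g (f' \<otimes> k \<otimes> f) = cond_exp g k" by simp
  then have "f' \<otimes> k \<otimes> f \<in> stage n"
    using cond_exp_supp_stage[OF g_stage] k_supp by (auto simp: supp_def)
  then have "inv g \<otimes> (f' \<otimes> k \<otimes> f) \<in> stage n" by (rule stage_mult[OF stage_inv[OF g_stage]])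
  moreover have "inv g \<otimes> (f' \<otimes> k \<otimes> f) = inv f \<otimes> (inv g \<otimes> k) \<otimes> f"
    unfolding f'_def by (simp add: m_assoc) (simp flip: m_assoc)
  moreover have "inv g \<otimes> k \<in> stage n" using g_stage k_stage by (intro stage_mult stage_inv)
  ultimately have "inv g \<otimes> k \<in> A" using f(2) by simp
  then have "g \<otimes> (inv g \<otimes> k) \<otimes> inv g \<in> A" by (rule A_conj[rotated]) simp
  then have "k \<otimes> inv g \<in> A \<inter> stage n"
    using g_stage k_stage by (auto intro: stage_mult stage_inv simp flip: m_assoc)
  moreover have "k = k \<otimes> inv g \<otimes> g" by (simp add: m_assoc)
  ultimately show "k \<in> (A \<inter> stage n) #> g" unfolding r_coset_def by blast
qed

text \<open>
  For \<open>p = E g\<close> and \<open>\<rho>\<close> the commutator, the element \<open>z = p* c p (inv c)\<close> of \<open>M\<close> is supported in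
  \<open>(A \<inter> stage n) #> \<rho>\<close>, where \<open>E \<rho>\<close> vanishes except at \<open>\<rho>\<close>. As \<open>\<langle>z, E \<rho>\<rangle>\<close> and \<open>\<langle>z, \<rho>\<rangle>\<close> agree and
  \<open>z \<rho> \<noteq> 0\<close>, this forces \<open>E \<rho> \<rho> = 1\<close>.
\<close>

lemma commutator_in_group_part:
  assumes A_group_part: "A \<subseteq> group_part" and g_stage: "g \<in> stage n" and nonzero: "cond_exp g g \<noteq> 0"
    and c_carrier: "c \<in> carrier G"
    and comm: "\<And>f. f \<in> A \<Longrightarrow> f \<in> stage n \<Longrightarrow> c \<otimes> f = f \<otimes> c"
  defines "\<rho> \<equiv> commutator G g c"
  assumes indep: "\<And>f. f \<in> A \<Longrightarrow> f \<in> stage n \<Longrightarrow> f \<noteq> \<one> \<Longrightarrow> cond_exp \<rho> (f \<otimes> \<rho>) = 0"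
  shows "\<rho> \<in> group_part"
proof -
  have [simp]: "g \<in> carrier G" "c \<in> carrier G" using g_stage stage_carrier c_carrier by auto
  have \<rho>_carrier[simp]: "\<rho> \<in> carrier G" by (simp add: \<rho>_def commutator_closed)
  define z where "z = star_conv G (cond_exp g) (conjugate G c (cond_exp g))"
  have z_fin: "z \<in> fin_coeffs"
    unfolding z_def
    by (intro fin_coeffs_star_conv fin_coeffs_conjugate cond_exp_fin_coeffs) simp_all
  have "inv g \<otimes> f \<otimes> g \<in> A \<inter> stage n" if "f \<in> A \<inter> stage n" for f
    using that g_stage A_conj_inv by (auto intro: stage_mult stage_inv)
  note coset = subgroups_Inter_pair[OF A_subgroup stage_subgroup] this _ _ c_carrier
    cond_exp_l2 cond_exp_supp_coset[OF A_group_part g_stage]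
  have z_\<rho>: "z \<rho> = cond_exp g g"
    unfolding z_def \<rho>_def
    by (subst star_conv_conjugate_commutator[OF coset]) (auto simp: comm cond_exp_self)
  have z_supp: "supp z \<subseteq> (A \<inter> stage n) #> \<rho>"
    unfolding z_def \<rho>_def by (rule supp_star_conv_conjugate[OF coset]) (auto simp: comm)
  have "cond_exp \<rho> k = cutoff {\<rho>} (cond_exp \<rho>) k" if k_supp: "k \<in> supp z" for k
  proof (cases "k = \<rho>")
    case False
    obtain f where f_in_A: "f \<in> A" and f_stage: "f \<in> stage n" and k_eq: "k = f \<otimes> \<rho>"
      using z_supp k_supp by (auto simp: r_coset_def)
    then have "f \<noteq> \<one>" using False by auto
    then show ?thesis using indep[OF f_in_A f_stage] k_eq False by (simp add: cutoff_def)
  qed (simp add: cutoff_def)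
  then have "inner_l2 G z (cond_exp \<rho>) = inner_l2 G (cutoff {\<rho>} z) (cond_exp \<rho>)"
    unfolding inner_cutoff_left by (rule inner_cong_supp)
  then have "cnj (z \<rho>) = cnj (z \<rho>) * cond_exp \<rho> \<rho>"
    using inner_cond_exp[OF \<rho>_carrier z_fin] by (simp add: inner_cutoff_finite)
  then have "cond_exp \<rho> \<rho> = 1" using nonzero z_\<rho> by simp
  then show ?thesis by (rule group_part_if_cond_exp_self_eq_1[OF \<rho>_carrier])
qed

end

subsection \<open>Coordinates on the Cantor space\<close>

definition agree_on :: "nat set \<Rightarrow> cantor \<Rightarrow> cantor \<Rightarrow> bool" where
  "agree_on J x y \<longleftrightarrow> (\<forall>k\<in>J. x k = y k)"

definition determined_by :: "nat set \<Rightarrow> cantor set \<Rightarrow> bool" where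
  "determined_by J A \<longleftrightarrow> (\<forall>x y. agree_on J x y \<longrightarrow> (x \<in> A \<longleftrightarrow> y \<in> A))"

definition acts_within :: "nat set \<Rightarrow> (cantor \<Rightarrow> cantor) \<Rightarrow> bool" where
  "acts_within J \<sigma> \<longleftrightarrow> bij \<sigma> \<and> (\<forall>x. \<forall>k. k \<notin> J \<longrightarrow> \<sigma> x k = x k) \<and>
    (\<forall>x y. agree_on J x y \<longrightarrow> agree_on J (\<sigma> x) (\<sigma> y))"

lemma agree_on_mono: "J \<subseteq> J' \<Longrightarrow> agree_on J' x y \<Longrightarrow> agree_on J x y"
  by (auto simp: agree_on_def)

lemma trunc_eq_iff: "trunc n x = trunc n y \<longleftrightarrow> agree_on {..<n} x y"
  by (auto simp: trunc_def agree_on_def fun_eq_iff)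

lemma trunc_trunc: "n \<le> m \<Longrightarrow> trunc n (trunc m x) = trunc n x"
  by (auto simp: trunc_def)

lemma trunc_eq_mono: "trunc m x = trunc m y \<Longrightarrow> n \<le> m \<Longrightarrow> trunc n x = trunc n y"
  by (metis trunc_trunc)

lemma trunc_in_cube: "trunc n x \<in> cube n"
  by (simp add: trunc_def cube_def)

lemma trunc_cube: "v \<in> cube n \<Longrightarrow> trunc n v = v"
  by (auto simp: trunc_def cube_def fun_eq_iff not_le[symmetric])

lemma determined_byD: "determined_by J A \<Longrightarrow> agree_on J x y \<Longrightarrow> x \<in> A \<longleftrightarrow> y \<in> A"
  by (simp add: determined_by_def)

lemma determined_by_trunc: "determined_by {..<n} A \<Longrightarrow> trunc n x = trunc n y \<Longrightarrow> x \<in> A \<longleftrightarrow> y \<in> A"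
  by (simp add: trunc_eq_iff determined_byD)

lemma determined_by_mono: "determined_by J A \<Longrightarrow> J \<subseteq> J' \<Longrightarrow> determined_by J' A"
  unfolding determined_by_def using agree_on_mono by blast

lemma determined_by_Compl: "determined_by J (- A) \<longleftrightarrow> determined_by J A"
  by (auto simp: determined_by_def)

lemma determined_by_empty: "determined_by J {}"
  by (simp add: determined_by_def)

lemma determined_by_Un: "determined_by J A \<Longrightarrow> determined_by J B \<Longrightarrow> determined_by J (A \<union> B)"
  unfolding determined_by_def by blast

lemma determined_by_sym_diff: "determined_by J A \<Longrightarrow> determined_by J B \<Longrightarrow>
    determined_by J (sym_diff A B)"
  unfolding determined_by_def by blast

lemma determined_by_no_coords: "determined_by {} A \<Longrightarrow> A = {} \<or> A = UNIV"
  by (auto simp: determined_by_def agree_on_def)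

lemma acts_withinD:
  assumes "acts_within J \<sigma>"
  shows "bij \<sigma>" "k \<notin> J \<Longrightarrow> \<sigma> x k = x k" "agree_on J x y \<Longrightarrow> agree_on J (\<sigma> x) (\<sigma> y)"
  using assms by (auto simp: acts_within_def)

lemma acts_withinI:
  assumes "bij \<sigma>" "\<And>x k. k \<notin> J \<Longrightarrow> \<sigma> x k = x k" "\<And>x y. agree_on J x y \<Longrightarrow> agree_on J (\<sigma> x) (\<sigma> y)"
  shows "acts_within J \<sigma>"
  using assms by (auto simp: acts_within_def)

lemma acts_within_id: "acts_within J id"
  by (simp add: acts_within_def)

lemma acts_within_no_coords: "acts_within {} \<sigma> \<Longrightarrow> \<sigma> = id"
  by (intro ext) (use acts_withinD(2) in auto)

lemma acts_within_comp: "acts_within J \<sigma> \<Longrightarrow> acts_within J \<tau> \<Longrightarrow> acts_within J (\<sigma> \<circ> \<tau>)"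
  by (auto simp: acts_within_def bij_comp)

lemma acts_within_mono:
  assumes "acts_within J \<sigma>" "J \<subseteq> J'"
  shows "acts_within J' \<sigma>"
proof (rule acts_withinI)
  fix x y assume xy_agree: "agree_on J' x y"
  then have "agree_on J (\<sigma> x) (\<sigma> y)"
    using acts_withinD(3)[OF assms(1)] agree_on_mono[OF assms(2)] by blast
  then show "agree_on J' (\<sigma> x) (\<sigma> y)"
    using xy_agree acts_withinD(2)[OF assms(1)] unfolding agree_on_def by metis
qed (use assms(2) acts_withinD(1,2)[OF assms(1)] in blast)+

lemma acts_within_inv:
  assumes \<sigma>_acts: "acts_within J \<sigma>"
  shows "acts_within J (inv_into UNIV \<sigma>)"
proof (rule acts_withinI)
  let ?i = "inv_into UNIV \<sigma>"
  have bij: "bij \<sigma>" using acts_withinD(1)[OF \<sigma>_acts] .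
  have \<sigma>_i: "\<sigma> (?i x) = x" for x using bij by (simp add: bij_is_surj surj_f_inv_f)
  show "bij ?i" using bij by (rule bij_imp_bij_inv)
  show "?i x k = x k" if "k \<notin> J" for x k
    using acts_withinD(2)[OF \<sigma>_acts that, of "?i x"] \<sigma>_i by simp
  fix x y assume xy_agree: "agree_on J x y"
  define z where "z = (\<lambda>k. if k \<in> J then ?i x k else ?i y k)"
  have "agree_on J z (?i x)" by (simp add: agree_on_def z_def)
  then have z_x: "agree_on J (\<sigma> z) x" using acts_withinD(3)[OF \<sigma>_acts] \<sigma>_i by metis
  have "\<sigma> z k = \<sigma> (?i y) k" for k
  proof (cases "k \<in> J")
    case True then show ?thesis using z_x xy_agree \<sigma>_i by (simp add: agree_on_def)
  next
    case False then show ?thesis using acts_withinD(2)[OF \<sigma>_acts False] by (simp add: z_def)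
  qed
  then have "\<sigma> z = \<sigma> (?i y)" by (rule ext)
  then have "z = ?i y" by (rule injD[OF bij_is_inj[OF bij]])
  moreover have "agree_on J (?i x) z" by (simp add: agree_on_def z_def)
  ultimately show "agree_on J (?i x) (?i y)" by simp
qed

lemma acts_within_trunc_iff:
  assumes "acts_within {..<n} \<sigma>"
  shows "trunc n (\<sigma> x) = trunc n (\<sigma> y) \<longleftrightarrow> trunc n x = trunc n y"
proof
  assume "trunc n (\<sigma> x) = trunc n (\<sigma> y)"
  then have "trunc n (inv_into UNIV \<sigma> (\<sigma> x)) = trunc n (inv_into UNIV \<sigma> (\<sigma> y))"
    using acts_withinD(3)[OF acts_within_inv[OF assms]] by (simp add: trunc_eq_iff)
  then show "trunc n x = trunc n y" using acts_withinD(1)[OF assms] by (simp add: bij_is_inj)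
qed (use acts_withinD(3)[OF assms] in \<open>simp add: trunc_eq_iff\<close>)

lemma acts_within_fixed_iff:
  assumes "acts_within {..<n} \<sigma>"
  shows "trunc n (\<sigma> x) = trunc n x \<longleftrightarrow> \<sigma> x = x"
proof
  assume "trunc n (\<sigma> x) = trunc n x"
  then have "\<sigma> x k = x k" for k
    using acts_withinD(2)[OF assms, of k] by (cases "k < n") (auto simp: trunc_eq_iff agree_on_def)
  then show "\<sigma> x = x" by (rule ext)
qed simp

lemma mem_image_bij: "bij f \<Longrightarrow> x \<in> f ` A \<longleftrightarrow> inv_into UNIV f x \<in> A"
  using bij_vimage_eq_inv_image[OF bij_imp_bij_inv, of f A] by (auto simp: inv_inv_eq)

lemma determined_by_image:
  assumes "determined_by J A" "acts_within J \<sigma>"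
  shows "determined_by J (\<sigma> ` A)"
  unfolding determined_by_def mem_image_bij[OF acts_withinD(1)[OF assms(2)]]
  using determined_byD[OF assms(1)] acts_withinD(3)[OF acts_within_inv[OF assms(2)]] by blast

lemma agree_on_Int_split:
  assumes "agree_on (J \<inter> J') x y"
  obtains z where "agree_on J x z" "agree_on J' z y"
proof
  show "agree_on J x (\<lambda>k. if k \<in> J then x k else y k)" by (simp add: agree_on_def)
  show "agree_on J' (\<lambda>k. if k \<in> J then x k else y k) y" using assms by (simp add: agree_on_def)
qed

lemma determined_by_Int:
  assumes "determined_by J A" "determined_by J' A"
  shows "determined_by (J \<inter> J') A"
  unfolding determined_by_def using assms determined_byD agree_on_Int_split by metis

lemma acts_within_Int:
  assumes "acts_within J \<sigma>" "acts_within J' \<sigma>"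
  shows "acts_within (J \<inter> J') \<sigma>"
proof (rule acts_withinI)
  show "\<sigma> x k = x k" if "k \<notin> J \<inter> J'" for x k
    using that acts_withinD(2)[OF assms(1)] acts_withinD(2)[OF assms(2)] by blast
  fix x y assume "agree_on (J \<inter> J') x y"
  then obtain z where "agree_on J x z" "agree_on J' z y" by (rule agree_on_Int_split)
  then have "agree_on J (\<sigma> x) (\<sigma> z)" "agree_on J' (\<sigma> z) (\<sigma> y)" using assms acts_withinD(3) by blast+
  then show "agree_on (J \<inter> J') (\<sigma> x) (\<sigma> y)" by (simp add: agree_on_def)
qed (use acts_withinD(1)[OF assms(1)] in blast)

lemma finite_cube: "finite (cube n)"
proof (rule finite_subset)
  show "cube n \<subseteq> (\<lambda>S k. k \<in> S) ` Pow {..<n}"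
  proof
    fix v assume "v \<in> cube n"
    then have "v = (\<lambda>k. k \<in> {k. v k})" "{k. v k} \<in> Pow {..<n}"
      by (auto simp: cube_def not_le[symmetric])
    then show "v \<in> (\<lambda>S k. k \<in> S) ` Pow {..<n}" by (rule image_eqI)
  qed
qed simp

lemma trunc_lift_perm:
  assumes "p permutes cube n"
  shows "trunc n (lift_perm n p x) = p (trunc n x)"
proof -
  have "trunc n (lift_perm n p x) = trunc n (p (trunc n x))" by (auto simp: lift_perm_def trunc_def)
  then show ?thesis using assms by (simp add: trunc_cube trunc_in_cube permutes_in_image)
qed

lemma lift_perm_comp:
  assumes "p permutes cube n"
  shows "lift_perm n q \<circ> lift_perm n p = lift_perm n (q \<circ> p)"
proof (intro ext)
  fix x k show "(lift_perm n q \<circ> lift_perm n p) x k = lift_perm n (q \<circ> p) x k"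
    unfolding o_apply lift_perm_def[of n q] lift_perm_def[of n "\<lambda>x. q (p x)"]
      trunc_lift_perm[OF assms]
    by (simp add: lift_perm_def)
qed

lemma lift_perm_id: "lift_perm n id = id"
  by (auto simp: lift_perm_def trunc_def fun_eq_iff)

lemma acts_within_lift_perm:
  assumes p_permutes: "p permutes cube n"
  shows "acts_within {..<n} (lift_perm n p)"
proof (rule acts_withinI)
  show "bij (lift_perm n p)"
    using lift_perm_comp[OF p_permutes] lift_perm_comp[OF permutes_inv[OF p_permutes]]
      permutes_inv_o[OF p_permutes]
    by (intro o_bij[of "lift_perm n (inv_into UNIV p)"]) (simp_all add: lift_perm_id)
  show "lift_perm n p x k = x k" if "k \<notin> {..<n}" for x k using that by (simp add: lift_perm_def)
  show "agree_on {..<n} (lift_perm n p x) (lift_perm n p y)" if "agree_on {..<n} x y" for x y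
    using that by (simp add: trunc_lift_perm[OF p_permutes] flip: trunc_eq_iff)
qed

lemma acts_within_imp_lift_perm:
  assumes \<sigma>_acts: "acts_within {..<n} \<sigma>"
  obtains p where "p permutes cube n" "\<sigma> = lift_perm n p"
proof -
  define p where "p = (\<lambda>v. if v \<in> cube n then \<sigma> v else v)"
  have into: "\<sigma> v \<in> cube n" if "v \<in> cube n" for v
    using that acts_withinD(2)[OF \<sigma>_acts] by (auto simp: cube_def)
  have "inj_on \<sigma> (cube n)"
    using acts_withinD(1)[OF \<sigma>_acts] by (meson bij_is_inj inj_on_subset subset_UNIV)
  then have "bij_betw \<sigma> (cube n) (cube n)"
    unfolding bij_betw_def using into endo_inj_surj[OF finite_cube, of \<sigma> n] by blast
  then have "bij_betw p (cube n) (cube n)" by (subst bij_betw_cong[of _ p \<sigma>]) (auto simp: p_def)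
  then have p_permutes: "p permutes cube n" by (rule bij_imp_permutes) (simp add: p_def)
  have "\<sigma> x k = lift_perm n p x k" for x k
  proof (cases "k < n")
    case True
    have "trunc n (\<sigma> x) = trunc n (\<sigma> (trunc n x))"
      by (simp add: acts_within_trunc_iff[OF \<sigma>_acts] trunc_trunc)
    then show ?thesis
      using True by (simp add: lift_perm_def p_def trunc_in_cube trunc_eq_iff agree_on_def)
  next
    case False
    then show ?thesis using acts_withinD(2)[OF \<sigma>_acts, of k x] by (simp add: lift_perm_def)
  qed
  then show ?thesis using that p_permutes by blast
qed

lemma S2inf_iff: "\<sigma> \<in> S2inf \<longleftrightarrow> (\<exists>n. acts_within {..<n} \<sigma>)"
proof
  assume "\<exists>n. acts_within {..<n} \<sigma>"
  then obtain n p where "p permutes cube n" "\<sigma> = lift_perm n p" by (metis acts_within_imp_lift_perm)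
  then show "\<sigma> \<in> S2inf" unfolding S2inf_def by auto
qed (auto simp: S2inf_def intro: acts_within_lift_perm)

lemma acts_within_S2inf: "acts_within {..<n} \<sigma> \<Longrightarrow> \<sigma> \<in> S2inf"
  using S2inf_iff by blast

lemma S2inf_bij: "\<sigma> \<in> S2inf \<Longrightarrow> bij \<sigma>"
  using S2inf_iff acts_withinD(1) by blast

lemma S2inf_id: "id \<in> S2inf"
  using acts_within_S2inf[OF acts_within_id[of "{..<0}"]] .

lemma S2inf_comp:
  assumes "\<sigma> \<in> S2inf" "\<tau> \<in> S2inf"
  shows "\<sigma> \<circ> \<tau> \<in> S2inf"
proof -
  obtain n m where "acts_within {..<n} \<sigma>" "acts_within {..<m} \<tau>" using assms S2inf_iff by blast
  then have "acts_within {..<max n m} \<sigma>" "acts_within {..<max n m} \<tau>"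
    by (auto elim!: acts_within_mono)
  then show ?thesis using acts_within_comp acts_within_S2inf by blast
qed

lemma S2inf_inv: "\<sigma> \<in> S2inf \<Longrightarrow> inv_into UNIV \<sigma> \<in> S2inf"
  using S2inf_iff acts_within_inv by blast

lemma finite_acts_within: "finite {\<sigma>. acts_within {..<n} \<sigma>}"
proof (rule finite_subset)
  show "{\<sigma>. acts_within {..<n} \<sigma>} \<subseteq> lift_perm n ` {p. p permutes cube n}"
    using acts_within_imp_lift_perm by blast
qed (intro finite_imageI finite_permutations finite_cube)

lemma finite_determined_by: "finite {A. determined_by {..<n} A}"
proof (rule finite_subset)
  show "{A. determined_by {..<n} A} \<subseteq> (\<lambda>Q. {x. trunc n x \<in> Q}) ` Pow (cube n)"
  proof
    fix A assume "A \<in> {A. determined_by {..<n} A}"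
    then have "x \<in> A \<longleftrightarrow> trunc n x \<in> A" for x
      by (simp add: determined_by_trunc[of n A x "trunc n x"] trunc_trunc)
    then have "A = {x. trunc n x \<in> A \<inter> cube n}" using trunc_in_cube by blast
    then show "A \<in> (\<lambda>Q. {x. trunc n x \<in> Q}) ` Pow (cube n)"
      by (intro image_eqI[of _ _ "A \<inter> cube n"]) auto
  qed
qed (simp add: finite_cube)

definition cyl :: "nat \<Rightarrow> cantor \<Rightarrow> cantor set" where
  "cyl n x = {y. trunc n y = trunc n x}"

lemma cyl_self: "x \<in> cyl n x"
  by (simp add: cyl_def)

lemma cyl_cong: "trunc n x = trunc n y \<Longrightarrow> cyl n x = cyl n y"
  by (simp add: cyl_def)

lemma open_cyl: "open (cyl n x)"
proof -
  have "cyl n x = {f. \<forall>k\<in>{..<n}. f k \<in> {x k}}" by (auto simp: cyl_def trunc_eq_iff agree_on_def)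
  moreover have "open {f. \<forall>k\<in>{..<n}. f (id k) \<in> {x k}}"
    by (rule product_topology_basis') (auto intro: open_discrete)
  ultimately show ?thesis by simp
qed

lemma open_contains_cyl:
  assumes "open U" "x \<in> U"
  shows "\<exists>n. cyl n x \<subseteq> U"
proof -
  have "openin (product_topology (\<lambda>_. euclidean) UNIV) U"
    using assms(1) by (simp add: open_fun_def)
  from product_topology_open_contains_basis[OF this assms(2)]
  obtain V :: "nat \<Rightarrow> bool set"
    where x_in_box: "x \<in> Pi\<^sub>E UNIV V" and V_finite: "finite {i. V i \<noteq> UNIV}"
      and box_in_U: "Pi\<^sub>E UNIV V \<subseteq> U"
    by (auto simp: topspace_euclidean)
  obtain n where n_bound: "\<And>i. V i \<noteq> UNIV \<Longrightarrow> i < n"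
    using V_finite unfolding finite_nat_set_iff_bounded by blast
  have "y i \<in> V i" if "y \<in> cyl n x" for y i
  proof (cases "V i = UNIV")
    case False
    then have "y i = x i" using n_bound that by (auto simp: cyl_def trunc_eq_iff agree_on_def)
    then show ?thesis using PiE_mem[OF x_in_box, of i] by simp
  qed simp
  then have "cyl n x \<subseteq> Pi\<^sub>E UNIV V" by (auto simp: PiE_iff)
  then show ?thesis using box_in_U by blast
qed

lemma compact_cantor: "compact (UNIV :: cantor set)"
proof -
  have "compactin (product_topology (\<lambda>_. euclidean) UNIV) (PiE UNIV (\<lambda>_::nat. UNIV :: bool set))"
    by (subst compactin_PiE) (auto intro: finite_imp_compact)
  then show ?thesis by (simp add: euclidean_product_topology PiE_UNIV_domain)
qed

lemma determined_by_imp_clopen: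
  assumes "determined_by {..<n} A"
  shows "clopen A"
proof -
  have "open B" if "determined_by {..<n} B" for B
  proof -
    have "(\<Union>x\<in>B. cyl n x) = B" unfolding cyl_def using determined_by_trunc[OF that] by blast
    then show ?thesis using open_UN[of B "cyl n"] open_cyl by simp
  qed
  then show ?thesis using assms by (simp add: clopen_def closed_def determined_by_Compl)
qed

lemma clopen_imp_determined_by:
  assumes "clopen A"
  obtains n where "determined_by {..<n} A"
proof -
  have "\<exists>n. cyl n x \<subseteq> A \<or> cyl n x \<subseteq> - A" for x
    using assms open_contains_cyl[of A x] open_contains_cyl[of "- A" x]
    by (cases "x \<in> A") (auto simp: clopen_def closed_def)
  then obtain d where d_cyl: "\<And>x. cyl (d x) x \<subseteq> A \<or> cyl (d x) x \<subseteq> - A" by metis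
  have "UNIV \<subseteq> (\<Union>x\<in>UNIV. cyl (d x) x)" using cyl_self by blast
  from compactE_image[OF compact_cantor open_cyl this]
  obtain F where F_finite: "finite F" and F_cover: "UNIV \<subseteq> (\<Union>x\<in>F. cyl (d x) x)" by metis
  define n where "n = Max (d ` F)"
  have "x \<in> A \<longleftrightarrow> y \<in> A" if "trunc n x = trunc n y" for x y
  proof -
    obtain z where z_in_F: "z \<in> F" and x_in_cyl_z: "x \<in> cyl (d z) z" using F_cover by blast
    then have "d z \<le> n" using F_finite by (simp add: n_def)
    then have "y \<in> cyl (d z) z" using trunc_eq_mono[OF that] x_in_cyl_z by (simp add: cyl_def)
    then show ?thesis using d_cyl[of z] x_in_cyl_z by blast
  qed
  then show ?thesis using that[of n] by (simp add: determined_by_def trunc_eq_iff)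
qed

lemma clopen_iff: "clopen A \<longleftrightarrow> (\<exists>n. determined_by {..<n} A)"
  using determined_by_imp_clopen clopen_imp_determined_by by metis

subsection \<open>The group\<close>

text \<open>The class of the indicator function of \<open>A\<close> is represented by the pair \<open>{A, - A}\<close>.\<close>

definition sd_elem :: "cantor set \<Rightarrow> (cantor \<Rightarrow> cantor) \<Rightarrow> cantor set set \<times> (cantor \<Rightarrow> cantor)" where
  "sd_elem A \<sigma> = ({A, - A}, \<sigma>)"

lemma sd_elem_eq_iff: "sd_elem A \<sigma> = sd_elem B \<tau> \<longleftrightarrow> \<sigma> = \<tau> \<and> (A = B \<or> A = - B)"
  by (auto simp: sd_elem_def doubleton_eq_iff)

lemma carrier_Gsd: "carrier Gsd = {sd_elem A \<sigma> | A \<sigma>. clopen A \<and> \<sigma> \<in> S2inf}"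
  by (auto simp: Gsd_def Ctil_def sd_elem_def)

lemma sd_elem_carrier: "clopen A \<Longrightarrow> \<sigma> \<in> S2inf \<Longrightarrow> sd_elem A \<sigma> \<in> carrier Gsd"
  by (auto simp: carrier_Gsd)

lemma Gsd_cases:
  assumes "g \<in> carrier Gsd"
  obtains A \<sigma> where "g = sd_elem A \<sigma>" "clopen A" "\<sigma> \<in> S2inf"
  using assms unfolding carrier_Gsd by blast

lemma cmult_classes: "cmult {A, - A} {C, - C} = {sym_diff A C, - sym_diff A C}"
proof -
  have "cmult c d = (\<Union>A\<in>c. \<Union>B\<in>d. {sym_diff A B})" for c d by (auto simp: cmult_def)
  moreover have "sym_diff A (- C) = - sym_diff A C" "sym_diff (- A) C = - sym_diff A C"
    "sym_diff (- A) (- C) = sym_diff A C"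
    by blast+
  ultimately show ?thesis
    by (simp only: UN_insert UN_empty Un_empty_left Un_empty_right Un_insert_left insert_commute
      insert_absorb2)
qed

lemma sd_elem_mult:
  assumes "bij \<sigma>"
  shows "sd_elem A \<sigma> \<otimes>\<^bsub>Gsd\<^esub> sd_elem B \<tau> = sd_elem (sym_diff A (\<sigma> ` B)) (\<sigma> \<circ> \<tau>)"
proof -
  have "cact \<sigma> {B, - B} = {\<sigma> ` B, - \<sigma> ` B}" by (simp add: cact_def bij_image_Compl_eq[OF assms])
  then show ?thesis using cmult_classes[of A "\<sigma> ` B"] by (simp only: Gsd_def sd_elem_def) simp
qed

lemma sd_elem_one: "\<one>\<^bsub>Gsd\<^esub> = sd_elem {} id"
  by (simp add: Gsd_def sd_elem_def)

lemma image_sym_diff: "bij \<sigma> \<Longrightarrow> \<sigma> ` sym_diff A B = sym_diff (\<sigma> ` A) (\<sigma> ` B)"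
  by (simp add: image_Un image_set_diff bij_is_inj)

lemma clopen_sym_diff: "clopen A \<Longrightarrow> clopen B \<Longrightarrow> clopen (sym_diff A B)"
  by (simp add: clopen_def open_Un closed_Un open_Diff closed_Diff)

lemma clopen_image:
  assumes "clopen A" "\<sigma> \<in> S2inf"
  shows "clopen (\<sigma> ` A)"
proof -
  obtain n m where "determined_by {..<n} A" "acts_within {..<m} \<sigma>"
    using assms clopen_iff S2inf_iff by blast
  then have "determined_by {..<max n m} A" "acts_within {..<max n m} \<sigma>"
    by (auto elim!: determined_by_mono acts_within_mono)
  then show ?thesis using determined_by_image clopen_iff by blast
qed

lemma clopen_empty: "clopen {}"
  by (simp add: clopen_def)

lemma group_Gsd: "group Gsd"
proof (rule groupI)
  fix x y assume "x \<in> carrier Gsd" "y \<in> carrier Gsd"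
  then obtain A \<sigma> B \<tau>
      where "x = sd_elem A \<sigma>" "clopen A" "\<sigma> \<in> S2inf" "y = sd_elem B \<tau>" "clopen B" "\<tau> \<in> S2inf"
    by (metis Gsd_cases)
  then show "x \<otimes>\<^bsub>Gsd\<^esub> y \<in> carrier Gsd"
    by (simp add: sd_elem_mult S2inf_bij sd_elem_carrier clopen_sym_diff clopen_image S2inf_comp)
next
  show "\<one>\<^bsub>Gsd\<^esub> \<in> carrier Gsd" unfolding sd_elem_one by (intro sd_elem_carrier clopen_empty S2inf_id)
next
  fix x y z assume "x \<in> carrier Gsd" "y \<in> carrier Gsd" "z \<in> carrier Gsd"
  then obtain A \<sigma> B \<tau> C \<rho> where xyz_eq: "x = sd_elem A \<sigma>" "y = sd_elem B \<tau>" "z = sd_elem C \<rho>"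
    and bij: "bij \<sigma>" "bij \<tau>"
    by (metis Gsd_cases S2inf_bij)
  have "sym_diff (sym_diff A (\<sigma> ` B)) ((\<sigma> \<circ> \<tau>) ` C) = sym_diff A (sym_diff (\<sigma> ` B) (\<sigma> ` \<tau> ` C))"
    unfolding image_comp by blast
  then show "x \<otimes>\<^bsub>Gsd\<^esub> y \<otimes>\<^bsub>Gsd\<^esub> z = x \<otimes>\<^bsub>Gsd\<^esub> (y \<otimes>\<^bsub>Gsd\<^esub> z)"
    by (simp only: xyz_eq sd_elem_mult bij bij_comp image_sym_diff comp_assoc)
next
  fix x assume "x \<in> carrier Gsd"
  then obtain A \<sigma> where x_eq: "x = sd_elem A \<sigma>" and A_clopen: "clopen A" and \<sigma>_S2inf: "\<sigma> \<in> S2inf"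
    by (rule Gsd_cases)
  then show "\<one>\<^bsub>Gsd\<^esub> \<otimes>\<^bsub>Gsd\<^esub> x = x" unfolding sd_elem_one by (simp add: sd_elem_mult)
  let ?i = "inv_into UNIV \<sigma>"
  have "bij \<sigma>" using \<sigma>_S2inf S2inf_bij by blast
  then have "sd_elem (?i ` A) ?i \<otimes>\<^bsub>Gsd\<^esub> x = \<one>\<^bsub>Gsd\<^esub>"
    unfolding sd_elem_one x_eq by (simp add: sd_elem_mult bij_imp_bij_inv bij_is_inj)
  moreover have "sd_elem (?i ` A) ?i \<in> carrier Gsd"
    using A_clopen \<sigma>_S2inf by (intro sd_elem_carrier clopen_image S2inf_inv)
  ultimately show "\<exists>y\<in>carrier Gsd. y \<otimes>\<^bsub>Gsd\<^esub> x = \<one>\<^bsub>Gsd\<^esub>" by blast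
qed

lemma sd_elem_inv:
  assumes "clopen A" "\<sigma> \<in> S2inf"
  shows "inv\<^bsub>Gsd\<^esub> (sd_elem A \<sigma>) = sd_elem (inv_into UNIV \<sigma> ` A) (inv_into UNIV \<sigma>)"
proof (rule group.inv_equality[OF group_Gsd])
  show "sd_elem (inv_into UNIV \<sigma> ` A) (inv_into UNIV \<sigma>) \<otimes>\<^bsub>Gsd\<^esub> sd_elem A \<sigma> = \<one>\<^bsub>Gsd\<^esub>"
    unfolding sd_elem_one using S2inf_bij[OF assms(2)]
    by (simp add: sd_elem_mult bij_imp_bij_inv bij_is_inj)
qed (use assms in \<open>auto intro!: sd_elem_carrier clopen_image S2inf_inv\<close>)

lemma sd_elem_conj:
  assumes "c \<in> S2inf" "clopen B" "\<tau> \<in> S2inf"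
  shows "sd_elem {} c \<otimes>\<^bsub>Gsd\<^esub> sd_elem B \<tau> \<otimes>\<^bsub>Gsd\<^esub> inv\<^bsub>Gsd\<^esub> (sd_elem {} c)
    = sd_elem (c ` B) (c \<circ> \<tau> \<circ> inv_into UNIV c)"
  using assms by (simp add: sd_elem_inv clopen_empty sd_elem_mult S2inf_bij bij_comp)

lemma inv_involution: "(\<And>x. c (c x) = x) \<Longrightarrow> inv_into UNIV c = c"
  by (rule inv_equality)

lemma mem_image_involution: "(\<And>x. c (c x) = x) \<Longrightarrow> x \<in> c ` A \<longleftrightarrow> c x \<in> A"
  by (metis image_iff)

lemma sd_elem_inv_involution:
  assumes "c \<in> S2inf" "\<And>x. c (c x) = x"
  shows "inv\<^bsub>Gsd\<^esub> (sd_elem {} c) = sd_elem {} c"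
  using inv_involution[of c, OF assms(2)] by (simp add: sd_elem_inv clopen_empty assms(1))

lemma sd_elem_conj_involution:
  assumes "c \<in> S2inf" "\<And>x. c (c x) = x" "clopen B" "\<tau> \<in> S2inf"
  shows "sd_elem {} c \<otimes>\<^bsub>Gsd\<^esub> sd_elem B \<tau> \<otimes>\<^bsub>Gsd\<^esub> inv\<^bsub>Gsd\<^esub> (sd_elem {} c) =
      sd_elem (c ` B) (c \<circ> \<tau> \<circ> c)"
  using sd_elem_conj[OF assms(1,3,4)] by (simp only: inv_involution[OF assms(2)])

definition Gsd_within :: "nat set \<Rightarrow> (cantor set set \<times> (cantor \<Rightarrow> cantor)) set" where
  "Gsd_within J = {sd_elem A \<sigma> | A \<sigma>. determined_by J A \<and> acts_within J \<sigma>}"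

lemma Gsd_within_iff: "sd_elem A \<sigma> \<in> Gsd_within J \<longleftrightarrow> determined_by J A \<and> acts_within J \<sigma>"
  by (auto simp: Gsd_within_def sd_elem_eq_iff determined_by_Compl)

lemma Gsd_within_cases:
  assumes "g \<in> Gsd_within J"
  obtains A \<sigma> where "g = sd_elem A \<sigma>" "determined_by J A" "acts_within J \<sigma>"
  using assms unfolding Gsd_within_def by blast

lemma Gsd_within_mono: "J \<subseteq> J' \<Longrightarrow> Gsd_within J \<subseteq> Gsd_within J'"
  unfolding Gsd_within_def using determined_by_mono acts_within_mono by blast

lemma Gsd_within_Int: "Gsd_within J \<inter> Gsd_within J' \<subseteq> Gsd_within (J \<inter> J')"
  by (auto elim!: Gsd_within_cases simp: Gsd_within_iff determined_by_Int acts_within_Int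
    sd_elem_eq_iff determined_by_Compl)

lemma Gsd_within_carrier: "Gsd_within {..<n} \<subseteq> carrier Gsd"
  unfolding Gsd_within_def carrier_Gsd using clopen_iff S2inf_iff by blast

lemma Gsd_within_empty: "Gsd_within {} = {\<one>\<^bsub>Gsd\<^esub>}"
proof
  show "Gsd_within {} \<subseteq> {\<one>\<^bsub>Gsd\<^esub>}"
  proof
    fix g assume "g \<in> Gsd_within {}"
    then obtain A \<sigma> where g_eq: "g = sd_elem A \<sigma>" and A_determined: "determined_by {} A"
        and \<sigma>_acts: "acts_within {} \<sigma>" by (rule Gsd_within_cases)
    then have "A = {} \<or> A = UNIV" "\<sigma> = id"
      using determined_by_no_coords acts_within_no_coords by auto
    then show "g \<in> {\<one>\<^bsub>Gsd\<^esub>}" unfolding sd_elem_one g_eq by (auto simp: sd_elem_eq_iff)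
  qed
  show "{\<one>\<^bsub>Gsd\<^esub>} \<subseteq> Gsd_within {}"
    unfolding sd_elem_one by (simp add: Gsd_within_iff determined_by_empty acts_within_id)
qed

lemma finite_Gsd_within: "finite (Gsd_within {..<n})"
proof (rule finite_subset)
  show "Gsd_within {..<n} \<subseteq>
      (\<lambda>(A, \<sigma>). sd_elem A \<sigma>) ` ({A. determined_by {..<n} A} \<times> {\<sigma>. acts_within {..<n} \<sigma>})"
    by (auto simp: Gsd_within_def)
qed (intro finite_imageI finite_cartesian_product finite_determined_by finite_acts_within)

lemma subgroup_Gsd_within: "subgroup (Gsd_within {..<n}) Gsd"
proof (rule group.subgroupI[OF group_Gsd])
  show "Gsd_within {..<n} \<subseteq> carrier Gsd" by (rule Gsd_within_carrier)
  have "sd_elem {} id \<in> Gsd_within {..<n}"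
    by (simp add: Gsd_within_iff determined_by_empty acts_within_id)
  then show "Gsd_within {..<n} \<noteq> {}" by blast
next
  fix g assume "g \<in> Gsd_within {..<n}"
  then obtain A \<sigma> where g_eq: "g = sd_elem A \<sigma>" and A_determined: "determined_by {..<n} A"
      and \<sigma>_acts: "acts_within {..<n} \<sigma>"
    by (rule Gsd_within_cases)
  then show "inv\<^bsub>Gsd\<^esub> g \<in> Gsd_within {..<n}"
    by (simp add: sd_elem_inv determined_by_imp_clopen acts_within_S2inf Gsd_within_iff
        determined_by_image acts_within_inv)
next
  fix g h assume "g \<in> Gsd_within {..<n}" "h \<in> Gsd_within {..<n}"
  then obtain A \<sigma> B \<tau> where g_eq: "g = sd_elem A \<sigma>" and A_determined: "determined_by {..<n} A"
      and \<sigma>_acts: "acts_within {..<n} \<sigma>"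
    and h_eq: "h = sd_elem B \<tau>" and B_determined: "determined_by {..<n} B"
    and \<tau>_acts: "acts_within {..<n} \<tau>"
    by (metis Gsd_within_cases)
  show "g \<otimes>\<^bsub>Gsd\<^esub> h \<in> Gsd_within {..<n}"
    unfolding g_eq h_eq sd_elem_mult[OF acts_withinD(1)[OF \<sigma>_acts]] Gsd_within_iff
    by (intro conjI determined_by_sym_diff determined_by_image acts_within_comp A_determined
      \<sigma>_acts B_determined \<tau>_acts)
qed

lemma carrier_Gsd_within: "carrier Gsd = (\<Union>n. Gsd_within {..<n})"
proof
  show "carrier Gsd \<subseteq> (\<Union>n. Gsd_within {..<n})"
  proof
    fix g assume "g \<in> carrier Gsd"
    then obtain A \<sigma> where g_eq: "g = sd_elem A \<sigma>" and A_clopen: "clopen A" and \<sigma>_S2inf: "\<sigma> \<in> S2inf"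
      by (rule Gsd_cases)
    then obtain n m where "determined_by {..<n} A" "acts_within {..<m} \<sigma>"
      using clopen_iff S2inf_iff by blast
    then have "determined_by {..<max n m} A" "acts_within {..<max n m} \<sigma>"
      by (auto elim!: determined_by_mono acts_within_mono)
    then have "g \<in> Gsd_within {..<max n m}" by (simp add: g_eq Gsd_within_iff)
    then show "g \<in> (\<Union>n. Gsd_within {..<n})" by blast
  qed
qed (use Gsd_within_carrier in blast)

lemma locally_finite_Gsd: "locally_finite_group Gsd (\<lambda>n. Gsd_within {..<n})"
proof (intro locally_finite_group.intro locally_finite_group_axioms.intro)
  show "Gsd_within {..<n} \<subseteq> Gsd_within {..<m}" if "n \<le> m" for n m
    using that by (intro Gsd_within_mono) auto
qed (fact group_Gsd finite_Gsd_within subgroup_Gsd_within carrier_Gsd_within)+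

subsection \<open>Permutations of the coordinates\<close>

definition coord_perm :: "(nat \<Rightarrow> nat) \<Rightarrow> cantor \<Rightarrow> cantor" where
  "coord_perm \<pi> x = x \<circ> \<pi>"

context
  fixes \<pi> :: "nat \<Rightarrow> nat" and N :: nat
  assumes \<pi>_\<pi>: "\<And>k. \<pi> (\<pi> k) = k" and \<pi>_above: "\<And>k. k \<ge> N \<Longrightarrow> \<pi> k = k"
begin

lemma coord_perm_coord_perm: "coord_perm \<pi> (coord_perm \<pi> x) = x"
  by (simp add: coord_perm_def fun_eq_iff \<pi>_\<pi>)

lemma coord_perm_S2inf: "coord_perm \<pi> \<in> S2inf"
proof (rule acts_within_S2inf[OF acts_withinI])
  show "bij (coord_perm \<pi>)" by (rule involuntory_imp_bij[OF coord_perm_coord_perm])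
  show "coord_perm \<pi> x k = x k" if "k \<notin> {..<N}" for x k
    using that by (simp add: coord_perm_def \<pi>_above)
  have "\<pi> k < N" if "k < N" for k using that \<pi>_\<pi> \<pi>_above by (metis not_le)
  then show "agree_on {..<N} (coord_perm \<pi> x) (coord_perm \<pi> y)" if "agree_on {..<N} x y" for x y
    using that by (auto simp: agree_on_def coord_perm_def)
qed

lemma coord_perm_conj:
  assumes "clopen B" "\<tau> \<in> S2inf"
  shows "inv\<^bsub>Gsd\<^esub> (sd_elem {} (coord_perm \<pi>)) \<otimes>\<^bsub>Gsd\<^esub> sd_elem B \<tau> \<otimes>\<^bsub>Gsd\<^esub> sd_elem {} (coord_perm \<pi>)
    = sd_elem (coord_perm \<pi> ` B) (coord_perm \<pi> \<circ> \<tau> \<circ> coord_perm \<pi>)"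
  using sd_elem_conj_involution[OF coord_perm_S2inf coord_perm_coord_perm assms]
  by (simp only: sd_elem_inv_involution[OF coord_perm_S2inf coord_perm_coord_perm])

lemma coord_perm_conj_within:
  assumes g_carrier: "g \<in> carrier Gsd" and g_within: "g \<in> Gsd_within J"
  shows "inv\<^bsub>Gsd\<^esub> (sd_elem {} (coord_perm \<pi>)) \<otimes>\<^bsub>Gsd\<^esub> g \<otimes>\<^bsub>Gsd\<^esub> sd_elem {} (coord_perm \<pi>) \<in>
      Gsd_within (\<pi> ` J)"
proof -
  obtain A \<sigma> where g_eq: "g = sd_elem A \<sigma>" and A_clopen: "clopen A" and \<sigma>_S2inf: "\<sigma> \<in> S2inf"
    using g_carrier by (rule Gsd_cases)
  then have A_determined: "determined_by J A" and \<sigma>_acts: "acts_within J \<sigma>"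
    using g_within by (simp_all add: Gsd_within_iff)
  let ?c = "coord_perm \<pi>"
  have agree: "agree_on J (?c x) (?c y)" if "agree_on (\<pi> ` J) x y" for x y
    using that by (simp add: agree_on_def coord_perm_def)
  have "determined_by (\<pi> ` J) (?c ` A)"
    unfolding determined_by_def mem_image_involution[of ?c, OF coord_perm_coord_perm]
    using determined_byD[OF A_determined] agree by blast
  moreover have "acts_within (\<pi> ` J) (?c \<circ> \<sigma> \<circ> ?c)"
  proof (rule acts_withinI)
    show "bij (?c \<circ> \<sigma> \<circ> ?c)" by (intro S2inf_bij S2inf_comp coord_perm_S2inf \<sigma>_S2inf)
    show "(?c \<circ> \<sigma> \<circ> ?c) x k = x k" if "k \<notin> \<pi> ` J" for x k
    proof -
      have "\<pi> k \<notin> J" using that \<pi>_\<pi> by (metis image_eqI)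
      then show ?thesis
        using acts_withinD(2)[OF \<sigma>_acts, of "\<pi> k" "?c x"] by (simp add: coord_perm_def \<pi>_\<pi>)
    qed
    show "agree_on (\<pi> ` J) ((?c \<circ> \<sigma> \<circ> ?c) x) ((?c \<circ> \<sigma> \<circ> ?c) y)" if "agree_on (\<pi> ` J) x y" for x y
      using acts_withinD(3)[OF \<sigma>_acts agree[OF that]] by (simp add: agree_on_def coord_perm_def \<pi>_\<pi>)
  qed
  ultimately show ?thesis unfolding g_eq coord_perm_conj[OF A_clopen \<sigma>_S2inf] Gsd_within_iff ..
qed

lemma coord_perm_conj_fixed:
  assumes g_carrier: "g \<in> carrier Gsd" and g_within: "g \<in> Gsd_within J"
    and fixed: "\<And>k. k \<in> J \<Longrightarrow> \<pi> k = k"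
  shows "inv\<^bsub>Gsd\<^esub> (sd_elem {} (coord_perm \<pi>)) \<otimes>\<^bsub>Gsd\<^esub> g \<otimes>\<^bsub>Gsd\<^esub> sd_elem {} (coord_perm \<pi>) = g"
proof -
  obtain A \<sigma> where g_eq: "g = sd_elem A \<sigma>" and A_clopen: "clopen A" and \<sigma>_S2inf: "\<sigma> \<in> S2inf"
    using g_carrier by (rule Gsd_cases)
  then have A_determined: "determined_by J A" and \<sigma>_acts: "acts_within J \<sigma>"
    using g_within by (simp_all add: Gsd_within_iff)
  let ?c = "coord_perm \<pi>"
  have agree: "agree_on J (?c x) x" for x by (simp add: agree_on_def coord_perm_def fixed)
  have "?c ` A = A"
    using mem_image_involution[of ?c, OF coord_perm_coord_perm]
      determined_byD[OF A_determined agree] by blast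
  moreover have "(?c \<circ> \<sigma> \<circ> ?c) x k = \<sigma> x k" for x k
  proof (cases "k \<in> J")
    case True
    then show ?thesis
      using acts_withinD(3)[OF \<sigma>_acts agree[of x]] by (simp add: agree_on_def coord_perm_def fixed)
  next
    case False
    then have "\<pi> k \<notin> J" using fixed \<pi>_\<pi> by metis
    then show ?thesis using acts_withinD(2)[OF \<sigma>_acts] False by (simp add: coord_perm_def \<pi>_\<pi>)
  qed
  then have "?c \<circ> \<sigma> \<circ> ?c = \<sigma>" by blast
  ultimately show ?thesis unfolding g_eq coord_perm_conj[OF A_clopen \<sigma>_S2inf] by simp
qed

lemma coord_perm_conj_conj:
  assumes "g \<in> carrier Gsd"
  defines "c \<equiv> sd_elem {} (coord_perm \<pi>)"
  shows "inv\<^bsub>Gsd\<^esub> c \<otimes>\<^bsub>Gsd\<^esub> (inv\<^bsub>Gsd\<^esub> c \<otimes>\<^bsub>Gsd\<^esub> g \<otimes>\<^bsub>Gsd\<^esub> c) \<otimes>\<^bsub>Gsd\<^esub> c = g"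
proof -
  interpret group Gsd by (rule group_Gsd)
  have c_carrier: "c \<in> carrier Gsd"
    unfolding c_def by (intro sd_elem_carrier clopen_empty coord_perm_S2inf)
  have inv_c: "inv\<^bsub>Gsd\<^esub> c = c"
    unfolding c_def by (rule sd_elem_inv_involution[OF coord_perm_S2inf coord_perm_coord_perm])
  have "inv\<^bsub>Gsd\<^esub> c \<otimes>\<^bsub>Gsd\<^esub> (c \<otimes>\<^bsub>Gsd\<^esub> g \<otimes>\<^bsub>Gsd\<^esub> inv\<^bsub>Gsd\<^esub> c) \<otimes>\<^bsub>Gsd\<^esub> c = g"
    using c_carrier assms(1) by (simp add: m_assoc) (simp flip: m_assoc)
  then show ?thesis by (simp only: inv_c)
qed

end

definition block_swap :: "nat \<Rightarrow> nat \<Rightarrow> nat \<Rightarrow> nat" where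
  "block_swap n i k =
    (if n \<le> k \<and> k < n + i then k + i else if n + i \<le> k \<and> k < n + 2 * i then k - i else k)"

lemma block_swap_block_swap: "block_swap n i (block_swap n i k) = k"
  by (auto simp: block_swap_def)

lemma block_swap_above: "k \<ge> n + 2 * i \<Longrightarrow> block_swap n i k = k"
  by (auto simp: block_swap_def)

lemma block_swap_escape:
  assumes g_within: "g \<in> Gsd_within {..<m}" and g_notin_within: "g \<notin> Gsd_within {..<n}"
    and m_le_i: "m \<le> i" and N_le_i: "N \<le> i"
  defines "c \<equiv> sd_elem {} (coord_perm (block_swap n i))"
  shows "inv\<^bsub>Gsd\<^esub> c \<otimes>\<^bsub>Gsd\<^esub> g \<otimes>\<^bsub>Gsd\<^esub> c \<notin> Gsd_within {..<N}"
proof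
  note block_swap = block_swap_block_swap[of n i] block_swap_above[of n i]
  have g_carrier: "g \<in> carrier Gsd" using g_within Gsd_within_carrier by blast
  assume conj_within: "inv\<^bsub>Gsd\<^esub> c \<otimes>\<^bsub>Gsd\<^esub> g \<otimes>\<^bsub>Gsd\<^esub> c \<in> Gsd_within {..<N}"
  then have "inv\<^bsub>Gsd\<^esub> c \<otimes>\<^bsub>Gsd\<^esub> (inv\<^bsub>Gsd\<^esub> c \<otimes>\<^bsub>Gsd\<^esub> g \<otimes>\<^bsub>Gsd\<^esub> c) \<otimes>\<^bsub>Gsd\<^esub> c \<in>
      Gsd_within (block_swap n i ` {..<N})"
    unfolding c_def
    by (intro coord_perm_conj_within[OF block_swap]) (use Gsd_within_carrier in blast)+
  then have "g \<in> Gsd_within (block_swap n i ` {..<N})"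
    unfolding c_def by (simp only: coord_perm_conj_conj[OF block_swap g_carrier])
  then have "g \<in> Gsd_within ({..<m} \<inter> block_swap n i ` {..<N})"
    using g_within Gsd_within_Int by blast
  moreover have "{..<m} \<inter> block_swap n i ` {..<N} \<subseteq> {..<n}"
    using m_le_i N_le_i by (auto simp: block_swap_def split: if_splits)
  ultimately show False using Gsd_within_mono g_notin_within by blast
qed

lemma escaping_Gsd: "escaping_group Gsd (\<lambda>n. Gsd_within {..<n})"
proof (intro escaping_group.intro[OF locally_finite_Gsd] escaping_group_axioms.intro exI conjI allI
    ballI)
  fix n i
  note block_swap = block_swap_block_swap[of n i] block_swap_above[of n i]
  let ?c = "\<lambda>i. sd_elem {} (coord_perm (block_swap n i))"
  show "?c i \<in> carrier Gsd"
    by (intro sd_elem_carrier clopen_empty coord_perm_S2inf[OF block_swap])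
  show "inv\<^bsub>Gsd\<^esub> (?c i) \<otimes>\<^bsub>Gsd\<^esub> g \<otimes>\<^bsub>Gsd\<^esub> ?c i = g" if "g \<in> Gsd_within {..<n}" for g
    by (rule coord_perm_conj_fixed[OF block_swap _ that])
      (use that Gsd_within_carrier in \<open>auto simp: block_swap_def\<close>)
  show "\<forall>\<^sub>F i in sequentially. inv\<^bsub>Gsd\<^esub> (?c i) \<otimes>\<^bsub>Gsd\<^esub> g \<otimes>\<^bsub>Gsd\<^esub> ?c i \<notin> Gsd_within {..<N}"
    if g_carrier: "g \<in> carrier Gsd - Gsd_within {..<n}" for g N
  proof -
    obtain m where "g \<in> Gsd_within {..<m}" using g_carrier carrier_Gsd_within by blast
    then show ?thesis
      using g_carrier by (intro eventually_sequentiallyI[of "max m N"] block_swap_escape) auto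
  qed
qed

subsection \<open>The abelian normal subgroup\<close>

lemma Csub_eq: "Csub = {sd_elem A id | A. clopen A}"
  by (auto simp: Csub_def Ctil_def sd_elem_def)

lemma sd_elem_in_Csub_iff: "sd_elem A \<sigma> \<in> Csub \<longleftrightarrow> clopen A \<and> \<sigma> = id"
proof -
  have "clopen (- A) \<longleftrightarrow> clopen A" by (simp add: clopen_iff determined_by_Compl)
  then show ?thesis by (auto simp: Csub_eq sd_elem_eq_iff)
qed

lemma Csub_cases:
  assumes "f \<in> Csub"
  obtains A where "f = sd_elem A id" "clopen A"
  using assms unfolding Csub_eq by blast

lemma Csub_normal: "Csub \<lhd> Gsd"
proof -
  interpret group Gsd by (rule group_Gsd)
  have "subgroup Csub Gsd"
  proof (rule subgroupI)
    show "Csub \<subseteq> carrier Gsd" unfolding Csub_eq using sd_elem_carrier S2inf_id by blast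
    show "Csub \<noteq> {}" unfolding Csub_eq using clopen_empty by blast
    show "inv\<^bsub>Gsd\<^esub> f \<in> Csub" if "f \<in> Csub" for f
      using that by (auto elim!: Csub_cases simp: sd_elem_inv S2inf_id sd_elem_in_Csub_iff)
    show "f \<otimes>\<^bsub>Gsd\<^esub> h \<in> Csub" if "f \<in> Csub" "h \<in> Csub" for f h
      using that by (auto elim!: Csub_cases simp: sd_elem_mult sd_elem_in_Csub_iff clopen_sym_diff)
  qed
  then show ?thesis
  proof (rule normal_invI)
    fix x h assume "x \<in> carrier Gsd" "h \<in> Csub"
    then obtain A \<sigma> B where x_eq: "x = sd_elem A \<sigma>" and A_clopen: "clopen A"
        and \<sigma>_S2inf: "\<sigma> \<in> S2inf" and h_eq: "h = sd_elem B id" and B_clopen: "clopen B"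
      by (metis Gsd_cases Csub_cases)
    have bij: "bij \<sigma>" using S2inf_bij[OF \<sigma>_S2inf] .
    then have "\<sigma> \<circ> inv_into UNIV \<sigma> = id" using bij_is_surj by (simp only: surj_iff)
    then show "x \<otimes>\<^bsub>Gsd\<^esub> h \<otimes>\<^bsub>Gsd\<^esub> inv\<^bsub>Gsd\<^esub> x \<in> Csub"
      using x_eq A_clopen \<sigma>_S2inf h_eq B_clopen bij
      by (simp add: sd_elem_mult sd_elem_inv sd_elem_in_Csub_iff clopen_sym_diff clopen_image
        S2inf_inv)
  qed
qed

lemma Csub_comm:
  assumes "f \<in> Csub" "h \<in> Csub"
  shows "f \<otimes>\<^bsub>Gsd\<^esub> h = h \<otimes>\<^bsub>Gsd\<^esub> f"
  using assms by (auto elim!: Csub_cases simp: sd_elem_mult Un_commute)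

lemma Csub_comm_group: "comm_group (Gsd\<lparr>carrier := Csub\<rparr>)"
proof -
  interpret group Gsd by (rule group_Gsd)
  have "group (Gsd\<lparr>carrier := Csub\<rparr>)"
    using subgroup_imp_group[OF normal_imp_subgroup[OF Csub_normal]] .
  then show ?thesis by (rule group.group_comm_groupI) (simp add: Csub_comm)
qed

lemma Csub_nontrivial: "Csub \<noteq> {\<one>\<^bsub>Gsd\<^esub>}"
proof -
  let ?A = "{x::cantor. x 0}"
  have "determined_by {..<1} ?A" by (simp add: determined_by_def agree_on_def)
  then have "sd_elem ?A id \<in> Csub" by (simp add: sd_elem_in_Csub_iff determined_by_imp_clopen)
  moreover have "(\<lambda>_. True) \<in> ?A" "(\<lambda>_. False) \<notin> ?A" by simp_all
  then have "sd_elem ?A id \<noteq> \<one>\<^bsub>Gsd\<^esub>" unfolding sd_elem_one sd_elem_eq_iff by blast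
  ultimately show ?thesis by blast
qed

text \<open>
  The second block of \<open>n\<close> coordinates is a copy of the first, which a permutation within the first
  block has to preserve; coordinate \<open>2 * n\<close> keeps the image of the set from being its complement,
  which could happen for \<open>n = 1\<close>.
\<close>

definition generic_set :: "nat \<Rightarrow> cantor set" where
  "generic_set n = {x. x (2 * n) \<and> (\<forall>k<n. x k = x (n + k))}"

lemma determined_by_generic_set: "determined_by {..<2 * n + 1} (generic_set n)"
  by (simp add: determined_by_def agree_on_def generic_set_def)

lemma generic_set_image_eq_imp_id:
  assumes \<rho>_acts: "acts_within {..<n} \<rho>"
    and det: "determined_by {..<n} (sym_diff (generic_set n) (\<rho> ` generic_set n))"
  shows "\<rho> = id"
proof -
  let ?i = "inv_into UNIV \<rho>"
  note i = acts_within_inv[OF \<rho>_acts]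
  have bij: "bij \<rho>" by (rule acts_withinD(1)[OF \<rho>_acts])
  have "?i x k = x k" if k_less_n: "k < n" for x k
  proof -
    define v where "v t j = (if j < n then x j else if j < 2 * n then x (j - n) else t)" for t j
    have "agree_on {..<n} (v t) x" for t by (simp add: agree_on_def v_def)
    then have below: "?i (v t) j = ?i x j" if "j < n" for t j
      using acts_withinD(3)[OF i] that by (simp add: agree_on_def)
    have above: "?i (v t) j = v t j" if "j \<ge> n" for t j using acts_withinD(2)[OF i] that by simp
    have "v t \<in> generic_set n \<longleftrightarrow> t" for t by (simp add: generic_set_def v_def)
    moreover have "?i (v t) \<in> generic_set n \<longleftrightarrow> t \<and> (\<forall>j<n. ?i x j = x j)" for t
      using below above by (auto simp: generic_set_def v_def)
    moreover have "agree_on {..<n} (v True) (v False)" by (simp add: agree_on_def v_def)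
    ultimately have "\<forall>j<n. ?i x j = x j"
      using determined_byD[OF det, of "v True" "v False"] by (simp add: mem_image_bij[OF bij])
    then show ?thesis using k_less_n by blast
  qed
  then have "?i x k = x k" for x k using acts_withinD(2)[OF i, of k x] by (cases "k < n") auto
  then have "?i = id" by (simp add: fun_eq_iff)
  then show ?thesis using inv_inv_eq[OF bij] by (metis inv_id)
qed

lemma generic_element_Csub:
  "generic_element Gsd (Gsd_within {..<n}) Csub (sd_elem (generic_set n) id)"
  unfolding generic_element_def
proof (intro conjI ballI impI)
  let ?B = "generic_set n"
  have clopen: "clopen ?B" by (rule determined_by_imp_clopen[OF determined_by_generic_set])
  then show "sd_elem ?B id \<in> Csub" by (simp add: sd_elem_in_Csub_iff)
  fix r assume r_within: "r \<in> Gsd_within {..<n}"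
    and conj: "inv\<^bsub>Gsd\<^esub> (sd_elem ?B id) \<otimes>\<^bsub>Gsd\<^esub> r \<otimes>\<^bsub>Gsd\<^esub> sd_elem ?B id \<in> Gsd_within {..<n}"
  obtain A \<rho> where r_eq: "r = sd_elem A \<rho>" and A_determined: "determined_by {..<n} A"
      and \<rho>_acts: "acts_within {..<n} \<rho>"
    using r_within by (rule Gsd_within_cases)
  have "determined_by {..<n} (sym_diff (sym_diff ?B A) (\<rho> ` ?B))"
    using conj acts_withinD(1)[OF \<rho>_acts]
    by (simp add: r_eq sd_elem_inv[OF clopen S2inf_id] sd_elem_mult Gsd_within_iff)
  then have "determined_by {..<n} (sym_diff A (sym_diff (sym_diff ?B A) (\<rho> ` ?B)))"
    by (rule determined_by_sym_diff[OF A_determined])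
  moreover have "sym_diff A (sym_diff (sym_diff ?B A) (\<rho> ` ?B)) = sym_diff ?B (\<rho> ` ?B)" by blast
  ultimately have "\<rho> = id" using generic_set_image_eq_imp_id[OF \<rho>_acts] by simp
  then show "r \<in> Csub"
    using determined_by_imp_clopen[OF A_determined] by (simp add: r_eq sd_elem_in_Csub_iff)
qed

subsection \<open>Swaps and flips of cylinders\<close>

definition cyl_swap :: "nat \<Rightarrow> cantor \<Rightarrow> cantor \<Rightarrow> cantor \<Rightarrow> cantor" where
  "cyl_swap m a b = lift_perm m (Transposition.transpose (trunc m a) (trunc m b))"

definition coord_flip :: "nat \<Rightarrow> cantor set \<Rightarrow> cantor \<Rightarrow> cantor" where
  "coord_flip j D x = (if x \<in> D then x(j := \<not> x j) else x)"

lemma trunc_upd: "n \<le> j \<Longrightarrow> trunc n (x(j := v)) = trunc n x"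
  by (auto simp: trunc_def)

lemma trunc_Suc_eq_iff: "trunc (Suc n) x = trunc (Suc n) y \<longleftrightarrow> trunc n x = trunc n y \<and> x n = y n"
  by (auto simp: trunc_eq_iff agree_on_def less_Suc_eq)

lemma transpose_trunc_permutes: "Transposition.transpose (trunc m a) (trunc m b) permutes cube m"
  by (intro permutes_swap_id trunc_in_cube)

lemma trunc_cyl_swap:
  "trunc m (cyl_swap m a b x) = Transposition.transpose (trunc m a) (trunc m b) (trunc m x)"
  unfolding cyl_swap_def by (rule trunc_lift_perm[OF transpose_trunc_permutes])

lemma acts_within_cyl_swap: "acts_within {..<m} (cyl_swap m a b)"
  unfolding cyl_swap_def by (rule acts_within_lift_perm[OF transpose_trunc_permutes])

lemma cyl_swap_cyl_swap: "cyl_swap m a b (cyl_swap m a b x) = x"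
  using lift_perm_comp[OF transpose_trunc_permutes[of m a b], of
    "Transposition.transpose (trunc m a) (trunc m b)"]
  by (simp add: cyl_swap_def lift_perm_id fun_eq_iff)

lemma cyl_swap_commute: "cyl_swap m a b = cyl_swap m b a"
  by (simp add: cyl_swap_def transpose_commute)

lemma cyl_swap_cong: "trunc m a = trunc m a' \<Longrightarrow> trunc m b = trunc m b' \<Longrightarrow>
    cyl_swap m a b = cyl_swap m a' b'"
  by (simp add: cyl_swap_def)

lemma cyl_swap_other:
  assumes "trunc m x \<noteq> trunc m a" "trunc m x \<noteq> trunc m b"
  shows "cyl_swap m a b x = x"
  using assms by (auto simp: cyl_swap_def lift_perm_def trunc_def[of _ x] fun_eq_iff)

lemma mem_cyl_swap_image: "x \<in> cyl_swap m a b ` A \<longleftrightarrow> cyl_swap m a b x \<in> A"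
  by (rule mem_image_involution) (rule cyl_swap_cyl_swap)

lemma cyl_swap_image_eq:
  assumes "determined_by {..<m} A" "a \<in> A \<longleftrightarrow> b \<in> A"
  shows "cyl_swap m a b ` A = A"
proof -
  have "cyl_swap m a b x \<in> A \<longleftrightarrow> x \<in> A" for x
  proof -
    consider (near_a) "trunc m x = trunc m a" | (near_b) "trunc m x = trunc m b"
      | (elsewhere) "trunc m x \<noteq> trunc m a" "trunc m x \<noteq> trunc m b"
      by blast
    then show ?thesis
    proof cases
      case near_a
      then have "trunc m (cyl_swap m a b x) = trunc m b" by (simp add: trunc_cyl_swap)
      then show ?thesis using determined_by_trunc[OF assms(1)] near_a assms(2) by blast
    next
      case near_b
      then have "trunc m (cyl_swap m a b x) = trunc m a" by (simp add: trunc_cyl_swap)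
      then show ?thesis using determined_by_trunc[OF assms(1)] near_b assms(2) by blast
    qed (simp add: cyl_swap_other)
  qed
  then show ?thesis using mem_cyl_swap_image by blast
qed

lemma sym_diff_cyl_swap:
  assumes A_determined: "determined_by {..<m} A" and a_in_A: "a \<in> A" and b_notin_A: "b \<notin> A"
  shows "sym_diff A (cyl_swap m a b ` A) = cyl m a \<union> cyl m b"
proof (intro Set.set_eqI)
  fix x
  consider (near_a) "trunc m x = trunc m a" | (near_b) "trunc m x = trunc m b"
    | (elsewhere) "trunc m x \<noteq> trunc m a" "trunc m x \<noteq> trunc m b"
    by blast
  then show "x \<in> sym_diff A (cyl_swap m a b ` A) \<longleftrightarrow> x \<in> cyl m a \<union> cyl m b"
  proof cases
    case near_a
    then have "trunc m (cyl_swap m a b x) = trunc m b" by (simp add: trunc_cyl_swap)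
    then have "x \<in> A" "cyl_swap m a b x \<notin> A"
      using determined_by_trunc[OF A_determined] near_a a_in_A b_notin_A by blast+
    then show ?thesis using near_a by (simp add: mem_cyl_swap_image cyl_def)
  next
    case near_b
    then have "trunc m (cyl_swap m a b x) = trunc m a" by (simp add: trunc_cyl_swap)
    then have "x \<notin> A" "cyl_swap m a b x \<in> A"
      using determined_by_trunc[OF A_determined] near_b a_in_A b_notin_A by blast+
    then show ?thesis using near_b by (simp add: mem_cyl_swap_image cyl_def)
  qed (simp add: mem_cyl_swap_image cyl_swap_other cyl_def)
qed

lemma cyl_swap_image_not_determined:
  assumes B_determined: "determined_by {..<n} B" and a_in_B: "a \<in> B" and b_notin_B: "b \<notin> B"
  shows "\<not> determined_by {..<n} (cyl_swap (Suc n) (a(n := False)) (b(n := False)) ` B)"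
proof
  let ?c = "cyl_swap (Suc n) (a(n := False)) (b(n := False))"
  assume det: "determined_by {..<n} (?c ` B)"
  have "trunc (Suc n) (?c (a(n := False))) = trunc (Suc n) (b(n := False))"
    by (simp add: trunc_cyl_swap)
  then have "trunc n (?c (a(n := False))) = trunc n b" by (simp add: trunc_Suc_eq_iff trunc_upd)
  then have "a(n := False) \<notin> ?c ` B"
    using determined_by_trunc[OF B_determined, of "?c (a(n := False))" b] b_notin_B
    by (simp add: mem_cyl_swap_image)
  moreover have "?c (a(n := True)) = a(n := True)"
    by (rule cyl_swap_other) (simp_all add: trunc_Suc_eq_iff)
  then have "a(n := True) \<in> ?c ` B"
    using determined_by_trunc[OF B_determined, of "a(n := True)" a] a_in_B
    by (simp add: mem_cyl_swap_image trunc_upd)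
  ultimately show False
    using determined_by_trunc[OF det, of "a(n := True)" "a(n := False)"] by (simp add: trunc_upd)
qed

lemma cyl_swap_conj:
  assumes h_acts: "acts_within {..<m} h"
  shows "h \<circ> cyl_swap m u v \<circ> inv_into UNIV h = cyl_swap m (h u) (h v)"
proof -
  obtain p where p_permutes: "p permutes cube m" and h_eq: "h = lift_perm m p"
    using acts_within_imp_lift_perm[OF h_acts] .
  let ?t = "Transposition.transpose (trunc m u) (trunc m v)"
    and ?t' = "Transposition.transpose (p (trunc m u)) (p (trunc m v))"
  have "p \<circ> ?t = ?t' \<circ> p"
    using transpose_comp_eq[OF permutes_bij[OF p_permutes]] permutes_inverses(2)[OF p_permutes]
    by simp
  then have "h \<circ> cyl_swap m u v = cyl_swap m (h u) (h v) \<circ> h"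
    unfolding cyl_swap_def h_eq trunc_lift_perm[OF p_permutes]
    by (simp only: lift_perm_comp[OF p_permutes] lift_perm_comp[OF transpose_trunc_permutes])
  then have "h \<circ> cyl_swap m u v \<circ> inv_into UNIV h = cyl_swap m (h u) (h v) \<circ> (h \<circ> inv_into UNIV h)"
    by (simp only: comp_assoc)
  then show ?thesis
    using bij_is_surj[OF acts_withinD(1)[OF h_acts]] by (simp only: surj_iff comp_id)
qed

lemma acts_within_two_transitive:
  assumes "trunc j x \<noteq> trunc j y" "trunc j x' \<noteq> trunc j y'"
  obtains h where "acts_within {..<j} h" "trunc j (h x) = trunc j x'" "trunc j (h y) = trunc j y'"
proof -
  let ?s = "cyl_swap j x x'"
  let ?h = "cyl_swap j (?s y) y' \<circ> ?s"
  have s_x: "trunc j (?s x) = trunc j x'" by (simp add: trunc_cyl_swap)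
  then have "trunc j (?s y) \<noteq> trunc j x'"
    using assms(1) acts_within_trunc_iff[OF acts_within_cyl_swap] by metis
  then have "trunc j (?h x) = trunc j x'"
    using s_x assms(2) by (simp add: trunc_cyl_swap[of j "?s y"])
  moreover have "trunc j (?h y) = trunc j y'" by (simp add: trunc_cyl_swap[of j "?s y"])
  moreover have "acts_within {..<j} ?h" by (intro acts_within_comp acts_within_cyl_swap)
  ultimately show ?thesis using that by blast
qed

lemma trunc_coord_flip: "n \<le> j \<Longrightarrow> trunc n (coord_flip j D x) = trunc n x"
  by (simp add: coord_flip_def trunc_upd)

lemma mem_coord_flip: "determined_by {..<j} B \<Longrightarrow> coord_flip j D x \<in> B \<longleftrightarrow> x \<in> B"
  using determined_by_trunc trunc_coord_flip[OF order_refl] by blast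

lemma coord_flip_coord_flip: "determined_by {..<j} D \<Longrightarrow> coord_flip j D (coord_flip j D x) = x"
  using mem_coord_flip[of j D D x] by (auto simp: coord_flip_def)

lemma acts_within_coord_flip:
  assumes "determined_by {..<j} D"
  shows "acts_within {..<Suc j} (coord_flip j D)"
proof (rule acts_withinI)
  show "bij (coord_flip j D)"
    by (rule involuntory_imp_bij[OF coord_flip_coord_flip[OF assms]])
  fix x y assume xy_agree: "agree_on {..<Suc j} x y"
  then have "x \<in> D \<longleftrightarrow> y \<in> D" by (intro determined_byD[OF assms]) (simp add: agree_on_def)
  then show "agree_on {..<Suc j} (coord_flip j D x) (coord_flip j D y)"
    using xy_agree by (simp add: coord_flip_def agree_on_def)
qed (simp add: coord_flip_def)

lemma coord_flip_image_eq:
  assumes "determined_by {..<j} D" "determined_by {..<j} B"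
  shows "coord_flip j D ` B = B"
  using mem_image_involution[of "coord_flip j D", OF coord_flip_coord_flip[OF assms(1)]]
    mem_coord_flip[OF assms(2)] by blast

lemma acts_within_fun_upd:
  assumes "acts_within {..<j} h"
  shows "h (x(j := v)) = (h x)(j := v)"
proof
  fix k
  have "trunc j (h (x(j := v))) = trunc j (h x)"
    by (simp add: acts_within_trunc_iff[OF assms] trunc_upd)
  then show "h (x(j := v)) k = ((h x)(j := v)) k"
    using acts_withinD(2)[OF assms, of k] by (cases "k < j") (auto simp: trunc_eq_iff agree_on_def)
qed

lemma coord_flip_apply_conj:
  assumes h_acts: "acts_within {..<j} h"
  shows "h (coord_flip j D x) = coord_flip j (h ` D) (h x)"
proof -
  have "h x j = x j" using acts_withinD(2)[OF h_acts] by simp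
  moreover have "h x \<in> h ` D \<longleftrightarrow> x \<in> D"
    using acts_withinD(1)[OF h_acts] by (simp add: bij_is_inj inj_image_mem_iff)
  ultimately show ?thesis by (simp add: coord_flip_def acts_within_fun_upd[OF h_acts])
qed

lemma coord_flip_conj:
  assumes h_acts: "acts_within {..<j} h"
  shows "h \<circ> coord_flip j D \<circ> inv_into UNIV h = coord_flip j (h ` D)"
  using acts_withinD(1)[OF h_acts]
  by (simp add: fun_eq_iff coord_flip_apply_conj[OF h_acts] bij_is_surj surj_f_inv_f)

lemma coord_flip_Un:
  assumes "determined_by {..<j} D" "D \<inter> D' = {}"
  shows "coord_flip j D (coord_flip j D' x) = coord_flip j (D \<union> D') x"
  using mem_coord_flip[OF assms(1), of D' x] assms(2) by (auto simp: coord_flip_def)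

lemma determined_by_cyl: "determined_by {..<n} (cyl n x)"
  by (simp add: determined_by_def cyl_def flip: trunc_eq_iff)

lemma determined_by_two_cyl: "determined_by {..<n} (cyl n x \<union> cyl n y)"
  by (intro determined_by_Un determined_by_cyl)

lemma cyl_image:
  assumes "acts_within {..<j} h"
  shows "h ` cyl j x = cyl j (h x)"
proof (intro Set.set_eqI)
  fix y
  have bij: "bij h" using acts_withinD(1)[OF assms] .
  have "trunc j (inv_into UNIV h y) = trunc j x \<longleftrightarrow> trunc j (h (inv_into UNIV h y)) = trunc j (h x)"
    by (simp only: acts_within_trunc_iff[OF assms])
  then show "y \<in> h ` cyl j x \<longleftrightarrow> y \<in> cyl j (h x)"
    using bij by (simp add: mem_image_bij cyl_def bij_is_surj surj_f_inv_f)
qed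

lemma cyl_disjoint: "trunc j x \<noteq> trunc j y \<Longrightarrow> cyl j x \<inter> cyl j y = {}"
  by (auto simp: cyl_def)

lemma cyl_split: "cyl (Suc j) (a(j := False)) \<union> cyl (Suc j) (a(j := True)) = cyl j a"
  by (auto simp: cyl_def trunc_Suc_eq_iff trunc_upd)

lemma determined_by_eq_Union_cyl: "determined_by {..<m} D \<Longrightarrow> D = (\<Union>v\<in>D \<inter> cube m. cyl m v)"
proof (intro Set.set_eqI iffI)
  fix x assume D_determined: "determined_by {..<m} D" and "x \<in> D"
  then have "trunc m x \<in> D \<inter> cube m"
    using determined_by_trunc[OF D_determined, of x "trunc m x"]
    by (simp add: trunc_trunc trunc_in_cube)
  then show "x \<in> (\<Union>v\<in>D \<inter> cube m. cyl m v)" by (rule UN_I) (simp add: cyl_def trunc_trunc)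
next
  fix x assume D_determined: "determined_by {..<m} D" and "x \<in> (\<Union>v\<in>D \<inter> cube m. cyl m v)"
  then obtain v where "v \<in> D" "trunc m x = trunc m v" by (auto simp: cyl_def)
  then show "x \<in> D" using determined_by_trunc[OF D_determined] by blast
qed

lemma coord_flip_cyl_eq_cyl_swap:
  "coord_flip j (cyl j a) = cyl_swap (Suc j) (a(j := False)) (a(j := True))"
proof
  fix x
  let ?c = "cyl_swap (Suc j) (a(j := False)) (a(j := True))"
  show "coord_flip j (cyl j a) x = ?c x"
  proof (cases "trunc j x = trunc j a")
    case True
    let ?y = "x(j := \<not> x j)"
    have "trunc (Suc j) x = trunc (Suc j) (a(j := x j))"
        "trunc (Suc j) ?y = trunc (Suc j) (a(j := \<not> x j))"
      using True by (simp_all add: trunc_Suc_eq_iff trunc_upd)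
    then have "trunc (Suc j) (?c x) = trunc (Suc j) ?y"
      unfolding trunc_cyl_swap by (cases "x j") simp_all
    moreover have "?c x k = ?y k" if "k \<ge> Suc j" for k
      using acts_withinD(2)[OF acts_within_cyl_swap, of k] that by simp
    ultimately have "?c x k = ?y k" for k
      by (cases "k < Suc j") (simp_all add: trunc_eq_iff agree_on_def)
    then show ?thesis using True by (auto simp: coord_flip_def cyl_def)
  next
    case False
    then have "?c x = x" by (intro cyl_swap_other) (simp_all add: trunc_Suc_eq_iff trunc_upd)
    then show ?thesis using False by (simp add: coord_flip_def cyl_def)
  qed
qed

lemma cyl_swap_coord_flip_commute:
  assumes D_determined: "determined_by {..<j} D" and j_le_m: "j \<le> m" and a_notin_D: "a \<notin> D"
    and b_notin_D: "b \<notin> D"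
  shows "cyl_swap m a b \<circ> coord_flip j D = coord_flip j D \<circ> cyl_swap m a b"
proof
  fix x
  have D_determined_m: "determined_by {..<m} D"
    by (rule determined_by_mono[OF D_determined]) (use j_le_m in auto)
  then have fixes_D: "cyl_swap m a b z = z" if "z \<in> D" for z
    using determined_by_trunc[OF D_determined_m] that a_notin_D b_notin_D
    by (intro cyl_swap_other) blast+
  have mem: "cyl_swap m a b x \<in> D \<longleftrightarrow> x \<in> D"
    using cyl_swap_image_eq[OF D_determined_m, of a b] a_notin_D b_notin_D
      mem_cyl_swap_image[of x m a b D] by simp
  show "(cyl_swap m a b \<circ> coord_flip j D) x = (coord_flip j D \<circ> cyl_swap m a b) x"
  proof (cases "x \<in> D")
    case True
    then show ?thesis using fixes_D mem_coord_flip[OF D_determined, of D x] by simp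
  qed (simp add: coord_flip_def mem)
qed

lemma point_outside_two_cyl:
  assumes n_less_j: "n < j" and xy_distinct: "trunc n x \<noteq> trunc n y"
  obtains u where "trunc n u = trunc n w" "u \<notin> cyl j x \<union> cyl j y"
proof -
  define u where "u = w(n := (if trunc n w = trunc n x then \<not> x n else \<not> y n))"
  have u_near_w: "trunc n u = trunc n w" by (simp add: u_def trunc_upd)
  have agree: "trunc n u = trunc n z \<and> u n = z n" if "trunc j u = trunc j z" for z
    using trunc_eq_mono[OF that Suc_leI[OF n_less_j]] by (simp add: trunc_Suc_eq_iff)
  have "u \<notin> cyl j x"
  proof
    assume "u \<in> cyl j x"
    then have "trunc n w = trunc n x" "u n = x n"
      using agree[of x] u_near_w by (simp_all add: cyl_def)
    then show False by (simp add: u_def)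
  qed
  moreover have "u \<notin> cyl j y"
  proof
    assume "u \<in> cyl j y"
    then have "trunc n w = trunc n y" "u n = y n"
      using agree[of y] u_near_w by (simp_all add: cyl_def)
    then show False using xy_distinct by (simp add: u_def)
  qed
  ultimately show ?thesis using u_near_w that by blast
qed

subsection \<open>Normal subgroups of the group\<close>

context
  fixes N :: "(cantor set set \<times> (cantor \<Rightarrow> cantor)) set"
  assumes N_normal: "N \<lhd> Gsd"
begin

lemma normal_mult: "a \<in> N \<Longrightarrow> b \<in> N \<Longrightarrow> a \<otimes>\<^bsub>Gsd\<^esub> b \<in> N"
  using subgroup.m_closed[OF normal_imp_subgroup[OF N_normal]] .

lemma normal_id: "sd_elem {} id \<in> N"
  using subgroup.one_closed[OF normal_imp_subgroup[OF N_normal]] by (simp only: sd_elem_one)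

lemma normal_sd_elem_conj:
  assumes "sd_elem B \<tau> \<in> N" "clopen B" "\<tau> \<in> S2inf" "h \<in> S2inf"
  shows "sd_elem (h ` B) (h \<circ> \<tau> \<circ> inv_into UNIV h) \<in> N"
proof -
  have "sd_elem {} h \<otimes>\<^bsub>Gsd\<^esub> sd_elem B \<tau> \<otimes>\<^bsub>Gsd\<^esub> inv\<^bsub>Gsd\<^esub> (sd_elem {} h) \<in> N"
    using group.normal_invE(2)[OF group_Gsd N_normal] assms(1)
      sd_elem_carrier[OF clopen_empty assms(4)] by blast
  then show ?thesis by (simp only: sd_elem_conj[OF assms(4,2,3)])
qed

lemma normal_set_image:
  assumes "sd_elem B id \<in> N" "clopen B" "h \<in> S2inf"
  shows "sd_elem (h ` B) id \<in> N"
proof -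
  have "h \<circ> inv_into UNIV h = id"
    using bij_is_surj[OF S2inf_bij[OF assms(3)]] by (simp only: surj_iff)
  then show ?thesis using normal_sd_elem_conj[OF assms(1,2) S2inf_id assms(3)] by simp
qed

lemma normal_perm_conj:
  assumes "sd_elem {} \<tau> \<in> N" "\<tau> \<in> S2inf" "h \<in> S2inf"
  shows "sd_elem {} (h \<circ> \<tau> \<circ> inv_into UNIV h) \<in> N"
  using normal_sd_elem_conj[OF assms(1) clopen_empty assms(2,3)] by simp

lemma normal_sym_diff: "sd_elem A id \<in> N \<Longrightarrow> sd_elem B id \<in> N \<Longrightarrow> sd_elem (sym_diff A B) id \<in> N"
  using normal_mult[of "sd_elem A id" "sd_elem B id"] by (simp add: sd_elem_mult)

lemma two_cyl_in_normal:
  assumes A_in_N: "sd_elem A id \<in> N" and A_determined: "determined_by {..<m} A" and a_in_A: "a \<in> A"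
    and b_notin_A: "b \<notin> A"
    and xy_distinct: "trunc m x \<noteq> trunc m y"
  shows "sd_elem (cyl m x \<union> cyl m y) id \<in> N"
proof -
  have "trunc m a \<noteq> trunc m b" using determined_by_trunc[OF A_determined] a_in_A b_notin_A by blast
  then obtain h where h_acts: "acts_within {..<m} h" and h_a: "trunc m (h a) = trunc m x"
      and h_b: "trunc m (h b) = trunc m y"
    using acts_within_two_transitive[OF _ xy_distinct] by blast
  have "sd_elem (cyl_swap m a b ` A) id \<in> N"
    by (rule normal_set_image[OF A_in_N determined_by_imp_clopen[OF A_determined]
      acts_within_S2inf[OF acts_within_cyl_swap]])
  from normal_sym_diff[OF A_in_N this] have "sd_elem (cyl m a \<union> cyl m b) id \<in> N"
    by (simp only: sym_diff_cyl_swap[OF A_determined a_in_A b_notin_A])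
  then have "sd_elem (h ` (cyl m a \<union> cyl m b)) id \<in> N"
    by (rule normal_set_image[OF _ determined_by_imp_clopen[OF determined_by_two_cyl]
      acts_within_S2inf[OF h_acts]])
  then show ?thesis
    using cyl_image[OF h_acts] cyl_cong[OF h_a] cyl_cong[OF h_b] by (simp add: image_Un)
qed

lemma determined_sets_in_normal:
  assumes cyl: "\<And>x. sd_elem (cyl m x) id \<in> N" and D_determined: "determined_by {..<m} D"
  shows "sd_elem D id \<in> N"
proof -
  have "sd_elem (\<Union>v\<in>Q. cyl m v) id \<in> N" if "finite Q" "Q \<subseteq> cube m" for Q
    using that
  proof (induction Q)
    case empty
    then show ?case using normal_id by (simp add: id_def)
  next
    case (insert v Q)
    have "trunc m v \<noteq> trunc m w" if "w \<in> Q" for w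
      using insert.prems insert.hyps(2) that trunc_cube[of v m] trunc_cube[of w m] by auto
    then have "cyl m v \<inter> (\<Union>v\<in>Q. cyl m v) = {}" using cyl_disjoint by blast
    then have "sym_diff (cyl m v) (\<Union>v\<in>Q. cyl m v) = (\<Union>v\<in>insert v Q. cyl m v)" by auto
    moreover have "sd_elem (\<Union>v\<in>Q. cyl m v) id \<in> N" using insert by blast
    ultimately show ?case using normal_sym_diff[OF cyl] by metis
  qed
  from this[of "D \<inter> cube m"] show ?thesis
    using finite_cube by (simp flip: determined_by_eq_Union_cyl[OF D_determined])
qed

lemma Csub_subset_normal:
  assumes f_Csub: "f \<in> Csub" and f_nontrivial: "f \<noteq> \<one>\<^bsub>Gsd\<^esub>" and f_in_N: "f \<in> N"
  shows "Csub \<subseteq> N"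
proof
  fix h assume "h \<in> Csub"
  then obtain D where h_eq: "h = sd_elem D id" and D_clopen: "clopen D" by (rule Csub_cases)
  obtain A where f_eq: "f = sd_elem A id" and A_clopen: "clopen A" using f_Csub by (rule Csub_cases)
  obtain n k where A_determined: "determined_by {..<n} A" and D_determined: "determined_by {..<k} D"
    using A_clopen D_clopen clopen_iff by blast
  define m where "m = max n k"
  have A_determined_Suc: "determined_by {..<Suc m} A" and D_determined_m: "determined_by {..<m} D"
    by (rule determined_by_mono[OF A_determined] determined_by_mono[OF D_determined],
        auto simp: m_def)+
  have "A \<noteq> {}" "A \<noteq> UNIV" using f_nontrivial f_eq by (auto simp: sd_elem_one sd_elem_eq_iff)
  then obtain a b where "a \<in> A" "b \<notin> A" by blast
  then have "sd_elem (cyl (Suc m) (x(m := False)) \<union> cyl (Suc m) (x(m := True))) id \<in> N" for x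
    using f_in_N
    by (intro two_cyl_in_normal[OF _ A_determined_Suc]) (simp_all add: f_eq trunc_Suc_eq_iff)
  then have "sd_elem (cyl m x) id \<in> N" for x by (simp only: cyl_split)
  then show "h \<in> N" unfolding h_eq by (rule determined_sets_in_normal[OF _ D_determined_m])
qed

lemma flip_two_cyl_in_normal:
  assumes xy_distinct: "trunc j x \<noteq> trunc j y"
    and flip_in_N: "sd_elem {} (coord_flip j (cyl j x \<union> cyl j y)) \<in> N"
    and x'y'_distinct: "trunc j x' \<noteq> trunc j y'"
  shows "sd_elem {} (coord_flip j (cyl j x' \<union> cyl j y')) \<in> N"
proof -
  obtain h where h_acts: "acts_within {..<j} h" and h_x: "trunc j (h x) = trunc j x'"
      and h_y: "trunc j (h y) = trunc j y'"
    using acts_within_two_transitive[OF xy_distinct x'y'_distinct] .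
  have "sd_elem {} (h \<circ> coord_flip j (cyl j x \<union> cyl j y) \<circ> inv_into UNIV h) \<in> N"
    by (intro normal_perm_conj flip_in_N acts_within_S2inf[OF h_acts]
        acts_within_S2inf[OF acts_within_coord_flip[OF determined_by_two_cyl]])
  then show ?thesis
    using cyl_image[OF h_acts] cyl_cong[OF h_x] cyl_cong[OF h_y]
    by (simp add: coord_flip_conj[OF h_acts] image_Un)
qed

lemma flip_cyl_in_normal:
  assumes "sd_elem {} (coord_flip (Suc j) (cyl j a)) \<in> N"
  shows "sd_elem {} (coord_flip j (cyl j a)) \<in> N"
proof -
  define \<pi> where "\<pi> = Transposition.transpose j (Suc j)"
  have \<pi>_inv: "\<pi> (\<pi> k) = k" and \<pi>_fixes: "k \<ge> Suc (Suc j) \<Longrightarrow> \<pi> k = k" for k by (auto simp: \<pi>_def)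
  let ?c = "coord_perm \<pi>"
  have "determined_by {..<Suc j} (cyl j a)" by (rule determined_by_mono[OF determined_by_cyl]) auto
  note flip_S2inf = acts_within_S2inf[OF acts_within_coord_flip[OF this]]
  have "sd_elem {} (?c \<circ> coord_flip (Suc j) (cyl j a) \<circ> ?c) \<in> N"
    using normal_perm_conj[OF assms flip_S2inf coord_perm_S2inf[OF \<pi>_inv \<pi>_fixes]]
    by (simp only: inv_involution[of ?c, OF coord_perm_coord_perm[OF \<pi>_inv \<pi>_fixes]])
  moreover have "?c \<circ> coord_flip (Suc j) (cyl j a) \<circ> ?c = coord_flip j (cyl j a)"
  proof
    fix x
    have "?c x \<in> cyl j a \<longleftrightarrow> x \<in> cyl j a"
      by (simp add: cyl_def trunc_eq_iff agree_on_def coord_perm_def \<pi>_def)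
    then show "(?c \<circ> coord_flip (Suc j) (cyl j a) \<circ> ?c) x = coord_flip j (cyl j a) x"
      by (auto simp: coord_flip_def coord_perm_def fun_eq_iff \<pi>_def Transposition.transpose_def
        split: if_splits)
  qed
  ultimately show ?thesis by simp
qed

lemma cyl_swap_in_normal:
  assumes "sd_elem {} (cyl_swap m a b) \<in> N" "trunc m a \<noteq> trunc m b" "trunc m u \<noteq> trunc m v"
  shows "sd_elem {} (cyl_swap m u v) \<in> N"
proof -
  obtain h where h_acts: "acts_within {..<m} h" and h_a: "trunc m (h a) = trunc m u"
      and h_b: "trunc m (h b) = trunc m v"
    using acts_within_two_transitive[OF assms(2,3)] .
  have "sd_elem {} (h \<circ> cyl_swap m a b \<circ> inv_into UNIV h) \<in> N"
    by (intro normal_perm_conj assms(1) acts_within_S2inf[OF h_acts]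
      acts_within_S2inf[OF acts_within_cyl_swap])
  then show ?thesis by (simp only: cyl_swap_conj[OF h_acts] cyl_swap_cong[OF h_a h_b])
qed

lemma lift_perm_in_normal:
  assumes swaps: "\<And>u v. trunc m u \<noteq> trunc m v \<Longrightarrow> sd_elem {} (cyl_swap m u v) \<in> N"
    and p_permutes: "p permutes cube m"
  shows "sd_elem {} (lift_perm m p) \<in> N"
  using p_permutes finite_cube
proof (induction rule: permutes_induct)
  case id
  then show ?case using normal_id by (simp only: lift_perm_id)
next
  case (swap a b p)
  have cube: "trunc m a = a" "trunc m b = b" using swap(1,2) by (simp_all add: trunc_cube)
  have "sd_elem {} (cyl_swap m a b) \<otimes>\<^bsub>Gsd\<^esub> sd_elem {} (lift_perm m p) \<in> N"
    using swap.hyps(3) cube by (intro normal_mult swaps swap.IH) simp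
  moreover have "cyl_swap m a b \<circ> lift_perm m p = lift_perm m (Transposition.transpose a b \<circ> p)"
    using lift_perm_comp[OF swap.hyps(4)] by (simp add: cyl_swap_def cube)
  ultimately show ?case
    by (simp add: sd_elem_mult acts_withinD(1)[OF acts_within_cyl_swap] comp_def)
qed

lemma perm_in_normal:
  assumes flips: "\<And>j. n < j \<Longrightarrow>
      \<exists>x y. trunc n x \<noteq> trunc n y \<and> sd_elem {} (coord_flip j (cyl j x \<union> cyl j y)) \<in> N"
    and \<sigma>_S2inf: "\<sigma> \<in> S2inf"
  shows "sd_elem {} \<sigma> \<in> N"
proof -
  obtain k where \<sigma>_acts: "acts_within {..<k} \<sigma>" using \<sigma>_S2inf S2inf_iff by blast
  define j where "j = max k (Suc n)"
  have n_less_j: "n < j" and n_less_Suc_j: "n < Suc j" by (auto simp: j_def)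
  have "acts_within {..<Suc j} \<sigma>" by (rule acts_within_mono[OF \<sigma>_acts]) (auto simp: j_def)
  then obtain p where p_permutes: "p permutes cube (Suc j)" and \<sigma>_eq: "\<sigma> = lift_perm (Suc j) p"
    by (rule acts_within_imp_lift_perm)
  define a :: cantor where "a = (\<lambda>_. False)"
  obtain x y where xy_distinct: "trunc n x \<noteq> trunc n y"
      and flip_in_N: "sd_elem {} (coord_flip (Suc j) (cyl (Suc j) x \<union> cyl (Suc j) y)) \<in> N"
    using flips[OF n_less_Suc_j] by blast
  have "trunc (Suc j) x \<noteq> trunc (Suc j) y"
    using xy_distinct trunc_eq_mono n_less_Suc_j less_imp_le by blast
  then have "sd_elem {}
      (coord_flip (Suc j) (cyl (Suc j) (a(j := False)) \<union> cyl (Suc j) (a(j := True)))) \<in> N"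
    by (rule flip_two_cyl_in_normal[OF _ flip_in_N]) (simp add: trunc_Suc_eq_iff)
  then have "sd_elem {} (coord_flip j (cyl j a)) \<in> N"
    unfolding cyl_split by (rule flip_cyl_in_normal)
  then have "sd_elem {} (cyl_swap (Suc j) u v) \<in> N" if "trunc (Suc j) u \<noteq> trunc (Suc j) v" for u v
    unfolding coord_flip_cyl_eq_cyl_swap
    by (rule cyl_swap_in_normal[OF _ _ that]) (simp add: trunc_Suc_eq_iff)
  then show ?thesis unfolding \<sigma>_eq by (rule lift_perm_in_normal[OF _ p_permutes])
qed

end

lemma commutator_coord_flip:
  assumes C_determined: "determined_by {..<j} C" and \<sigma>_acts: "acts_within {..<j} \<sigma>"
    and y_moved: "trunc j (\<sigma> y) \<noteq> trunc j y"
  defines "c \<equiv> sd_elem {} (coord_flip j (cyl j (\<sigma> y)))"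
  shows "commutator Gsd (sd_elem C \<sigma>) c = sd_elem {} (coord_flip j (cyl j (\<sigma> y) \<union> cyl j y))"
proof -
  let ?D = "cyl j (\<sigma> y)" and ?i = "inv_into UNIV \<sigma>"
  have bij: "bij \<sigma>" "bij ?i" "bij (coord_flip j ?D)"
    using acts_withinD(1)[OF \<sigma>_acts]
      acts_withinD(1)[OF acts_within_coord_flip[OF determined_by_cyl]]
    by (auto intro: bij_imp_bij_inv)
  have inv_c: "inv\<^bsub>Gsd\<^esub> c = c"
    unfolding c_def
    by (rule sd_elem_inv_involution[OF acts_within_S2inf[OF acts_within_coord_flip]
          coord_flip_coord_flip]) (rule determined_by_cyl)+
  have "?i \<circ> coord_flip j ?D \<circ> \<sigma> = coord_flip j (cyl j y)"
  proof
    fix z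
    have "?i (coord_flip j ?D (\<sigma> z)) = coord_flip j (?i ` ?D) (?i (\<sigma> z))"
      by (rule coord_flip_apply_conj[OF acts_within_inv[OF \<sigma>_acts]])
    then show "(?i \<circ> coord_flip j ?D \<circ> \<sigma>) z = coord_flip j (cyl j y) z"
      using cyl_image[OF acts_within_inv[OF \<sigma>_acts], of "\<sigma> y"] bij(1) by (simp add: bij_is_inj)
  qed
  moreover have "coord_flip j (cyl j y) \<circ> coord_flip j ?D = coord_flip j (?D \<union> cyl j y)"
    using coord_flip_Un[OF determined_by_cyl cyl_disjoint[OF y_moved[symmetric]]]
    by (simp add: fun_eq_iff Un_commute)
  ultimately have perm: "?i \<circ> coord_flip j ?D \<circ> \<sigma> \<circ> coord_flip j ?D = coord_flip j (?D \<union> cyl j y)"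
    by (simp only:)
  have "(?i \<circ> coord_flip j ?D) ` C = ?i ` C"
    by (simp only: image_comp[symmetric] coord_flip_image_eq[OF determined_by_cyl C_determined])
  then show ?thesis
    unfolding commutator_def inv_c
    unfolding c_def sd_elem_inv[OF determined_by_imp_clopen[OF C_determined]
      acts_within_S2inf[OF \<sigma>_acts]]
    by (simp add: sd_elem_mult bij bij_comp) (simp only: perm)
qed

subsection \<open>Invariant subalgebras of the group von Neumann algebra\<close>

locale Gsd_vNa = generic_invariant_vNa Gsd "\<lambda>n. Gsd_within {..<n}" M Csub for M
begin

lemma cond_exp_supp_conj:
  assumes g_within: "g \<in> Gsd_within {..<n}" and supp: "sd_elem B \<tau> \<in> supp (cond_exp g)"
    and c_acts: "acts_within {..<m} c" and c_inv: "\<And>x. c (c x) = x"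
    and comm: "sd_elem {} c \<otimes>\<^bsub>Gsd\<^esub> g = g \<otimes>\<^bsub>Gsd\<^esub> sd_elem {} c"
  shows "determined_by {..<n} (c ` B)" "acts_within {..<n} (c \<circ> \<tau> \<circ> c)"
proof -
  have within: "sd_elem B \<tau> \<in> Gsd_within {..<n}"
    using cond_exp_supp_stage[OF g_within] supp by blast
  then have B_clopen: "clopen B" and \<tau>_S2inf: "\<tau> \<in> S2inf"
    by (auto simp: Gsd_within_iff intro: determined_by_imp_clopen acts_within_S2inf)
  have "cond_exp g (sd_elem {} c \<otimes>\<^bsub>Gsd\<^esub> sd_elem B \<tau> \<otimes>\<^bsub>Gsd\<^esub> inv\<^bsub>Gsd\<^esub> (sd_elem {} c)) =
      cond_exp g (sd_elem B \<tau>)"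
  proof (rule cond_exp_centralizer[OF _ _ _ comm])
    show "g \<in> carrier Gsd" using g_within Gsd_within_carrier by blast
    show "sd_elem B \<tau> \<in> carrier Gsd" using B_clopen \<tau>_S2inf by (rule sd_elem_carrier)
    show "sd_elem {} c \<in> carrier Gsd"
      by (intro sd_elem_carrier clopen_empty acts_within_S2inf[OF c_acts])
  qed
  then have "sd_elem (c ` B) (c \<circ> \<tau> \<circ> c) \<in> supp (cond_exp g)"
    using supp sd_elem_conj_involution[OF acts_within_S2inf[OF c_acts] c_inv B_clopen \<tau>_S2inf]
    by (simp add: supp_def)
  then have "sd_elem (c ` B) (c \<circ> \<tau> \<circ> c) \<in> Gsd_within {..<n}"
    using cond_exp_supp_stage[OF g_within] by blast
  then show "determined_by {..<n} (c ` B)" "acts_within {..<n} (c \<circ> \<tau> \<circ> c)"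
    by (simp_all add: Gsd_within_iff)
qed

lemma cond_exp_supp_swap_invariant:
  assumes g_within: "g \<in> Gsd_within {..<n}" and supp: "sd_elem B \<tau> \<in> supp (cond_exp g)"
    and comm: "sd_elem {} (cyl_swap (Suc n) (a(n := False)) (b(n := False))) \<otimes>\<^bsub>Gsd\<^esub> g
      = g \<otimes>\<^bsub>Gsd\<^esub> sd_elem {} (cyl_swap (Suc n) (a(n := False)) (b(n := False)))"
  shows "a \<in> B \<longleftrightarrow> b \<in> B"
proof -
  have B_determined: "determined_by {..<n} B"
    using cond_exp_supp_stage[OF g_within] supp Gsd_within_iff by blast
  have det: "determined_by {..<n} (cyl_swap (Suc n) (a(n := False)) (b(n := False)) ` B)"
    by (rule cond_exp_supp_conj(1)[OF g_within supp acts_within_cyl_swap cyl_swap_cyl_swap comm])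
  show ?thesis
    using cyl_swap_image_not_determined[OF B_determined, of a b]
      cyl_swap_image_not_determined[OF B_determined, of b a]
      det cyl_swap_commute[of "Suc n" "a(n := False)"] by metis
qed

lemma perm_commutes_with_set:
  assumes "bij c" "c ` A = A"
  shows "sd_elem {} c \<otimes>\<^bsub>Gsd\<^esub> sd_elem A id = sd_elem A id \<otimes>\<^bsub>Gsd\<^esub> sd_elem {} c"
  using assms by (simp add: sd_elem_mult)

lemma cond_exp_Csub_supp_perm:
  assumes A_determined: "determined_by {..<n} A"
    and supp: "sd_elem B \<tau> \<in> supp (cond_exp (sd_elem A id))"
  shows "\<tau> = id"
proof (rule ccontr)
  have A_within: "sd_elem A id \<in> Gsd_within {..<n}"
    using A_determined acts_within_id by (simp add: Gsd_within_iff)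
  have \<tau>_acts: "acts_within {..<n} \<tau>"
    using cond_exp_supp_stage[OF A_within] supp by (auto simp: Gsd_within_iff)
  assume "\<tau> \<noteq> id"
  then obtain x where "\<tau> x \<noteq> x" by (auto simp: fun_eq_iff)
  then have moved: "trunc n (\<tau> x) \<noteq> trunc n x" by (simp add: acts_within_fixed_iff[OF \<tau>_acts])
  let ?c = "coord_flip n (cyl n x)"
  have "acts_within {..<n} (?c \<circ> \<tau> \<circ> ?c)"
    by (rule cond_exp_supp_conj(2)[OF A_within supp acts_within_coord_flip[OF determined_by_cyl]
          coord_flip_coord_flip[OF determined_by_cyl]
          perm_commutes_with_set[OF _ coord_flip_image_eq[OF determined_by_cyl A_determined]]])
      (rule acts_withinD(1)[OF acts_within_coord_flip[OF determined_by_cyl]])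
  then have "(?c \<circ> \<tau> \<circ> ?c) x n = x n" by (rule acts_withinD(2)) simp
  moreover have "\<tau> (?c x) \<notin> cyl n x"
    using moved acts_within_trunc_iff[OF \<tau>_acts, of "?c x" x]
    by (simp add: cyl_def trunc_coord_flip)
  then have "(?c \<circ> \<tau> \<circ> ?c) x n = (\<not> x n)"
    using acts_withinD(2)[OF \<tau>_acts, of n "?c x"] by (simp add: coord_flip_def cyl_self)
  ultimately show False by simp
qed

lemma cond_exp_Csub_supp:
  assumes A_determined: "determined_by {..<n} A"
  shows "supp (cond_exp (sd_elem A id)) \<subseteq> {sd_elem A id, \<one>\<^bsub>Gsd\<^esub>}"
proof
  fix k assume k_supp: "k \<in> supp (cond_exp (sd_elem A id))"
  have A_within: "sd_elem A id \<in> Gsd_within {..<n}"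
    using A_determined acts_within_id by (simp add: Gsd_within_iff)
  have "k \<in> Gsd_within {..<n}" using cond_exp_supp_stage[OF A_within] k_supp by blast
  then obtain B \<tau> where k_eq: "k = sd_elem B \<tau>" by (rule Gsd_within_cases)
  note supp = k_supp[unfolded k_eq]
  have "a \<in> B \<longleftrightarrow> b \<in> B" if ab_same_side: "a \<in> A \<longleftrightarrow> b \<in> A" for a b
  proof (rule cond_exp_supp_swap_invariant[OF A_within supp perm_commutes_with_set])
    show "bij (cyl_swap (Suc n) (a(n := False)) (b(n := False)))"
      by (rule acts_withinD(1)[OF acts_within_cyl_swap])
    show "cyl_swap (Suc n) (a(n := False)) (b(n := False)) ` A = A"
    proof (rule cyl_swap_image_eq[OF determined_by_mono[OF A_determined]])
      have "x(n := False) \<in> A \<longleftrightarrow> x \<in> A" for x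
        by (rule determined_by_trunc[OF A_determined]) (simp add: trunc_upd)
      then show "a(n := False) \<in> A \<longleftrightarrow> b(n := False) \<in> A" using ab_same_side by simp
    qed auto
  qed
  then have "B = {} \<or> B = UNIV \<or> B = A \<or> B = - A" by blast
  then show "k \<in> {sd_elem A id, \<one>\<^bsub>Gsd\<^esub>}"
    using cond_exp_Csub_supp_perm[OF A_determined supp]
    by (auto simp: k_eq sd_elem_one sd_elem_eq_iff)
qed

lemma Csub_in_group_part:
  assumes f_Csub: "f \<in> Csub" and f_nontrivial: "f \<noteq> \<one>\<^bsub>Gsd\<^esub>" and nonzero: "cond_exp f f \<noteq> 0"
  shows "f \<in> group_part"
proof (rule group_part_if_cond_exp_supp[OF A_carrier[OF f_Csub] _ nonzero])
  obtain A where f_eq: "f = sd_elem A id" and A_clopen: "clopen A" using f_Csub by (rule Csub_cases)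
  obtain n where "determined_by {..<n} A" using A_clopen by (rule clopen_imp_determined_by)
  then have "supp (cond_exp f) \<subseteq> {f, \<one>\<^bsub>Gsd\<^esub>}" unfolding f_eq by (rule cond_exp_Csub_supp)
  then show "supp (cond_exp f) \<subseteq> {f}"
    using cond_exp_one[OF A_carrier[OF f_Csub] f_nontrivial] by (auto simp: supp_def)
qed

lemma cond_exp_two_flips_independent:
  assumes n_less_j: "n < j" and xy_distinct: "trunc n x \<noteq> trunc n y"
    and B_determined: "determined_by {..<n} B" and B_nontrivial: "sd_elem B id \<noteq> \<one>\<^bsub>Gsd\<^esub>"
  defines "\<rho> \<equiv> coord_flip j (cyl j x \<union> cyl j y)"
  shows "cond_exp (sd_elem {} \<rho>) (sd_elem B \<rho>) = 0"
proof (rule ccontr)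
  let ?D = "cyl j x \<union> cyl j y"
  have \<rho>_acts: "acts_within {..<Suc j} \<rho>"
    unfolding \<rho>_def by (rule acts_within_coord_flip[OF determined_by_two_cyl])
  assume "cond_exp (sd_elem {} \<rho>) (sd_elem B \<rho>) \<noteq> 0"
  then have supp: "sd_elem B \<rho> \<in> supp (cond_exp (sd_elem {} \<rho>))" by (simp add: supp_def)
  have within: "sd_elem {} \<rho> \<in> Gsd_within {..<Suc j}"
    using \<rho>_acts by (simp add: Gsd_within_iff determined_by_empty)
  have "B \<noteq> {}" "B \<noteq> UNIV" using B_nontrivial by (auto simp: sd_elem_one sd_elem_eq_iff)
  then obtain w w' where w_in_B: "w \<in> B" and w'_notin_B: "w' \<notin> B" by blast
  obtain u where u_near_w: "trunc n u = trunc n w" and u_notin_D: "u \<notin> ?D"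
    by (rule point_outside_two_cyl[OF n_less_j xy_distinct])
  obtain v where v_near_w': "trunc n v = trunc n w'" and v_notin_D: "v \<notin> ?D"
    by (rule point_outside_two_cyl[OF n_less_j xy_distinct])
  let ?c = "cyl_swap (Suc (Suc j)) (u(Suc j := False)) (v(Suc j := False))"
  have "?c \<circ> \<rho> = \<rho> \<circ> ?c"
    unfolding \<rho>_def by (rule cyl_swap_coord_flip_commute[OF determined_by_two_cyl])
      (use u_notin_D v_notin_D in \<open>auto simp: cyl_def trunc_upd\<close>)
  then have "sd_elem {} ?c \<otimes>\<^bsub>Gsd\<^esub> sd_elem {} \<rho> = sd_elem {} \<rho> \<otimes>\<^bsub>Gsd\<^esub> sd_elem {} ?c"
    by (simp add: sd_elem_mult acts_withinD(1)[OF acts_within_cyl_swap] acts_withinD(1)[OF \<rho>_acts])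
  then have "u \<in> B \<longleftrightarrow> v \<in> B" by (rule cond_exp_supp_swap_invariant[OF within supp])
  then show False
    using determined_by_trunc[OF B_determined] u_near_w v_near_w' w_in_B w'_notin_B by blast
qed

lemma flip_in_group_part:
  assumes Csub: "Csub \<subseteq> group_part" and g_within: "sd_elem C \<sigma> \<in> Gsd_within {..<n}"
    and nonzero: "cond_exp (sd_elem C \<sigma>) (sd_elem C \<sigma>) \<noteq> 0" and \<sigma>_nontrivial: "\<sigma> \<noteq> id"
    and n_less_j: "n < j"
  shows "\<exists>x y. trunc n x \<noteq> trunc n y \<and> sd_elem {} (coord_flip j (cyl j x \<union> cyl j y)) \<in> group_part"
proof -
  have C_determined: "determined_by {..<n} C" and \<sigma>_acts: "acts_within {..<n} \<sigma>"
    using g_within by (simp_all add: Gsd_within_iff)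
  have C\<sigma>_within_j: "determined_by {..<j} C" "acts_within {..<j} \<sigma>"
    using determined_by_mono[OF C_determined] acts_within_mono[OF \<sigma>_acts] n_less_j by auto
  obtain y where "\<sigma> y \<noteq> y" using \<sigma>_nontrivial by (auto simp: fun_eq_iff)
  then have y_moved: "trunc n (\<sigma> y) \<noteq> trunc n y" by (simp add: acts_within_fixed_iff[OF \<sigma>_acts])
  then have y_moved_j: "trunc j (\<sigma> y) \<noteq> trunc j y" using trunc_eq_mono less_imp_le[OF n_less_j] by blast
  let ?D = "cyl j (\<sigma> y)"
  let ?c = "sd_elem {} (coord_flip j ?D)" and ?\<rho> = "sd_elem {} (coord_flip j (?D \<union> cyl j y))"
  have flip: "acts_within {..<Suc j} (coord_flip j ?D)"
    by (rule acts_within_coord_flip[OF determined_by_cyl])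
  note commutator = commutator_coord_flip[OF C\<sigma>_within_j y_moved_j]
  have "commutator Gsd (sd_elem C \<sigma>) ?c \<in> group_part"
  proof (rule commutator_in_group_part[OF Csub g_within nonzero])
    show "?c \<in> carrier Gsd" by (intro sd_elem_carrier clopen_empty acts_within_S2inf[OF flip])
    fix f assume f_Csub: "f \<in> Csub" and f_within: "f \<in> Gsd_within {..<n}"
    then obtain B where f_eq: "f = sd_elem B id" by (blast elim: Csub_cases)
    have B_determined: "determined_by {..<n} B" using f_within by (simp add: f_eq Gsd_within_iff)
    have "determined_by {..<j} B"
      by (rule determined_by_mono[OF B_determined]) (use n_less_j in auto)
    then show "?c \<otimes>\<^bsub>Gsd\<^esub> f = f \<otimes>\<^bsub>Gsd\<^esub> ?c"
      unfolding f_eq by (intro perm_commutes_with_set acts_withinD(1)[OF flip]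
          coord_flip_image_eq[OF determined_by_cyl])
    assume "f \<noteq> \<one>\<^bsub>Gsd\<^esub>"
    then have "cond_exp ?\<rho> (f \<otimes>\<^bsub>Gsd\<^esub> ?\<rho>) = 0"
      using cond_exp_two_flips_independent[OF n_less_j y_moved B_determined]
      by (simp add: f_eq sd_elem_mult)
    then show "cond_exp (commutator Gsd (sd_elem C \<sigma>) ?c)
        (f \<otimes>\<^bsub>Gsd\<^esub> commutator Gsd (sd_elem C \<sigma>) ?c) = 0"
      by (simp only: commutator)
  qed
  then show ?thesis using y_moved by (auto simp: commutator)
qed

lemma fin_coeffs_supp_group_part:
  assumes a_fin: "a \<in> fin_coeffs"
  shows "supp a \<subseteq> group_part"
proof
  fix k assume k_supp: "k \<in> supp a"
  show "k \<in> group_part"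
  proof (cases "k = \<one>\<^bsub>Gsd\<^esub>")
    case True
    then show ?thesis using subgroup.one_closed[OF group_part_subgroup] by simp
  next
    case False
    then obtain f where "f \<in> Csub" "f \<noteq> \<one>\<^bsub>Gsd\<^esub>" "f \<in> group_part"
      using nontrivial_cond_exp_in_A[OF a_fin k_supp] Csub_in_group_part by blast
    then have Csub: "Csub \<subseteq> group_part" by (rule Csub_subset_normal[OF group_part_normal])
    obtain C \<sigma> where k_eq: "k = sd_elem C \<sigma>" and C_clopen: "clopen C" and \<sigma>_S2inf: "\<sigma> \<in> S2inf"
      using fin_coeffs_supp_carrier[OF a_fin k_supp] by (rule Gsd_cases)
    obtain n where g_within: "sd_elem C \<sigma> \<in> Gsd_within {..<n}"
      using fin_coeffs_supp_carrier[OF a_fin k_supp] carrier_Gsd_within k_eq by blast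
    have "sd_elem {} \<sigma> \<in> group_part"
    proof (cases "\<sigma> = id")
      case True
      then show ?thesis using normal_id[OF group_part_normal] by simp
    next
      case False
      show ?thesis
        using flip_in_group_part[OF Csub g_within
          cond_exp_self_nonzero[OF a_fin k_supp, unfolded k_eq] False]
        by (rule perm_in_normal[OF group_part_normal _ \<sigma>_S2inf])
    qed
    moreover have "sd_elem C id \<in> group_part"
      using Csub C_clopen by (auto simp: sd_elem_in_Csub_iff)
    ultimately have "sd_elem C id \<otimes>\<^bsub>Gsd\<^esub> sd_elem {} \<sigma> \<in> group_part"
      by (intro normal_mult[OF group_part_normal])
    then show ?thesis by (simp add: k_eq sd_elem_mult)
  qed
qed

end

theorem ISR_Gsd: "ISR Gsd"
  unfolding ISR_def
proof (intro allI impI)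
  fix M assume M_invariant: "is_vNa Gsd M \<and> M \<subseteq> grpvN Gsd (carrier Gsd) \<and> G_invariant Gsd M"
  interpret Gsd_vNa M
  proof (intro Gsd_vNa.intro generic_invariant_vNa.intro invariant_vNa.intro
      invariant_vNa_axioms.intro generic_invariant_vNa_axioms.intro)
    show "escaping_group Gsd (\<lambda>n. Gsd_within {..<n})" by (rule escaping_Gsd)
    show "\<exists>f. generic_element Gsd (Gsd_within {..<n}) Csub f" for n
      using generic_element_Csub by blast
  qed (use M_invariant Csub_normal Csub_comm in auto)
  show "\<exists>N. N \<lhd> Gsd \<and> M = grpvN Gsd N"
    using group_part_normal M_eq_grpvN[OF fin_coeffs_supp_group_part] by blast
qed

theorem theorem3p9:
  shows "group Gsd \<and> amenable_grp Gsd \<and> icc_grp Gsd \<and>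
         Csub \<lhd> Gsd \<and> comm_group (Gsd\<lparr>carrier := Csub\<rparr>) \<and> Csub \<noteq> {\<one>\<^bsub>Gsd\<^esub>} \<and>
         ISR Gsd"
proof -
  interpret escaping_group Gsd "\<lambda>n. Gsd_within {..<n}" by (rule escaping_Gsd)
  have "Gsd_within {..<0} = {\<one>\<^bsub>Gsd\<^esub>}" using Gsd_within_empty by simp
  then have "icc_grp Gsd" by (rule icc)
  then show ?thesis
    using group_Gsd amenable Csub_normal Csub_comm_group Csub_nontrivial ISR_Gsd by blast
qed

end
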